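(* Let $P(\xi,\lambda)=\sum_{\alpha,k}a_{\alpha k}\xi^\alpha\lambda^k$ be a polynomial in $\xi\in\mathbb R^n$ and $\lambda\in\mathbb C$ with Newton polygon $N(P)$ satisfying the standing assumptions in the context, and let $\Xi_P$, $\Xi_P^{(-\rho)}$ and $m_1,\dots,m_S$ be the associated weight functions and integers. For every $\lambda_0>0$ there exists a constant $C>0$, independent of $u$ and $\lambda$, such that $$\|D_n^lu(x',0)\|_{\Xi_P^{(-l-\frac12)},\mathbb R^{n-1}}\le C\|u\|_{\Xi_P,\mathbb R^n}\qquad(l=0,\dots,2m_1+\dots+2m_S-1)$$ holds for all $u\in H^{\Xi_P}(\mathbb R^n)$ and all $\lambda\in\mathbb C$ with $|\lambda|\ge\lambda_0$.
   Context: $n\ge2$; $\xi=(\xi',\xi_n)$, $x=(x',x_n)$, $D_n=-i\,\partial/\partial x_n$; $D_n^lu(x',0)$ denotes the trace of $D_n^lu$ on $x_n=0$. Newton polygon. Let $\nu(P)$ be the set of integer points $(i,k)$ such that $a_{\alpha k}\ne0$ for some $\alpha$ with $|\alpha|=i$. $N(P)$ is the convex hull of the points of $\nu(P)$, their projections on the coordinate axes, and the origin. Let its vertices be $(0,0),(a_1,b_1),\dots,(a_{S+1},b_{S+1})$ with $a_1=0$, $b_{S+1}=0$, numbered clockwise, and let $\Gamma_s$ ($s=1,\dots,S$) be the side joining $(a_s,b_s)$ and $(a_{s+1},b_{s+1})$; put $r_s=(a_{s+1}-a_s)/(b_s-b_{s+1})$. Standing assumptions: $\Gamma_S$ is not vertical,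 so $\infty\ge r_1>\dots>r_S>0$ ($r_1=\infty$ is allowed and means that $\Gamma_1$ is horizontal); and the numbers $m_s$ defined by $2m_s=a_{s+1}-a_s$ are integers. Weights. $\Xi_P(\xi,\lambda)=\sum_{(i,k)}|\xi|^i|\lambda|^k$, summed over all integer points $(i,k)$ of $N(P)$. For $|\lambda|\ge\lambda_0>0$ it is equivalent (two-sided bounds with positive constants independent of $\xi,\lambda$) to $\prod_{s=1}^S(|\xi|^2+|\lambda|^{2/r_s})^{m_s}$ (with $|\lambda|^{2/r_1}=1$ if $r_1=\infty$). For $0\le\rho<a_{S+1}$, $\Xi_P^{(-\rho)}$ is the weight function corresponding to the polygon obtained from $N(P)$ by a shift of length $\rho$ to the left, i.e. to $\{(a,b):a\ge0,\ b\ge0,\ (a+\rho,b)\in N(P)\}$; since its vertices need not be integer points, its weight function is taken to be $\sum|\xi|^a|\lambda|^b$ over the vertices $(a,b)$ of this polygon (for polygons $N(P)$ with integer vertices this is equivalent, for $|\lambda|\ge\lambda_0$, to the sum over all integer points). On $\mathbb R^{n-1}$ one uses $\Xi_P^{(-\rho)}(\xi',\lambda):=\Xi_P^{(-\rho)}(\xi',0,\lambda)$. Spaces. For a weight $\sigma$ on $\mathbb R^d$, $H^\sigma(\mathbb R^d)=\{u\in\mathcal S'(\mathbb R^d):\sigma Fu\in L_2(\mathbb R^d)\}$ ($F$ the Fourier transform), with norm $\|u\|_{\sigma,\mathbb R^d}=\|\sigma Fu\|_{L_2(\mathbb R^d)}$. *)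

theory Defs
  imports "HOL-Analysis.Analysis" "HOL-Library.Poly_Mapping"
begin

section \<open>Symbols and Newton polygons\<close>

(* A polynomial P(xi, lambda) = sum a_{alpha,k} xi^alpha lambda^k with xi = (xi', xi_n) in
   R^n = R^(n-1) x R is given by its finitely supported family of coefficients
   a_{alpha,k} = Poly_Mapping.lookup P ((alpha', alpha_n), k), where alpha = (alpha', alpha_n) is a multi-index.
   R^(n-1) is real ^ 'm with CARD('m) = n - 1 >= 1. *)
type_synonym 'm multi_index = "('m \<Rightarrow> nat) \<times> nat"
type_synonym 'm symbol = "('m multi_index \<times> nat) \<Rightarrow>\<^sub>0 complex"

definition mi_order :: "('m::finite) multi_index \<Rightarrow> nat" where
  "mi_order \<alpha> = (\<Sum>j\<in>UNIV. fst \<alpha> j) + snd \<alpha>"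

definition newton_points :: "('m::finite) symbol \<Rightarrow> (nat \<times> nat) set" where
  "newton_points P = {(i, k). \<exists>\<alpha>. mi_order \<alpha> = i \<and> Poly_Mapping.lookup P (\<alpha>, k) \<noteq> 0}"

definition newton_polygon :: "('m::finite) symbol \<Rightarrow> (real \<times> real) set" where
  "newton_polygon P = convex hull
     ((\<lambda>(i, k). (real i, real k)) ` newton_points P
      \<union> (\<lambda>(i, k). (real i, 0)) ` newton_points P
      \<union> (\<lambda>(i, k). (0, real k)) ` newton_points P
      \<union> {(0, 0)})"

(* The turn from q - p to r - p is clockwise iff the cross product of these vectors is negative. *)
definition clockwise_turn :: "real \<times> real \<Rightarrow> real \<times> real \<Rightarrow> real \<times> real \<Rightarrow> bool" where
  "clockwise_turn p q r \<longleftrightarrow>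
     (fst q - fst p) * (snd r - snd p) - (snd q - snd p) * (fst r - fst p) < 0"

definition clockwise_vertices :: "(real \<times> real) list \<Rightarrow> (real \<times> real) set \<Rightarrow> bool" where
  "clockwise_vertices ws K \<longleftrightarrow>
     distinct ws \<and> set ws = {v. v extreme_point_of K} \<and>
     (\<forall>i j k. i < j \<and> j < k \<and> k < length ws \<longrightarrow> clockwise_turn (ws ! i) (ws ! j) (ws ! k))"

section \<open>Weight functions\<close>

(* newton_polygon P is a bounded subset of the closed first quadrant, so its integer points form
   a finite set of pairs of natural numbers. *)
definition newton_weight ::
    "('m::finite) symbol \<Rightarrow> 'a::real_normed_vector \<Rightarrow> complex \<Rightarrow> real" where
  "newton_weight P \<xi> lam =
     (\<Sum>(i, k) \<in> {(i, k). (real i, real k) \<in> newton_polygon P}. norm \<xi> ^ i * cmod lam ^ k)"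

definition shifted_polygon :: "('m::finite) symbol \<Rightarrow> real \<Rightarrow> (real \<times> real) set" where
  "shifted_polygon P \<rho> = {(a, b). 0 \<le> a \<and> 0 \<le> b \<and> (a + \<rho>, b) \<in> newton_polygon P}"

(* 0 powr 0 = 0 in the library, whereas the monomials below need 0^0 = 1. *)
definition real_exp_pow :: "real \<Rightarrow> real \<Rightarrow> real" where
  "real_exp_pow x a = (if a = 0 then 1 else x powr a)"

definition shifted_weight ::
    "('m::finite) symbol \<Rightarrow> real \<Rightarrow> 'a::real_normed_vector \<Rightarrow> complex \<Rightarrow> real" where
  "shifted_weight P \<rho> \<xi> lam =
     (\<Sum>(a, b) \<in> {v. v extreme_point_of shifted_polygon P \<rho>}.
        real_exp_pow (norm \<xi>) a * real_exp_pow (cmod lam) b)"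

section \<open>Schwartz functions and tempered distributions\<close>

definition dir_deriv :: "'a::euclidean_space \<Rightarrow> ('a \<Rightarrow> complex) \<Rightarrow> 'a \<Rightarrow> complex" where
  "dir_deriv b f x = frechet_derivative f (at x) b"

definition iter_deriv :: "'a::euclidean_space list \<Rightarrow> ('a \<Rightarrow> complex) \<Rightarrow> 'a \<Rightarrow> complex" where
  "iter_deriv bs f = foldr dir_deriv bs f"

definition schwartz :: "('a::euclidean_space \<Rightarrow> complex) set" where
  "schwartz = {f. \<forall>bs. set bs \<subseteq> Basis \<longrightarrow>
      iter_deriv bs f differentiable_on UNIV \<and>
      (\<forall>k::nat. bounded (range (\<lambda>x. of_real ((1 + norm x) ^ k) * iter_deriv bs f x)))}"

definition schwartz_norm :: "nat \<Rightarrow> ('a::euclidean_space \<Rightarrow> complex) \<Rightarrow> real" where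
  "schwartz_norm N f =
     (\<Sum>bs \<in> {bs. set bs \<subseteq> Basis \<and> length bs \<le> N}.
        SUP x. (1 + norm x) ^ N * cmod (iter_deriv bs f x))"

(* Distributions are represented by functionals on all functions; only their values on
   the Schwartz space are significant. *)
type_synonym 'a distr = "('a \<Rightarrow> complex) \<Rightarrow> complex"

definition tempered :: "('a::euclidean_space) distr \<Rightarrow> bool" where
  "tempered u \<longleftrightarrow>
     (\<forall>\<phi>\<in>schwartz. \<forall>\<psi>\<in>schwartz. u (\<lambda>x. \<phi> x + \<psi> x) = u \<phi> + u \<psi>) \<and>
     (\<forall>\<phi>\<in>schwartz. \<forall>c. u (\<lambda>x. c * \<phi> x) = c * u \<phi>) \<and>
     (\<exists>C N. \<forall>\<phi>\<in>schwartz. cmod (u \<phi>) \<le> C * schwartz_norm N \<phi>)"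

definition fourier :: "('a::euclidean_space \<Rightarrow> complex) \<Rightarrow> 'a \<Rightarrow> complex" where
  "fourier \<phi> \<xi> =
     of_real ((2 * pi) powr (- real DIM('a) / 2)) *
     integral\<^sup>L lborel (\<lambda>x. cis (- (x \<bullet> \<xi>)) * \<phi> x)"

definition fourier_distr :: "('a::euclidean_space) distr \<Rightarrow> 'a distr" where
  "fourier_distr u = (\<lambda>\<phi>. u (fourier \<phi>))"

definition represents :: "('a::euclidean_space) distr \<Rightarrow> ('a \<Rightarrow> complex) \<Rightarrow> bool" where
  "represents u g \<longleftrightarrow> g \<in> borel_measurable lborel \<and>
     (\<forall>\<phi>\<in>schwartz. integrable lborel (\<lambda>x. g x * \<phi> x) \<and>
                   u \<phi> = integral\<^sup>L lborel (\<lambda>x. g x * \<phi> x))"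

(* D_n = -i d/dx_n on R^(n-1) x R, extended to distributions by duality:
   <D_n u, phi> = - <u, D_n phi> = <u, i d phi/dx_n>. *)
definition D_last :: "('a::euclidean_space \<times> real) distr \<Rightarrow> ('a \<times> real) distr" where
  "D_last u = (\<lambda>\<phi>. u (\<lambda>x. \<i> * dir_deriv (0, 1) \<phi> x))"

(* v is the trace of w on x_n = 0: w is given by a family W t of tempered distributions
   on R^(n-1) depending weakly continuously on t = x_n, i.e. w is in C(R; S'(R^(n-1))), and
   v = W 0. The family, hence v, is uniquely determined by w (on the Schwartz space). *)
definition has_trace :: "('a::euclidean_space \<times> real) distr \<Rightarrow> 'a distr \<Rightarrow> bool" where
  "has_trace w v \<longleftrightarrow> (\<exists>W :: real \<Rightarrow> 'a distr.
     (\<forall>t. tempered (W t)) \<and>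
     (\<forall>\<psi>\<in>schwartz. continuous_on UNIV (\<lambda>t. W t \<psi>)) \<and>
     (\<forall>\<phi>\<in>schwartz. integrable lborel (\<lambda>t. W t (\<lambda>x'. \<phi> (x', t))) \<and>
        w \<phi> = integral\<^sup>L lborel (\<lambda>t. W t (\<lambda>x'. \<phi> (x', t)))) \<and>
     v = W 0)"

section \<open>The spaces \<open>H\<^sup>\<sigma>\<close>\<close>

definition in_L2 :: "('a::euclidean_space \<Rightarrow> complex) \<Rightarrow> bool" where
  "in_L2 f \<longleftrightarrow> f \<in> borel_measurable lborel \<and> integrable lborel (\<lambda>x. (cmod (f x))\<^sup>2)"

definition L2_norm :: "('a::euclidean_space \<Rightarrow> complex) \<Rightarrow> real" where
  "L2_norm f = sqrt (integral\<^sup>L lborel (\<lambda>x. (cmod (f x))\<^sup>2))"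

definition H_space :: "('a::euclidean_space \<Rightarrow> real) \<Rightarrow> 'a distr set" where
  "H_space \<sigma> = {u. tempered u \<and>
     (\<exists>g. represents (fourier_distr u) g \<and> in_L2 (\<lambda>\<xi>. of_real (\<sigma> \<xi>) * g \<xi>))}"

(* The function representing F u is unique up to null sets, so the choice does not matter. *)
definition fourier_fun :: "('a::euclidean_space) distr \<Rightarrow> 'a \<Rightarrow> complex" where
  "fourier_fun u = (SOME g. represents (fourier_distr u) g)"

definition H_norm :: "('a::euclidean_space \<Rightarrow> real) \<Rightarrow> 'a distr \<Rightarrow> real" where
  "H_norm \<sigma> u = L2_norm (\<lambda>\<xi>. of_real (\<sigma> \<xi>) * fourier_fun u \<xi>)"

end

(*
  Write g for the Fourier transform of u. Up to the factor (2 pi)^(-1/2), the Fourier transform of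
  the trace of D_n^l u is the integral of t^l g(xi', t) over t, so by the Cauchy-Schwarz inequality
  it suffices to bound the integral over t of t^(2l) / Xi_P(xi', t, lambda)^2 by a constant times
  (|xi'|^a |lambda|^b)^(-2) for every vertex (a, b) of the polygon shifted by rho = l + 1/2.
  Every point (p, q) of N(P) gives the lower bound |xi|^p |lambda|^q <= Xi_P. If a > 0, the point
  (a + rho, b) yields bounds by multiples of |t|^0 and of |t|^(a + rho). If a = 0, the abscissa rho
  is not an integer, so (rho, b) lies on a segment between points of N(P) with abscissae
  p1 < rho < p2. In both cases the two lower bounds for Xi_P control the integral near 0 and near
  infinity, and optimizing the splitting point gives exactly the required homogeneity.
*)

theory Submission
  imports Defs "HOL-Probability.Characteristic_Functions" "HOL-Probability.Sinc_Integral"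
begin

section \<open>Schwartz functions\<close>

text \<open>Two estimates of the integral of t^(2l) / Xi_P^2 are used. The sharp one carries the
  weight of the trace space. The crude one is uniform in xi' and yields the existence of the trace:
  the vertex (M, 0) with M = 2m_1 + ... + 2m_S gives |t|^M <= Xi_P, so l + 1 <= M bounds the
  integrand by a multiple of 1 / (1 + t^2). This is where the range of l enters. It makes xi_n^l
  g(xi) psi(xi') absolutely integrable for psi in L2, and integrating this against cis (t xi_n)
  defines the weakly continuous family that realizes the trace. The half in rho = l + 1/2 is the
  borderline of integrability: |t|^(2l - 2p) is integrable at 0 iff p < rho and at infinity iff p >
  rho, so bounds with exponents strictly on both sides of rho are forced. The exponents of |lambda|
  interpolate exactly, hence no constant depends on lambda. The claim concerns every trace and a
  representative of Fu picked by choice, so both must be unique. Uniqueness is reduced to testing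
  against Gaussians, which also drive Fourier inversion.\<close>

definition rapid :: "('a::euclidean_space \<Rightarrow> complex) \<Rightarrow> bool" where
  "rapid f \<longleftrightarrow> (\<forall>k::nat. \<exists>B. \<forall>x. (1 + norm x) ^ k * cmod (f x) \<le> B)"

lemma rapid_iff_bounded:
  "rapid f \<longleftrightarrow> (\<forall>k::nat. bounded (range (\<lambda>x. of_real ((1 + norm x) ^ k) * f x)))"
proof -
  have "cmod (of_real ((1 + norm x) ^ k) * f x) = (1 + norm x) ^ k * cmod (f x)" for x k
    by (simp add: norm_mult norm_power del: of_real_power of_real_add)
  then show ?thesis
    unfolding rapid_def bounded_iff by auto
qed

lemma iter_deriv_Nil [simp]: "iter_deriv [] f = f"
  and iter_deriv_Cons: "iter_deriv (b # bs) f = dir_deriv b (iter_deriv bs f)"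
  and iter_deriv_snoc: "iter_deriv (bs @ [b]) f = iter_deriv bs (dir_deriv b f)"
  by (simp_all add: iter_deriv_def)

lemma schwartz_iff:
  "f \<in> schwartz \<longleftrightarrow> (\<forall>bs. set bs \<subseteq> Basis \<longrightarrow>
     iter_deriv bs f differentiable_on UNIV \<and> rapid (iter_deriv bs f))"
  by (simp add: schwartz_def rapid_iff_bounded)

text \<open>Membership in the Schwartz space is proved coinductively: it suffices to exhibit a set of
  rapidly decreasing functions that is closed under partial derivatives.\<close>

lemma schwartzI_coinduct:
  assumes "f \<in> X"
    and diff: "\<And>f x. f \<in> X \<Longrightarrow> f differentiable (at x)"
    and rap: "\<And>f. f \<in> X \<Longrightarrow> rapid f"
    and step: "\<And>f b. f \<in> X \<Longrightarrow> b \<in> Basis \<Longrightarrow> dir_deriv b f \<in> X"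
  shows "f \<in> schwartz"
proof -
  have "iter_deriv bs f \<in> X" if "set bs \<subseteq> Basis" for bs
    using that by (induction bs) (auto simp: iter_deriv_Cons assms)
  then show ?thesis
    unfolding schwartz_iff differentiable_on_def using diff rap by auto
qed

lemma schwartz_differentiable: "f \<in> schwartz \<Longrightarrow> f differentiable (at x)"
  unfolding schwartz_iff differentiable_on_def
  by (metis UNIV_I empty_iff empty_set iter_deriv_Nil subsetI)

lemma schwartz_rapid: "f \<in> schwartz \<Longrightarrow> rapid f"
  unfolding schwartz_iff by (metis empty_iff empty_set iter_deriv_Nil subsetI)

lemma schwartz_dir_deriv: "f \<in> schwartz \<Longrightarrow> b \<in> Basis \<Longrightarrow> dir_deriv b f \<in> schwartz"
  unfolding schwartz_iff iter_deriv_snoc[symmetric] by simp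

lemma schwartz_bounded:
  assumes "f \<in> schwartz"
  obtains B where "0 < B" "\<And>x. cmod (f x) \<le> B / (1 + norm x) ^ k"
proof -
  obtain B where B: "\<And>x. (1 + norm x) ^ k * cmod (f x) \<le> B"
    using schwartz_rapid[OF assms] unfolding rapid_def by blast
  have "0 < 1 + norm x" for x :: 'a
    by (smt (verit) norm_ge_zero)
  then have "cmod (f x) \<le> max B 1 / (1 + norm x) ^ k" for x
    using B[of x] by (simp add: pos_le_divide_eq mult.commute)
  then show ?thesis
    using that[of "max B 1"] by auto
qed

section \<open>Directional derivatives and multipliers of Schwartz functions\<close>

lemma dir_deriv_eq: "(f has_derivative f') (at x) \<Longrightarrow> dir_deriv b f x = f' b"
  unfolding dir_deriv_def by (metis frechet_derivative_at)

lemma differentiable_has_derivative: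
  "f differentiable (at x) \<Longrightarrow> (f has_derivative (\<lambda>h. dir_deriv h f x)) (at x)"
  unfolding dir_deriv_def by (simp add: frechet_derivative_works)

lemma dir_deriv_add:
  "f differentiable (at x) \<Longrightarrow> g differentiable (at x) \<Longrightarrow>
    dir_deriv b (\<lambda>x. f x + g x) x = dir_deriv b f x + dir_deriv b g x"
  by (rule dir_deriv_eq) (auto intro!: derivative_eq_intros differentiable_has_derivative)

lemma dir_deriv_mult:
  "f differentiable (at x) \<Longrightarrow> g differentiable (at x) \<Longrightarrow>
    dir_deriv b (\<lambda>x. f x * g x) x = f x * dir_deriv b g x + dir_deriv b f x * g x"
  by (rule dir_deriv_eq) (auto intro!: derivative_eq_intros differentiable_has_derivative)

definition poly_bounded :: "('a::euclidean_space \<Rightarrow> complex) \<Rightarrow> bool" where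
  "poly_bounded f \<longleftrightarrow> (\<exists>B. \<exists>k::nat. \<forall>x. cmod (f x) \<le> B * (1 + norm x) ^ k)"

lemma rapid_add: "rapid f \<Longrightarrow> rapid g \<Longrightarrow> rapid (\<lambda>x. f x + g x)"
  unfolding rapid_def
proof
  fix k :: nat
  assume "\<forall>k. \<exists>B. \<forall>x. (1 + norm x) ^ k * cmod (f x) \<le> B" "\<forall>k. \<exists>B. \<forall>x. (1 + norm x) ^ k * cmod (g x) \<le> B"
  then obtain B C where B: "\<And>x. (1 + norm x) ^ k * cmod (f x) \<le> B"
    and C: "\<And>x. (1 + norm x) ^ k * cmod (g x) \<le> C"
    by meson
  have "(1 + norm x) ^ k * cmod (f x + g x) \<le> B + C" for x
  proof -
    have "(1 + norm x) ^ k * cmod (f x + g x) \<le> (1 + norm x) ^ k * (cmod (f x) + cmod (g x))"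
      by (intro mult_left_mono norm_triangle_ineq) simp
    then show ?thesis using B[of x] C[of x] by (simp add: distrib_left)
  qed
  then show "\<exists>B. \<forall>x. (1 + norm x) ^ k * cmod (f x + g x) \<le> B" by blast
qed

lemma rapid_mult:
  assumes "poly_bounded m" "rapid f"
  shows "rapid (\<lambda>x. m x * f x)"
  unfolding rapid_def
proof
  fix k :: nat
  obtain B j where B: "\<And>x. cmod (m x) \<le> B * (1 + norm x) ^ j"
    using assms(1) unfolding poly_bounded_def by blast
  obtain C where C: "\<And>x. (1 + norm x) ^ (j + k) * cmod (f x) \<le> C"
    using assms(2) unfolding rapid_def by blast
  have "0 \<le> B" using B[of 0] by (smt (verit) norm_ge_zero norm_zero power_one mult_cancel_left1)
  have "(1 + norm x) ^ k * cmod (m x * f x) \<le> B * C" for x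
  proof -
    have "(1 + norm x) ^ k * cmod (m x * f x) \<le> (1 + norm x) ^ k * ((B * (1 + norm x) ^ j) * cmod (f x))"
      unfolding norm_mult by (intro mult_left_mono mult_right_mono B) auto
    also have "\<dots> = B * ((1 + norm x) ^ (j + k) * cmod (f x))"
      by (simp add: power_add)
    also have "\<dots> \<le> B * C" by (intro mult_left_mono C \<open>0 \<le> B\<close>)
    finally show ?thesis .
  qed
  then show "\<exists>B. \<forall>x. (1 + norm x) ^ k * cmod (m x * f x) \<le> B" by blast
qed

text \<open>The product rule turns one product into a sum of two, so the invariant set of the
  coinduction has to contain finite sums of products.\<close>

inductive_set multiplier_span :: "('a::euclidean_space \<Rightarrow> complex) set \<Rightarrow> ('a \<Rightarrow> complex) set"
  for M where
  base: "m \<in> M \<Longrightarrow> f \<in> schwartz \<Longrightarrow> (\<lambda>x. m x * f x) \<in> multiplier_span M"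
| add: "f \<in> multiplier_span M \<Longrightarrow> g \<in> multiplier_span M \<Longrightarrow> (\<lambda>x. f x + g x) \<in> multiplier_span M"

text \<open>If a class of multipliers of polynomial growth is closed under partial derivatives, the
  product rule keeps every derivative of a product inside \<open>multiplier_span M\<close>.
  Constants, coordinates, characters and Schwartz functions are all handled by suitable choices of
  \<open>M\<close>.\<close>

lemma schwartz_multiplier:
  assumes "m \<in> M" "f \<in> schwartz"
    and diff: "\<And>m x. m \<in> M \<Longrightarrow> m differentiable (at x)"
    and growth: "\<And>m. m \<in> M \<Longrightarrow> poly_bounded m"
    and step: "\<And>m b. m \<in> M \<Longrightarrow> b \<in> Basis \<Longrightarrow> dir_deriv b m \<in> M"
  shows "(\<lambda>x. m x * f x) \<in> schwartz"
proof (rule schwartzI_coinduct[where X = "multiplier_span M"])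
  show "(\<lambda>x. m x * f x) \<in> multiplier_span M" using assms by (intro multiplier_span.base)
next
  fix g x assume "g \<in> multiplier_span M"
  then show "g differentiable (at x)"
    by induction (auto intro: differentiable_mult differentiable_add diff schwartz_differentiable)
next
  fix g assume "g \<in> multiplier_span M"
  then show "rapid g"
    by induction (blast intro: rapid_add rapid_mult growth schwartz_rapid)+
next
  fix g and b :: 'a assume "g \<in> multiplier_span M" and b: "b \<in> Basis"
  \<comment> \<open>Differentiability is carried along because the derivative of a sum splits only
    for differentiable summands.\<close>
  then have "dir_deriv b g \<in> multiplier_span M \<and> (\<forall>x. g differentiable (at x))"
  proof induction
    case (base m f)
    have "dir_deriv b (\<lambda>x. m x * f x) = (\<lambda>x. m x * dir_deriv b f x + dir_deriv b m x * f x)"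
      using base by (intro ext dir_deriv_mult diff schwartz_differentiable)
    then show ?case
      using multiplier_span.add[OF multiplier_span.base multiplier_span.base, of m M "dir_deriv b f" "dir_deriv b m" f] base b
      by (simp add: schwartz_dir_deriv step differentiable_mult diff schwartz_differentiable)
  next
    case (add f g)
    then have "dir_deriv b (\<lambda>x. f x + g x) = (\<lambda>x. dir_deriv b f x + dir_deriv b g x)"
      by (intro ext dir_deriv_add) auto
    with add show ?case by (simp add: multiplier_span.add)
  qed
  then show "dir_deriv b g \<in> multiplier_span M" by simp
qed

lemma poly_bounded_bounded: "(\<And>x. cmod (f x) \<le> B) \<Longrightarrow> poly_bounded f"
  unfolding poly_bounded_def by (rule exI[of _ B], rule exI[of _ 0]) simp

lemma poly_bounded_const: "poly_bounded (\<lambda>_. c)"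
  by (rule poly_bounded_bounded[OF order_refl])

lemma schwartz_poly_bounded:
  assumes "f \<in> schwartz" shows "poly_bounded f"
proof -
  obtain B where "\<And>x. cmod (f x) \<le> B / (1 + norm x) ^ 0" using schwartz_bounded[OF assms] by blast
  then show ?thesis by (intro poly_bounded_bounded[where B = B]) simp
qed

lemma dir_deriv_const [simp]: "dir_deriv b (\<lambda>_. c) = (\<lambda>_. 0)"
  by (rule ext, rule dir_deriv_eq) simp

lemma schwartz_cmult: "f \<in> schwartz \<Longrightarrow> (\<lambda>x. c * f x) \<in> schwartz"
  by (rule schwartz_multiplier[where M = "range (\<lambda>c _. c)"])
     (auto intro: poly_bounded_const)

lemma schwartz_mult: "f \<in> schwartz \<Longrightarrow> g \<in> schwartz \<Longrightarrow> (\<lambda>x. f x * g x) \<in> schwartz"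
  by (rule schwartz_multiplier[where M = schwartz])
     (auto intro: schwartz_poly_bounded schwartz_differentiable schwartz_dir_deriv)

lemma schwartz_zero: "(\<lambda>_. 0) \<in> schwartz"
  by (rule schwartzI_coinduct[where X = "{\<lambda>_. 0}"]) (auto simp: rapid_def)

lemma schwartz_add:
  assumes "f \<in> schwartz" "g \<in> schwartz"
  shows "(\<lambda>x. f x + g x) \<in> schwartz"
proof (rule schwartzI_coinduct[where X = "{\<lambda>x. f x + g x |f g. f \<in> schwartz \<and> g \<in> schwartz}"])
  fix h :: "'a \<Rightarrow> complex" and b assume "h \<in> {\<lambda>x. f x + g x |f g. f \<in> schwartz \<and> g \<in> schwartz}" and b: "b \<in> (Basis :: 'a set)"
  then obtain f g where h: "h = (\<lambda>x. f x + g x)" "f \<in> schwartz" "g \<in> schwartz" by blast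
  have "dir_deriv b h = (\<lambda>x. dir_deriv b f x + dir_deriv b g x)"
    unfolding h(1) using h by (auto intro!: dir_deriv_add schwartz_differentiable)
  then show "dir_deriv b h \<in> {\<lambda>x. f x + g x |f g. f \<in> schwartz \<and> g \<in> schwartz}"
    using h b by (auto intro: schwartz_dir_deriv)
qed (use assms in \<open>auto intro!: differentiable_add intro: schwartz_differentiable rapid_add schwartz_rapid\<close>)

lemma schwartz_sum:
  "(\<And>i. i \<in> I \<Longrightarrow> f i \<in> schwartz) \<Longrightarrow> (\<lambda>x. \<Sum>i\<in>I. f i x) \<in> schwartz"
  by (induction I rule: infinite_finite_induct) (auto simp: schwartz_zero intro: schwartz_add)

lemma coord_has_derivative:
  "((\<lambda>x. complex_of_real (x \<bullet> y)) has_derivative (\<lambda>h. of_real (h \<bullet> y))) (at x)"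
  by (auto intro!: derivative_eq_intros)

lemma poly_bounded_coord: "poly_bounded (\<lambda>x::'a::euclidean_space. complex_of_real (x \<bullet> y))"
  unfolding poly_bounded_def
proof (rule exI[of _ "norm y"], rule exI[of _ 1], intro allI)
  fix x :: 'a
  have "\<bar>x \<bullet> y\<bar> \<le> norm x * norm y" by (rule Cauchy_Schwarz_ineq2)
  then show "cmod (complex_of_real (x \<bullet> y)) \<le> norm y * (1 + norm x) ^ 1"
    by (simp add: algebra_simps add_increasing)
qed

lemma schwartz_coord:
  assumes "f \<in> schwartz"
  shows "(\<lambda>x. of_real (x \<bullet> y) * f x) \<in> schwartz"
proof (rule schwartz_multiplier[where M = "insert (\<lambda>x. of_real (x \<bullet> y)) (range (\<lambda>c _. c))"])
  show "poly_bounded m" if "m \<in> insert (\<lambda>x. of_real (x \<bullet> y)) (range (\<lambda>c _. c))" for m :: "'a \<Rightarrow> complex"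
    using that by (auto intro: poly_bounded_const poly_bounded_coord)
next
  show "m differentiable (at x)" if "m \<in> insert (\<lambda>x. of_real (x \<bullet> y)) (range (\<lambda>c _. c))" for m :: "'a \<Rightarrow> complex" and x
    using that differentiableI[OF coord_has_derivative] by auto
  show "dir_deriv b m \<in> insert (\<lambda>x. of_real (x \<bullet> y)) (range (\<lambda>c _. c))" 
    if "m \<in> insert (\<lambda>x. of_real (x \<bullet> y)) (range (\<lambda>c _. c))" for m :: "'a \<Rightarrow> complex" and b
    using that by (auto simp: dir_deriv_eq[OF coord_has_derivative, abs_def])
qed (use assms in auto)

lemma has_derivative_cis_inner:
  "((\<lambda>x. cis (x \<bullet> y)) has_derivative (\<lambda>h. \<i> * of_real (h \<bullet> y) * cis (x \<bullet> y))) (at x)"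
proof -
  have "((\<lambda>x. x \<bullet> y) has_derivative (\<lambda>h. h \<bullet> y)) (at x)"
    by (rule has_derivative_inner_left) simp
  moreover have "(cis has_derivative (\<lambda>t. t *\<^sub>R (\<i> * cis (x \<bullet> y)))) (at (x \<bullet> y))"
    using has_vector_derivative_iexp[of "x \<bullet> y" UNIV]
    unfolding has_vector_derivative_def cis_conv_exp .
  ultimately have "((cis \<circ> (\<lambda>x. x \<bullet> y)) has_derivative (\<lambda>t. t *\<^sub>R (\<i> * cis (x \<bullet> y))) \<circ> (\<lambda>h. h \<bullet> y)) (at x)"
    by (rule diff_chain_at)
  then show ?thesis by (simp add: o_def scaleR_conv_of_real mult_ac)
qed

lemma schwartz_cis:
  assumes "f \<in> schwartz"
  shows "(\<lambda>x. cis (x \<bullet> y) * f x) \<in> schwartz"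
proof (rule schwartz_multiplier[where M = "range (\<lambda>c x. c * cis (x \<bullet> y))"])
  have d: "((\<lambda>x. c * cis (x \<bullet> y)) has_derivative (\<lambda>h. (c * \<i> * of_real (h \<bullet> y)) * cis (x \<bullet> y))) (at x)" for x c
    using has_derivative_mult_right[OF has_derivative_cis_inner, of c] by (simp add: mult.assoc)
  show "m differentiable (at x)" if "m \<in> range (\<lambda>c x. c * cis (x \<bullet> y))" for m x
    using that d unfolding differentiable_def by blast
  show "dir_deriv b m \<in> range (\<lambda>c x. c * cis (x \<bullet> y))" if m: "m \<in> range (\<lambda>c x. c * cis (x \<bullet> y))" for m b
  proof -
    obtain c where "m = (\<lambda>x. c * cis (x \<bullet> y))" using m by blast
    then show ?thesis using dir_deriv_eq[OF d, of b c] by (intro range_eqI[of _ _ "c * \<i> * of_real (b \<bullet> y)"]) auto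
  qed
  show "poly_bounded m" if m: "m \<in> range (\<lambda>c x. c * cis (x \<bullet> y))" for m
  proof -
    obtain c where "m = (\<lambda>x. c * cis (x \<bullet> y))" using m by blast
    then show ?thesis by (intro poly_bounded_bounded[where B = "cmod c"]) (simp add: norm_mult)
  qed
  show "(\<lambda>x. cis (x \<bullet> y)) \<in> range (\<lambda>c x. c * cis (x \<bullet> y))"
    by (rule range_eqI[of _ _ 1]) simp
qed fact

section \<open>Affine substitutions, slices and tensor products\<close>

text \<open>By \<open>basis\<close> the chain rule yields a multiple of a single partial derivative
  of \<open>f\<close>, so scalar multiples of such compositions already form an invariant set. By
  \<open>proper\<close>, decay in \<open>L x + c\<close> becomes decay in \<open>x\<close>.\<close>

lemma schwartz_affine:
  fixes L :: "'a::euclidean_space \<Rightarrow> 'b::euclidean_space"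
  assumes f: "f \<in> schwartz" and L: "bounded_linear L"
    and basis: "\<And>b. b \<in> Basis \<Longrightarrow> \<exists>s. \<exists>b'\<in>Basis. L b = s *\<^sub>R b'"
    and proper: "\<And>x. norm x \<le> K * (1 + norm (L x + c))"
  shows "(\<lambda>x. f (L x + c)) \<in> schwartz"
proof -
  let ?X = "{\<lambda>x. \<alpha> * f (L x + c) |\<alpha> f. f \<in> schwartz}"
  have d: "((\<lambda>x. \<alpha> * f (L x + c)) has_derivative (\<lambda>h. \<alpha> * dir_deriv (L h) f (L x + c))) (at x)"
    if "f \<in> schwartz" for \<alpha> f x
  proof -
    have 1: "((\<lambda>x. L x + c) has_derivative L) (at x)"
      by (auto intro!: derivative_eq_intros bounded_linear_imp_has_derivative L)
    have "((f \<circ> (\<lambda>x. L x + c)) has_derivative ((\<lambda>h. dir_deriv h f (L x + c)) \<circ> L)) (at x)"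
      by (rule diff_chain_at[OF 1]) (rule differentiable_has_derivative[OF schwartz_differentiable[OF that]])
    then show ?thesis unfolding o_def by (rule has_derivative_mult_right)
  qed
  show ?thesis
  proof (rule schwartzI_coinduct[where X = ?X])
    show "(\<lambda>x. f (L x + c)) \<in> ?X" using f by (auto intro!: exI[of _ 1])
    show "h differentiable (at x)" if "h \<in> ?X" for h x
      using that d unfolding differentiable_def by blast
    show "rapid h" if hX: "h \<in> ?X" for h
    proof -
      obtain \<alpha> f where h: "h = (\<lambda>x. \<alpha> * f (L x + c))" "f \<in> schwartz" using hX by auto
      show ?thesis unfolding rapid_def
      proof
        fix k :: nat
        obtain B where B: "0 < B" "\<And>x. cmod (f x) \<le> B / (1 + norm x) ^ k" using schwartz_bounded[OF h(2)] by blast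
        have "(1 + norm x) ^ k * cmod (h x) \<le> (1 + \<bar>K\<bar>) ^ k * (cmod \<alpha> * B)" for x
        proof -
          let ?y = "L x + c"
          have p: "0 < 1 + norm ?y" by (smt (verit) norm_ge_zero)
          have "norm x \<le> \<bar>K\<bar> * (1 + norm ?y)" using proper[of x] p
            by (smt (verit) mult_right_mono)
          then have "1 + norm x \<le> (1 + \<bar>K\<bar>) * (1 + norm ?y)"
            by (simp add: algebra_simps) (smt (verit) norm_ge_zero)
          then have "(1 + norm x) ^ k \<le> (1 + \<bar>K\<bar>) ^ k * (1 + norm ?y) ^ k"
            by (metis power_mono power_mult_distrib norm_ge_zero add_nonneg_nonneg zero_le_one)
          then have "(1 + norm x) ^ k * cmod (h x) \<le> ((1 + \<bar>K\<bar>) ^ k * (1 + norm ?y) ^ k) * (cmod \<alpha> * (B / (1 + norm ?y) ^ k))"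
            unfolding h norm_mult by (intro mult_mono mult_left_mono B) auto
          also have "\<dots> = (1 + \<bar>K\<bar>) ^ k * (cmod \<alpha> * B)" using p by simp
          finally show ?thesis .
        qed
        then show "\<exists>B. \<forall>x. (1 + norm x) ^ k * cmod (h x) \<le> B" by blast
      qed
    qed
    show "dir_deriv b h \<in> ?X" if hX: "h \<in> ?X" and b: "b \<in> Basis" for h and b
    proof -
      obtain \<alpha> f where h: "h = (\<lambda>x. \<alpha> * f (L x + c))" "f \<in> schwartz" using hX by auto
      obtain s b' where s: "b' \<in> Basis" "L b = s *\<^sub>R b'" using basis[OF b] by blast
      have "dir_deriv (s *\<^sub>R b') f y = of_real s * dir_deriv b' f y" for y
        using linear_scale[OF has_derivative_linear[OF differentiable_has_derivative[OF schwartz_differentiable[OF h(2)]]]]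
        by (simp add: scaleR_conv_of_real)
      then have "dir_deriv b h = (\<lambda>x. (\<alpha> * of_real s) * dir_deriv b' f (L x + c))"
        unfolding h(1) using dir_deriv_eq[OF d[OF h(2)]] s by (auto simp: mult.assoc)
      then show ?thesis using schwartz_dir_deriv[OF h(2) s(1)] by blast
    qed
  qed
qed

lemma schwartz_reflect: "f \<in> schwartz \<Longrightarrow> (\<lambda>x. f (- x)) \<in> schwartz"
  using schwartz_affine[where L = uminus and c = 0 and K = 1 and f = f]
  by (simp add: bounded_linear_minus bounded_linear_ident)
     (metis scaleR_minus1_left)

lemma schwartz_slice:
  fixes f :: "'a::euclidean_space \<times> 'b::euclidean_space \<Rightarrow> complex"
  assumes "f \<in> schwartz" shows "(\<lambda>x. f (x, t)) \<in> schwartz"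
proof -
  have "(\<lambda>x. f ((x, 0) + (0, t))) \<in> schwartz"
  proof (rule schwartz_affine[where L = "\<lambda>x. (x, 0)" and c = "(0, t)" and K = 1])
    show "bounded_linear (\<lambda>x::'a. (x, 0::'b))" 
      by (intro bounded_linear_Pair bounded_linear_ident bounded_linear_zero)
    show "\<exists>s. \<exists>b'\<in>Basis. (b, 0) = s *\<^sub>R b'" if "b \<in> Basis" for b :: 'a
      using that by (intro exI[of _ 1] bexI[of _ "(b, 0)"]) (auto simp: Basis_prod_def)
    show "norm x \<le> 1 * (1 + norm ((x, 0) + (0, t)))" for x :: 'a
      using norm_fst_le[of x t] by simp
  qed fact
  then show ?thesis by simp
qed

text \<open>A basis direction of the product space differentiates only one factor, so products
  without sums form an invariant set. These test functions separate \<open>t\<close> from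
  \<open>x'\<close> in the uniqueness of traces.\<close>

lemma schwartz_tensor:
  fixes f :: "'a::euclidean_space \<Rightarrow> complex" and g :: "'b::euclidean_space \<Rightarrow> complex"
  assumes f: "f \<in> schwartz" and g: "g \<in> schwartz"
  shows "(\<lambda>x. f (fst x) * g (snd x)) \<in> schwartz"
proof -
  let ?X = "{\<lambda>x::'a \<times> 'b. f (fst x) * g (snd x) |f g. f \<in> schwartz \<and> g \<in> schwartz}"
  have d: "((\<lambda>x. f (fst x) * g (snd x)) has_derivative
      (\<lambda>h. f (fst x) * dir_deriv (snd h) g (snd x) + dir_deriv (fst h) f (fst x) * g (snd x))) (at x)"
    if "f \<in> schwartz" "g \<in> schwartz" for x :: "'a \<times> 'b" and f g
  proof (rule has_derivative_mult)
    have "((f \<circ> fst) has_derivative ((\<lambda>h. dir_deriv h f (fst x)) \<circ> fst)) (at x)"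
      by (rule diff_chain_at[OF _ differentiable_has_derivative[OF schwartz_differentiable[OF that(1)]]])
         (auto intro!: derivative_eq_intros)
    then show "((\<lambda>x. f (fst x)) has_derivative (\<lambda>h. dir_deriv (fst h) f (fst x))) (at x)"
      by (simp add: o_def)
    have "((g \<circ> snd) has_derivative ((\<lambda>h. dir_deriv h g (snd x)) \<circ> snd)) (at x)"
      by (rule diff_chain_at[OF _ differentiable_has_derivative[OF schwartz_differentiable[OF that(2)]]])
         (auto intro!: derivative_eq_intros)
    then show "((\<lambda>x. g (snd x)) has_derivative (\<lambda>h. dir_deriv (snd h) g (snd x))) (at x)"
      by (simp add: o_def)
  qed
  show ?thesis
  proof (rule schwartzI_coinduct[where X = ?X])
    show "(\<lambda>x. f (fst x) * g (snd x)) \<in> ?X" using assms by blast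
    show "h differentiable (at x)" if "h \<in> ?X" for h x
      using that d unfolding differentiable_def by blast
    show "rapid h" if hX: "h \<in> ?X" for h unfolding rapid_def
    proof
      fix k :: nat
      obtain f g where h: "h = (\<lambda>x. f (fst x) * g (snd x))" "f \<in> schwartz" "g \<in> schwartz" using hX by auto
      obtain B where B: "0 < B" "\<And>x. cmod (f x) \<le> B / (1 + norm x) ^ k" using schwartz_bounded[OF h(2)] by blast
      obtain C where C: "0 < C" "\<And>x. cmod (g x) \<le> C / (1 + norm x) ^ k" using schwartz_bounded[OF h(3)] by blast
      have "(1 + norm x) ^ k * cmod (h x) \<le> B * C" for x
      proof -
        have p: "0 < 1 + norm (fst x)" "0 < 1 + norm (snd x)"  by (smt (verit) norm_ge_zero)+
        have "norm x \<le> norm (fst x) + norm (snd x)" by (metis norm_Pair_le prod.collapse)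
        then have "1 + norm x \<le> (1 + norm (fst x)) * (1 + norm (snd x))"
          by (simp add: algebra_simps) (smt (verit) norm_ge_zero mult_nonneg_nonneg)
        then have "(1 + norm x) ^ k \<le> (1 + norm (fst x)) ^ k * (1 + norm (snd x)) ^ k"
          by (metis power_mono power_mult_distrib norm_ge_zero add_nonneg_nonneg zero_le_one)
        then have "(1 + norm x) ^ k * cmod (h x) \<le> ((1 + norm (fst x)) ^ k * (1 + norm (snd x)) ^ k) *
            (B / (1 + norm (fst x)) ^ k * (C / (1 + norm (snd x)) ^ k))"
          unfolding h norm_mult using B C by (intro mult_mono) auto
        also have "\<dots> = B * C" using p by simp
        finally show ?thesis .
      qed
      then show "\<exists>B. \<forall>x. (1 + norm x) ^ k * cmod (h x) \<le> B" by blast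
    qed
    show "dir_deriv b h \<in> ?X" if hX: "h \<in> ?X" and b: "b \<in> Basis" for h and b
    proof -
      obtain f g where h: "h = (\<lambda>x. f (fst x) * g (snd x))" "f \<in> schwartz" "g \<in> schwartz" using hX by auto
      have z: "dir_deriv 0 f x = 0" if "f \<in> schwartz" for f :: "'a \<Rightarrow> _" and x
        using linear_0[OF has_derivative_linear[OF differentiable_has_derivative[OF schwartz_differentiable[OF that]]]] .
      have z': "dir_deriv 0 f x = 0" if "f \<in> schwartz" for f :: "'b \<Rightarrow> _" and x
        using linear_0[OF has_derivative_linear[OF differentiable_has_derivative[OF schwartz_differentiable[OF that]]]] .
      have e: "dir_deriv b h = (\<lambda>x. f (fst x) * dir_deriv (snd b) g (snd x) + dir_deriv (fst b) f (fst x) * g (snd x))"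
        unfolding h(1) by (rule ext) (rule dir_deriv_eq[OF d[OF h(2,3)]])
      from b consider "fst b \<in> Basis" "snd b = 0" | "snd b \<in> Basis" "fst b = 0"
        by (auto simp: Basis_prod_def)
      then show ?thesis
      proof cases
        case 1
        then have "dir_deriv b h = (\<lambda>x. dir_deriv (fst b) f (fst x) * g (snd x))"
          unfolding e using z' h by auto
        then show ?thesis using 1 h schwartz_dir_deriv by blast
      next
        case 2
        then have "dir_deriv b h = (\<lambda>x. f (fst x) * dir_deriv (snd b) g (snd x))"
          unfolding e using z h by auto
        then show ?thesis using 2 h schwartz_dir_deriv by blast
      qed
    qed
  qed
qed

section \<open>Fourier transform on the Schwartz space\<close>

lemma lborel_translate:
  fixes f :: "'a::euclidean_space \<Rightarrow> 'b::{banach, second_countable_topology}"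
  assumes [measurable]: "f \<in> borel_measurable borel"
  shows lborel_integral_translate: "(LINT x|lborel. f (c + x)) = integral\<^sup>L lborel f"
    and lborel_integrable_translate: "integrable lborel (\<lambda>x. f (c + x)) \<longleftrightarrow> integrable lborel f"
proof -
  have e: "lborel = distr lborel borel (\<lambda>x. c + x)" by (simp add: lborel_distr_plus)
  show "(LINT x|lborel. f (c + x)) = integral\<^sup>L lborel f"
    by (subst (2) e) (simp add: integral_distr)
  show "integrable lborel (\<lambda>x. f (c + x)) \<longleftrightarrow> integrable lborel f"
    by (subst (2) e) (simp add: integrable_distr_eq)
qed

lemma lborel_scale:
  fixes f :: "'a::euclidean_space \<Rightarrow> 'b::{banach, second_countable_topology}"
  assumes [measurable]: "f \<in> borel_measurable borel" and c: "c \<noteq> 0"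
  shows lborel_integral_scale: "(LINT x|lborel. f (c *\<^sub>R x)) = (1 / \<bar>c\<bar> ^ DIM('a)) *\<^sub>R integral\<^sup>L lborel f"
    and lborel_integrable_scale: "integrable lborel (\<lambda>x. f (c *\<^sub>R x)) \<longleftrightarrow> integrable lborel f"
proof -
  have e: "(lborel :: 'a measure) = density (distr lborel borel (\<lambda>x. c *\<^sub>R x)) (\<lambda>_. ennreal (\<bar>c\<bar> ^ DIM('a)))"
    using lborel_affine[OF c, of 0] by simp
  have "integral\<^sup>L lborel f = \<bar>c\<bar> ^ DIM('a) *\<^sub>R (LINT x|lborel. f (c *\<^sub>R x))"
    by (subst e) (simp add: integral_density integral_distr)
  then show "(LINT x|lborel. f (c *\<^sub>R x)) = (1 / \<bar>c\<bar> ^ DIM('a)) *\<^sub>R integral\<^sup>L lborel f"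
    using c by simp
  have "integrable lborel f \<longleftrightarrow> integrable lborel (\<lambda>x. \<bar>c\<bar> ^ DIM('a) *\<^sub>R f (c *\<^sub>R x))"
    by (subst e) (simp add: integrable_density integrable_distr_eq)
  also have "\<dots> \<longleftrightarrow> integrable lborel (\<lambda>x. f (c *\<^sub>R x))"
    (is "?l \<longleftrightarrow> ?r")
  proof
    assume ?l
    then have "integrable lborel (\<lambda>x. (1 / \<bar>c\<bar> ^ DIM('a)) *\<^sub>R (\<bar>c\<bar> ^ DIM('a) *\<^sub>R f (c *\<^sub>R x)))"
      by (rule integrable_scaleR_right)
    then show ?r using c by simp
  qed simp
  finally show "integrable lborel (\<lambda>x. f (c *\<^sub>R x)) \<longleftrightarrow> integrable lborel f" by simp
qed

lemma lborel_integral_reflect: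
  fixes f :: "'a::euclidean_space \<Rightarrow> 'b::{banach, second_countable_topology}"
  assumes "f \<in> borel_measurable borel"
  shows "(LINT x|lborel. f (- x)) = integral\<^sup>L lborel f"
  using lborel_integral_scale[OF assms, of "-1"] by simp

lemma lborel_Basis_prod:
  fixes f :: "'a::euclidean_space \<Rightarrow> real \<Rightarrow> 'b::{real_normed_field, banach, second_countable_topology}"
  assumes int: "\<And>b. b \<in> Basis \<Longrightarrow> integrable lborel (f b)"
  shows lborel_integrable_prod: "integrable lborel (\<lambda>x. \<Prod>b\<in>Basis. f b (x \<bullet> b))"
    and lborel_integral_prod: "(LINT x|lborel. (\<Prod>b\<in>Basis. f b (x \<bullet> b))) = (\<Prod>b\<in>Basis. integral\<^sup>L lborel (f b))"
proof -
  interpret product_sigma_finite "\<lambda>_::'a. lborel :: real measure" ..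
  let ?M = "Pi\<^sub>M (Basis :: 'a set) (\<lambda>_. lborel :: real measure)"
  let ?T = "\<lambda>g. \<Sum>b\<in>Basis. g b *\<^sub>R b :: 'a"
  let ?F = "\<lambda>x. \<Prod>b\<in>Basis. f b (x \<bullet> b)"
  have [measurable]: "f b \<in> borel_measurable borel" if "b \<in> Basis" for b
    using int[OF that] by (simp add: borel_measurable_integrable)
  have m: "?F \<in> borel_measurable borel" by measurable
  have T: "?T \<in> measurable ?M borel"
    by (rule borel_measurable_sum, rule borel_measurable_scaleR) auto
  have "?F (?T g) = (\<Prod>b\<in>Basis. f b (g b))" for g
    by (intro prod.cong refl arg_cong[where f = "f _"]) simp
  then have e: "(\<lambda>g. ?F (?T g)) = (\<lambda>g. \<Prod>b\<in>Basis. f b (g b))" by (rule ext)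
  show "integrable lborel ?F"
    by (subst lborel_eq, subst integrable_distr_eq[OF T m], subst e, rule product_integrable_prod) (auto intro: int)
  show "integral\<^sup>L lborel ?F = (\<Prod>b\<in>Basis. integral\<^sup>L lborel (f b))"
    by (subst lborel_eq, subst integral_distr[OF T m], subst e, rule product_integral_prod) (auto intro: int)
qed

text \<open>Comparison with a product of one-dimensional Cauchy densities: each of the
  \<open>DIM('a)\<close> factors \<open>1 + (x \<bullet> b)\<^sup>2\<close> is at most
  \<open>(1 + norm x)\<^sup>2\<close>, which accounts for the exponent.\<close>

lemma integrable_inverse_one_plus_norm:
  "integrable lborel (\<lambda>x::'a::euclidean_space. 1 / (1 + norm x) ^ (2 * DIM('a)))"
proof (rule Bochner_Integration.integrable_bound)
  have "integrable lborel (\<lambda>x::real. inverse (1 + x\<^sup>2))"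
    using integrable_inverse_1_plus_square by (simp add: set_integrable_def)
  then show "integrable lborel (\<lambda>x::'a. \<Prod>b\<in>Basis. inverse (1 + (x \<bullet> b)\<^sup>2))"
    by (rule lborel_integrable_prod)
  show "AE x::'a in lborel. norm (1 / (1 + norm x) ^ (2 * DIM('a))) \<le> norm (\<Prod>b\<in>Basis. inverse (1 + (x \<bullet> b)\<^sup>2))"
  proof (rule AE_I2)
    fix x :: 'a
    have p: "0 < 1 + (x \<bullet> b)\<^sup>2" for b by (smt (verit) zero_le_power2)
    have "1 + (x \<bullet> b)\<^sup>2 \<le> (1 + norm x)\<^sup>2" if "b \<in> Basis" for b
    proof -
      have "(x \<bullet> b)\<^sup>2 \<le> (norm x)\<^sup>2" using Basis_le_norm[OF that, of x] by (metis abs_le_square_iff abs_norm_cancel)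
      then show ?thesis by (simp add: power2_sum add_increasing2)
    qed
    then have "(\<Prod>b\<in>Basis. 1 + (x \<bullet> b)\<^sup>2) \<le> (\<Prod>b::'a\<in>Basis. (1 + norm x)\<^sup>2)"
      using p by (intro prod_mono) (auto simp: less_imp_le)
    also have "\<dots> = (1 + norm x) ^ (2 * DIM('a))"
      by (simp add: power_mult)
    finally have "(\<Prod>b\<in>Basis. 1 + (x \<bullet> b)\<^sup>2) \<le> (1 + norm x) ^ (2 * DIM('a))" .
    moreover have "0 < (\<Prod>b\<in>Basis. 1 + (x \<bullet> b)\<^sup>2)" by (intro prod_pos p)
    ultimately have "1 / (1 + norm x) ^ (2 * DIM('a)) \<le> 1 / (\<Prod>b\<in>Basis. 1 + (x \<bullet> b)\<^sup>2)"
      by (intro divide_left_mono) auto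
    then show "norm (1 / (1 + norm x) ^ (2 * DIM('a))) \<le> norm (\<Prod>b\<in>Basis. inverse (1 + (x \<bullet> b)\<^sup>2))"
      using p by (simp add: prod_inversef[unfolded o_def, symmetric] prod_pos less_imp_le divide_inverse abs_of_nonneg prod_nonneg)
  qed
qed simp

lemma schwartz_continuous: "f \<in> schwartz \<Longrightarrow> continuous_on S f"
  by (meson continuous_at_imp_continuous_on differentiable_imp_continuous_within schwartz_differentiable)

lemma schwartz_measurable: "f \<in> schwartz \<Longrightarrow> f \<in> borel_measurable borel"
  by (intro borel_measurable_continuous_onI schwartz_continuous)

lemma integrable_bound_one_plus_norm:
  fixes f :: "'a::euclidean_space \<Rightarrow> complex"
  assumes "f \<in> borel_measurable borel" and "\<And>x. cmod (f x) \<le> B / (1 + norm x) ^ (2 * DIM('a))"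
  shows "integrable lborel f"
proof (rule Bochner_Integration.integrable_bound)
  show "integrable lborel (\<lambda>x::'a. B * (1 / (1 + norm x) ^ (2 * DIM('a))))"
    by (intro integrable_mult_right integrable_inverse_one_plus_norm)
  show "AE x in lborel. norm (f x) \<le> norm (B * (1 / (1 + norm x) ^ (2 * DIM('a))))"
  proof (rule AE_I2)
    show "norm (f x) \<le> norm (B * (1 / (1 + norm x) ^ (2 * DIM('a))))" for x
      using assms(2)[of x] abs_ge_self[of "B * (1 / (1 + norm x) ^ (2 * DIM('a)))"] by simp
  qed
qed (use assms in simp)

lemma schwartz_integrable:
  assumes "f \<in> schwartz" shows "integrable lborel f"
proof -
  obtain B where "\<And>x. cmod (f x) \<le> B / (1 + norm x) ^ (2 * DIM('a))"
    using schwartz_bounded[OF assms] by blast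
  then show ?thesis using schwartz_measurable[OF assms] by (intro integrable_bound_one_plus_norm)
qed

text \<open>By translation invariance every difference quotient of \<open>f\<close> has integral
  zero, and dominated convergence passes to the derivative. This plays the role of integration by
  parts.\<close>

lemma integral_dir_deriv:
  fixes f :: "'a::euclidean_space \<Rightarrow> complex"
  assumes f: "f \<in> schwartz" and b: "b \<in> Basis"
  shows "(LINT x|lborel. dir_deriv b f x) = 0"
proof -
  \<comment> \<open>Step sizes at most 1 keep the mean value point within distance 1 of
    \<open>x\<close>, so its decay bound is comparable with that at \<open>x\<close>, at the price
    of the factor \<open>2 ^ (2 * DIM('a))\<close>.\<close>
  define s :: "nat \<Rightarrow> real" where "s n = 1 / (n + 1)" for n
  have s: "0 < s n" "s n \<le> 1" for n by (auto simp: s_def)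
  define q where "q n = (\<lambda>x. (f (s n *\<^sub>R b + x) - f x) /\<^sub>R s n)" for n
  obtain B where B: "0 < B" "\<And>x. cmod (dir_deriv b f x) \<le> B / (1 + norm x) ^ (2 * DIM('a))"
    using schwartz_bounded[OF schwartz_dir_deriv[OF f b]] by blast
  note [measurable] = schwartz_measurable[OF f] schwartz_measurable[OF schwartz_dir_deriv[OF f b]]
  have d: "((\<lambda>\<theta>. f (\<theta> *\<^sub>R b + x)) has_derivative (\<lambda>h. h *\<^sub>R dir_deriv b f (\<theta> *\<^sub>R b + x))) (at \<theta>)" for \<theta> x
  proof -
    have fd: "(f has_derivative (\<lambda>h. dir_deriv h f y)) (at y)" for y
      by (rule differentiable_has_derivative[OF schwartz_differentiable[OF f]])
    have "((\<lambda>\<theta>. \<theta> *\<^sub>R b + x) has_derivative (\<lambda>h. h *\<^sub>R b)) (at \<theta>)"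
      by (auto intro!: derivative_eq_intros)
    then have "((f \<circ> (\<lambda>\<theta>. \<theta> *\<^sub>R b + x)) has_derivative (\<lambda>h. dir_deriv h f (\<theta> *\<^sub>R b + x)) \<circ> (\<lambda>h. h *\<^sub>R b)) (at \<theta>)"
      by (rule diff_chain_at) (rule fd)
    then show ?thesis
      using linear_scale[OF has_derivative_linear[OF fd]] by (simp add: o_def)
  qed
  have bound: "norm (q n x) \<le> (2 ^ (2 * DIM('a)) * B) * (1 / (1 + norm x) ^ (2 * DIM('a)))" for n x
  proof -
    have "\<exists>\<theta>\<in>{0<..<s n}. norm (f (s n *\<^sub>R b + x) - f (0 *\<^sub>R b + x))
        \<le> norm ((s n - 0) *\<^sub>R dir_deriv b f (\<theta> *\<^sub>R b + x))"
      by (rule mvt_general[OF s(1) _ d])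
         (intro continuous_at_imp_continuous_on ballI has_derivative_continuous[OF d])
    then obtain \<theta> where \<theta>: "0 < \<theta>" "\<theta> < s n"
      "norm (f (s n *\<^sub>R b + x) - f x) \<le> s n * norm (dir_deriv b f (\<theta> *\<^sub>R b + x))"
      using s(1)[of n] by auto
    have "norm x \<le> norm (\<theta> *\<^sub>R b + x) + norm (\<theta> *\<^sub>R b)"
      by (metis add.commute add_diff_cancel_left' norm_triangle_ineq4 norm_minus_commute)
    moreover have "norm (\<theta> *\<^sub>R b) \<le> 1" using \<theta> s(2)[of n] b by simp
    ultimately have h: "(1 + norm x) / 2 \<le> 1 + norm (\<theta> *\<^sub>R b + x)"
    proof -
      have "(1 + s) / 2 \<le> 1 + t" if "s \<le> t + r" "r \<le> 1" "0 \<le> t" for s t r :: real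
        using that by (simp add: field_simps)
      then show ?thesis using \<open>norm x \<le> _\<close> \<open>norm (\<theta> *\<^sub>R b) \<le> 1\<close> norm_ge_zero by blast
    qed
    have p: "0 < 1 + norm x" by (smt (verit) norm_ge_zero)
    have "norm (q n x) \<le> norm (dir_deriv b f (\<theta> *\<^sub>R b + x))"
      using \<theta> s(1)[of n] by (simp add: q_def divide_simps mult.commute)
    also have "\<dots> \<le> B / (1 + norm (\<theta> *\<^sub>R b + x)) ^ (2 * DIM('a))" by (rule B)
    also have "\<dots> \<le> B / ((1 + norm x) / 2) ^ (2 * DIM('a))"
      using h p B(1) by (intro divide_left_mono power_mono mult_pos_pos zero_less_power) auto
    finally show ?thesis by (simp add: power_divide field_simps)
  qed
  have "(\<lambda>n. integral\<^sup>L lborel (q n)) \<longlonglongrightarrow> (LINT x|lborel. dir_deriv b f x)"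
  proof (rule integral_dominated_convergence)
    show "integrable lborel (\<lambda>x::'a. (2 ^ (2 * DIM('a)) * B) * (1 / (1 + norm x) ^ (2 * DIM('a))))"
      by (intro integrable_mult_right integrable_inverse_one_plus_norm)
    show "AE x in lborel. (\<lambda>n. q n x) \<longlonglongrightarrow> dir_deriv b f x"
    proof (rule AE_I2)
      fix x
      have "((\<lambda>\<theta>. f (\<theta> *\<^sub>R b + x)) has_vector_derivative dir_deriv b f (0 *\<^sub>R b + x)) (at 0)"
        unfolding has_vector_derivative_def by (rule d)
      then have "((\<lambda>h. norm (f (h *\<^sub>R b + x) - f x - h *\<^sub>R dir_deriv b f x) / norm h) \<longlongrightarrow> 0) (at 0)"
        by (simp add: has_vector_derivative_def has_derivative_at)
      moreover have "norm (f (h *\<^sub>R b + x) - f x - h *\<^sub>R dir_deriv b f x) / norm h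
          = norm ((f (h *\<^sub>R b + x) - f x) /\<^sub>R h - dir_deriv b f x)" if "h \<noteq> 0" for h
      proof -
        have "(f (h *\<^sub>R b + x) - f x) /\<^sub>R h - dir_deriv b f x
            = (f (h *\<^sub>R b + x) - f x - h *\<^sub>R dir_deriv b f x) /\<^sub>R h"
          using that by (simp add: scaleR_diff_right)
        then show ?thesis by (simp add: divide_inverse mult.commute)
      qed
      ultimately have "((\<lambda>h. norm ((f (h *\<^sub>R b + x) - f x) /\<^sub>R h - dir_deriv b f x)) \<longlongrightarrow> 0) (at 0)"
        by (elim Lim_transform_eventually) (auto simp: eventually_at_filter)
      then have "((\<lambda>h. (f (h *\<^sub>R b + x) - f x) /\<^sub>R h) \<longlongrightarrow> dir_deriv b f x) (at 0)"
        using LIM_zero_cancel tendsto_norm_zero_iff by blast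
      moreover have "filterlim s (at 0) sequentially"
        unfolding filterlim_at s_def using LIMSEQ_inverse_real_of_nat
        by (auto simp: inverse_eq_divide add.commute)
      ultimately show "(\<lambda>n. q n x) \<longlonglongrightarrow> dir_deriv b f x"
        unfolding q_def by (rule filterlim_compose)
    qed
    show "AE x in lborel. norm (q n x) \<le> (2 ^ (2 * DIM('a)) * B) * (1 / (1 + norm x) ^ (2 * DIM('a)))" for n
      using bound by auto
  qed (auto simp: q_def)
  moreover have "integral\<^sup>L lborel (q n) = 0" for n
  proof -
    have "integrable lborel f" by (rule schwartz_integrable[OF f])
    then show ?thesis
      unfolding q_def by (simp add: lborel_integral_translate lborel_integrable_translate)
  qed
  ultimately show ?thesis by (simp add: LIMSEQ_const_iff)
qed

section \<open>The Fourier integral, its derivative rules and its decay\<close>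

abbreviation fourier_const :: "'a::euclidean_space itself \<Rightarrow> real" where
  "fourier_const _ \<equiv> (2 * pi) powr (- real DIM('a) / 2)"

lemma cis_measurable [measurable]: "cis \<in> borel_measurable borel"
  by (intro borel_measurable_continuous_onI continuous_on_cis continuous_on_id)

lemma integrable_cis_mult [simp]:
  fixes f :: "'a::euclidean_space \<Rightarrow> complex"
  assumes "integrable lborel f" and [measurable]: "g \<in> borel_measurable borel"
  shows "integrable lborel (\<lambda>x. cis (g x) * f x)"
proof (rule Bochner_Integration.integrable_bound[OF assms(1)])
  note [measurable] = borel_measurable_integrable[OF assms(1)]
  show "(\<lambda>x. cis (g x) * f x) \<in> borel_measurable lborel" by measurable
qed (simp add: norm_mult)

lemma fourier_add:
  "integrable lborel f \<Longrightarrow> integrable lborel g \<Longrightarrow>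
    fourier (\<lambda>x. f x + g x) \<xi> = fourier f \<xi> + fourier g \<xi>"
  by (simp add: fourier_def distrib_left)

lemma fourier_diff:
  "integrable lborel f \<Longrightarrow> integrable lborel g \<Longrightarrow>
    fourier (\<lambda>x. f x - g x) \<xi> = fourier f \<xi> - fourier g \<xi>"
  by (simp add: fourier_def right_diff_distrib)

lemma fourier_cmult: "fourier (\<lambda>x. c * f x) \<xi> = c * fourier f \<xi>"
  by (simp add: fourier_def mult.left_commute[of _ c])

lemma fourier_sum:
  "(\<And>i. i \<in> I \<Longrightarrow> integrable lborel (f i)) \<Longrightarrow>
    fourier (\<lambda>x. \<Sum>i\<in>I. f i x) \<xi> = (\<Sum>i\<in>I. fourier (f i) \<xi>)"
  by (induction I rule: infinite_finite_induct) (auto simp: fourier_add, auto simp: fourier_def)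

lemma fourier_bound:
  fixes f :: "'a::euclidean_space \<Rightarrow> complex"
  shows "cmod (fourier f \<xi>) \<le> fourier_const TYPE('a) * (LINT x|lborel. cmod (f x))"
proof -
  have "cmod (LINT x|lborel. cis (- (x \<bullet> \<xi>)) * f x) \<le> (LINT x|lborel. cmod (cis (- (x \<bullet> \<xi>)) * f x))"
    by (rule integral_norm_bound)
  then show ?thesis
    unfolding fourier_def by (simp add: norm_mult mult_left_mono)
qed

text \<open>The vanishing integral of a derivative is applied to the character times
  \<open>f\<close> and expanded by the product rule.\<close>

lemma fourier_dir_deriv:
  assumes f: "f \<in> schwartz" and b: "b \<in> Basis"
  shows "fourier (dir_deriv b f) \<xi> = \<i> * of_real (\<xi> \<bullet> b) * fourier f \<xi>"
proof -
  let ?e = "\<lambda>x. cis (x \<bullet> (- \<xi>))"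
  have e: "(\<lambda>x. ?e x * g x) \<in> schwartz" if "g \<in> schwartz" for g
    by (rule schwartz_cis[OF that])
  have "dir_deriv b (\<lambda>x. ?e x * f x) = (\<lambda>x. ?e x * dir_deriv b f x + (\<i> * of_real (b \<bullet> (- \<xi>))) * (?e x * f x))"
  proof
    fix x
    have "dir_deriv b (\<lambda>x. ?e x * f x) x = ?e x * dir_deriv b f x + dir_deriv b ?e x * f x"
      using differentiableI[OF has_derivative_cis_inner] schwartz_differentiable[OF f]
      by (rule dir_deriv_mult)
    also have "dir_deriv b ?e x = \<i> * of_real (b \<bullet> (- \<xi>)) * ?e x"
      by (rule dir_deriv_eq[OF has_derivative_cis_inner])
    finally show "dir_deriv b (\<lambda>x. ?e x * f x) x = ?e x * dir_deriv b f x + (\<i> * of_real (b \<bullet> (- \<xi>))) * (?e x * f x)"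
      by (simp add: mult.assoc)
  qed
  with integral_dir_deriv[OF e[OF f] b]
  have "0 = (LINT x|lborel. ?e x * dir_deriv b f x) + (\<i> * of_real (b \<bullet> (- \<xi>))) * (LINT x|lborel. ?e x * f x)"
    using schwartz_integrable[OF e[OF f]] schwartz_integrable[OF e[OF schwartz_dir_deriv[OF f b]]]
    by (simp only: Bochner_Integration.integral_add integrable_mult_right integral_mult_right_zero)
  then have "(LINT x|lborel. ?e x * dir_deriv b f x) = \<i> * of_real (\<xi> \<bullet> b) * (LINT x|lborel. ?e x * f x)"
    by (simp add: inner_commute)
  then show ?thesis by (simp add: fourier_def)
qed

text \<open>Differentiation under the integral with an explicit remainder: the first-order Taylor
  expansion of \<open>cis\<close> leaves an error of at most |x|^2 |h|^2 |f x|, integrable in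
  \<open>x\<close>, so the total error is quadratic in \<open>h\<close>.\<close>

lemma fourier_has_derivative:
  fixes f :: "'a::euclidean_space \<Rightarrow> complex"
  assumes f: "f \<in> schwartz"
  shows "(fourier f has_derivative (\<lambda>h. fourier (\<lambda>x. - \<i> * (of_real (x \<bullet> h) * f x)) \<xi>)) (at \<xi>)"
proof -
  let ?D = "\<lambda>h. fourier (\<lambda>x. - \<i> * (of_real (x \<bullet> h) * f x)) \<xi>"
  have int: "integrable lborel (\<lambda>x. of_real (x \<bullet> h) * f x)" for h
    by (rule schwartz_integrable[OF schwartz_coord[OF f]])
  \<comment> \<open>The two extra powers of decay are spent on the factor
    \<open>(norm x)\<^sup>2\<close> of the remainder.\<close>
  obtain B where B: "0 < B" "\<And>x. cmod (f x) \<le> B / (1 + norm x) ^ (2 * DIM('a) + 2)"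
    using schwartz_bounded[OF f] by blast
  have p: "0 < 1 + norm x" for x :: 'a by (smt (verit) norm_ge_zero)
  note [measurable] = schwartz_measurable[OF f]
  have int2: "integrable lborel (\<lambda>x. of_real ((norm x)\<^sup>2) * f x)"
  proof (rule integrable_bound_one_plus_norm)
    fix x :: 'a
    have "cmod (of_real ((norm x)\<^sup>2) * f x) \<le> (1 + norm x)\<^sup>2 * (B / (1 + norm x) ^ (2 * DIM('a) + 2))"
      unfolding norm_mult by (intro mult_mono B) (auto intro!: power_mono simp: norm_power)
    also have "\<dots> = B / (1 + norm x) ^ (2 * DIM('a))" using p[of x] by (simp add: power_add power2_eq_square)
    finally show "cmod (of_real ((norm x)\<^sup>2) * f x) \<le> B / (1 + norm x) ^ (2 * DIM('a))" .
  qed measurable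
  define J where "J = fourier_const TYPE('a) * (LINT x|lborel. cmod (of_real ((norm x)\<^sup>2) * f x))"
  have lin: "bounded_linear ?D"
  proof -
    have "linear ?D"
    proof
      show "?D (x + y) = ?D x + ?D y" for x y
        using int by (simp only: fourier_cmult inner_add_right distrib_left distrib_right of_real_add fourier_add integrable_mult_right)
      show "?D (r *\<^sub>R x) = r *\<^sub>R ?D x" for r x
      proof -
        have "(\<lambda>y. - \<i> * (of_real (y \<bullet> (r *\<^sub>R x)) * f y)) = (\<lambda>y. of_real r * (- \<i> * (of_real (y \<bullet> x) * f y)))"
          by (auto simp: mult_ac)
        then show ?thesis by (simp only: fourier_cmult scaleR_conv_of_real)
      qed
    qed
    then show ?thesis by (rule linear_conv_bounded_linear[THEN iffD1])
  qed
  have rem: "cmod (fourier f (\<xi> + h) - fourier f \<xi> - ?D h) \<le> J * (norm h)\<^sup>2" for h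
  proof -
    define r where "r x = (cis (- (x \<bullet> h)) - 1 + \<i> * of_real (x \<bullet> h))" for x
    have r: "cmod (r x) \<le> (norm h)\<^sup>2 * (norm x)\<^sup>2" for x
    proof -
      have "cmod (r x) \<le> \<bar>- (x \<bullet> h)\<bar>\<^sup>2 / 2"
      proof -
        have "r x = exp (\<i> * of_real (- (x \<bullet> h))) - (\<Sum>k\<le>1. (\<i> * of_real (- (x \<bullet> h))) ^ k / fact k)"
          by (simp add: r_def cis_conv_exp algebra_simps)
        then show ?thesis
          using iexp_approx1[of "- (x \<bullet> h)" 1] by (simp add: numeral_2_eq_2)
      qed
      also have "\<dots> \<le> (norm x * norm h)\<^sup>2"
        using power_mono[OF Cauchy_Schwarz_ineq2[of x h] abs_ge_zero, of 2]
        by (simp add: divide_le_eq) (smt (verit) zero_le_power2)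
      finally show ?thesis by (simp add: power_mult_distrib mult.commute)
    qed
    have rf: "(\<lambda>x. r x * f x) = (\<lambda>x. (cis (- (x \<bullet> h)) * f x - f x) - - \<i> * (of_real (x \<bullet> h) * f x))"
      by (auto simp: r_def algebra_simps)
    have ci: "integrable lborel (\<lambda>x. cis (- (x \<bullet> h)) * f x)"
      by (rule integrable_cis_mult[OF schwartz_integrable[OF f]]) simp
    have ri: "integrable lborel (\<lambda>x. r x * f x)"
      unfolding rf by (intro Bochner_Integration.integrable_diff integrable_mult_right int ci schwartz_integrable[OF f])
    have "fourier f (\<xi> + h) - fourier f \<xi> - ?D h = fourier (\<lambda>x. r x * f x) \<xi>"
    proof -
      have "fourier f (\<xi> + h) = fourier (\<lambda>x. cis (- (x \<bullet> h)) * f x) \<xi>"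
      proof -
        have "cis (- (x \<bullet> (\<xi> + h))) = cis (- (x \<bullet> \<xi>)) * cis (- (x \<bullet> h))" for x
          by (simp add: cis_mult inner_add_right)
        then show ?thesis unfolding fourier_def by (simp add: mult.assoc)
      qed
      moreover have "fourier (\<lambda>x. r x * f x) \<xi>
          = fourier (\<lambda>x. cis (- (x \<bullet> h)) * f x) \<xi> - fourier f \<xi> - fourier (\<lambda>x. - \<i> * (of_real (x \<bullet> h) * f x)) \<xi>"
        unfolding rf using schwartz_integrable[OF f] int[of h] ci
        by (simp only: fourier_diff integrable_mult_right Bochner_Integration.integrable_diff)
      ultimately show ?thesis by simp
    qed
    then have "cmod (fourier f (\<xi> + h) - fourier f \<xi> - ?D h) \<le> fourier_const TYPE('a) * (LINT x|lborel. cmod (r x * f x))"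
      using fourier_bound[of "\<lambda>x. r x * f x" \<xi>] by simp
    also have "(LINT x|lborel. cmod (r x * f x)) \<le> (LINT x|lborel. (norm h)\<^sup>2 * cmod (of_real ((norm x)\<^sup>2) * f x))"
      using ri int2 r by (intro integral_mono integrable_norm integrable_mult_right)
        (auto simp: norm_mult norm_power mult.assoc[symmetric] intro!: mult_right_mono)
    finally show ?thesis by (simp add: J_def mult_ac)
  qed
  have "((\<lambda>h. norm (fourier f (\<xi> + h) - fourier f \<xi> - ?D h) / norm h) \<longlongrightarrow> 0) (at 0)"
  proof (rule tendsto_sandwich[OF always_eventually always_eventually])
    show "\<forall>h. 0 \<le> norm (fourier f (\<xi> + h) - fourier f \<xi> - ?D h) / norm h" by simp
    show "\<forall>h. norm (fourier f (\<xi> + h) - fourier f \<xi> - ?D h) / norm h \<le> J * norm h"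
      using rem by (auto simp: divide_simps power2_eq_square mult.assoc)
    show "((\<lambda>h. J * norm h) \<longlongrightarrow> 0) (at 0)"
      by (auto intro!: tendsto_eq_intros)
  qed simp
  then show ?thesis unfolding has_derivative_at using lin by simp
qed

lemma norm_power2_Basis: "(norm x)\<^sup>2 = (\<Sum>b\<in>Basis. (x \<bullet> b)\<^sup>2)" for x :: "'a::euclidean_space"
  unfolding power2_norm_eq_inner by (subst euclidean_inner) (simp add: power2_eq_square)

text \<open>The Fourier multiplier with symbol 1 + |xi|^2. Its powers turn smoothness of
  \<open>f\<close> into polynomial decay of the transform.\<close>

definition one_minus_laplacian :: "('a::euclidean_space \<Rightarrow> complex) \<Rightarrow> 'a \<Rightarrow> complex" where
  "one_minus_laplacian f x = f x - (\<Sum>b\<in>Basis. dir_deriv b (dir_deriv b f) x)"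

lemma schwartz_diff: "f \<in> schwartz \<Longrightarrow> g \<in> schwartz \<Longrightarrow> (\<lambda>x. f x - g x) \<in> schwartz"
  using schwartz_add[of f "\<lambda>x. -1 * g x"] schwartz_cmult[of g "-1"] by simp

lemma schwartz_one_minus_laplacian: "f \<in> schwartz \<Longrightarrow> one_minus_laplacian f \<in> schwartz"
  unfolding one_minus_laplacian_def[abs_def]
  by (intro schwartz_diff schwartz_sum schwartz_dir_deriv)

lemma fourier_one_minus_laplacian:
  assumes f: "f \<in> schwartz"
  shows "fourier (one_minus_laplacian f) \<xi> = of_real (1 + (norm \<xi>)\<^sup>2) * fourier f \<xi>"
proof -
  have int: "integrable lborel (dir_deriv b (dir_deriv b f))" if "b \<in> Basis" for b
    using that f by (intro schwartz_integrable schwartz_dir_deriv)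
  have "fourier (one_minus_laplacian f) \<xi>
      = fourier f \<xi> - (\<Sum>b\<in>Basis. fourier (dir_deriv b (dir_deriv b f)) \<xi>)"
    unfolding one_minus_laplacian_def[abs_def]
    using int f by (subst fourier_diff) (auto simp: fourier_sum schwartz_integrable)
  also have "\<dots> = fourier f \<xi> + (\<Sum>b\<in>Basis. of_real ((\<xi> \<bullet> b)\<^sup>2)) * fourier f \<xi>"
  proof -
    have "fourier (dir_deriv b (dir_deriv b f)) \<xi> = - (of_real ((\<xi> \<bullet> b)\<^sup>2) * fourier f \<xi>)" if "b \<in> Basis" for b
      using that f by (simp add: fourier_dir_deriv schwartz_dir_deriv power2_eq_square mult_ac)
    then show ?thesis by (simp add: sum_negf sum_distrib_right)
  qed
  also have "(\<Sum>b\<in>Basis. complex_of_real ((\<xi> \<bullet> b)\<^sup>2)) = of_real ((norm \<xi>)\<^sup>2)"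
    by (simp add: norm_power2_Basis)
  finally show ?thesis by (simp add: distrib_right)
qed

lemma rapid_fourier:
  assumes f: "f \<in> schwartz"
  shows "rapid (fourier f)"
  unfolding rapid_def
proof
  fix k :: nat
  let ?g = "(one_minus_laplacian ^^ k) f"
  have g: "(one_minus_laplacian ^^ j) f \<in> schwartz" for j
    by (induction j) (auto simp: f schwartz_one_minus_laplacian)
  have eq: "fourier ((one_minus_laplacian ^^ j) f) \<xi> = of_real (1 + (norm \<xi>)\<^sup>2) ^ j * fourier f \<xi>" for j \<xi>
    by (induction j) (simp_all add: fourier_one_minus_laplacian[OF g])
  let ?B = "fourier_const TYPE('a) * (LINT x|lborel. cmod (?g x))"
  have "(1 + norm \<xi>) ^ k * cmod (fourier f \<xi>) \<le> 2 ^ k * ?B" for \<xi>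
  proof -
    have "0 \<le> (norm \<xi> - 1)\<^sup>2" by simp
    then have "1 + norm \<xi> \<le> 2 * (1 + (norm \<xi>)\<^sup>2)"
      unfolding power2_diff using zero_le_power2[of "norm \<xi>"] norm_ge_zero[of \<xi>] by (simp; linarith)
    then have "(1 + norm \<xi>) ^ k \<le> (2 * (1 + (norm \<xi>)\<^sup>2)) ^ k" by (intro power_mono) auto
    then have "(1 + norm \<xi>) ^ k * cmod (fourier f \<xi>) \<le> (2 * (1 + (norm \<xi>)\<^sup>2)) ^ k * cmod (fourier f \<xi>)"
      by (rule mult_right_mono) simp
    also have "\<dots> = 2 ^ k * cmod (fourier ?g \<xi>)"
    proof -
      have "cmod (of_real (1 + (norm \<xi>)\<^sup>2) ^ k) = (1 + (norm \<xi>)\<^sup>2) ^ k"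
        unfolding norm_power norm_of_real by simp
      then show ?thesis unfolding eq norm_mult power_mult_distrib by simp
    qed
    also have "\<dots> \<le> 2 ^ k * ?B" by (intro mult_left_mono fourier_bound) simp
    finally show ?thesis .
  qed
  then show "\<exists>B. \<forall>x. (1 + norm x) ^ k * cmod (fourier f x) \<le> B" by blast
qed

text \<open>Coinduction on the image of the Schwartz space: a derivative of \<open>fourier f\<close>
  is the transform of a coordinate multiple of \<open>f\<close>, hence again in the image, and
  \<open>rapid_fourier\<close> gives the decay.\<close>

lemma schwartz_fourier:
  assumes f: "f \<in> schwartz"
  shows "fourier f \<in> schwartz"
proof (rule schwartzI_coinduct[where X = "fourier ` schwartz"])
  fix g :: "'a \<Rightarrow> complex" and b :: 'a assume "g \<in> fourier ` schwartz"
  then obtain f where f: "f \<in> schwartz" and g: "g = fourier f" by blast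
  have "dir_deriv b g = fourier (\<lambda>x. - \<i> * (of_real (x \<bullet> b) * f x))"
    unfolding g by (rule ext, rule dir_deriv_eq[OF fourier_has_derivative[OF f]])
  then show "dir_deriv b g \<in> fourier ` schwartz"
    using imageI[OF schwartz_cmult[OF schwartz_coord[OF f]]] by (simp only:)
qed (use f fourier_has_derivative in \<open>auto intro: rapid_fourier differentiableI\<close>)

section \<open>Gaussians and Fourier inversion\<close>

definition gaussian :: "real \<Rightarrow> 'a::euclidean_space \<Rightarrow> 'a \<Rightarrow> complex" where
  "gaussian c y x = of_real (exp (x \<bullet> y - c * (norm x)\<^sup>2))"

lemma gaussian_has_derivative:
  "(gaussian c y has_derivative (\<lambda>h. of_real (h \<bullet> y - 2 * c * (x \<bullet> h)) * gaussian c y x)) (at x)"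
  unfolding gaussian_def power2_norm_eq_inner
  by (auto intro!: derivative_eq_intros simp: inner_commute algebra_simps scaleR_conv_of_real fun_eq_iff)

lemma rapid_gaussian:
  fixes y :: "'a::euclidean_space"
  assumes c: "0 < c" shows "rapid (gaussian c y)"
  unfolding rapid_def
proof
  fix k :: nat
  \<comment> \<open>\<open>?u\<close> collects the linear growth in |x|: \<open>k\<close> from (1 +
    |x|)^k <= exp (k |x|) and \<open>norm y\<close> from Cauchy-Schwarz. The maximum of u r - c r^2
    over r is u^2 / (4 c).\<close>
  let ?u = "norm y + k"
  have "(1 + norm x) ^ k * cmod (gaussian c y x) \<le> exp (?u\<^sup>2 / (4 * c))" for x
  proof -
    have "(1 + norm x) ^ k \<le> exp (norm x) ^ k" by (intro power_mono exp_ge_add_one_self) auto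
    then have "(1 + norm x) ^ k \<le> exp (k * norm x)" by (simp add: exp_of_nat_mult)
    moreover have "x \<bullet> y \<le> norm x * norm y" by (rule norm_cauchy_schwarz)
    ultimately have "(1 + norm x) ^ k * cmod (gaussian c y x)
        \<le> exp (k * norm x) * exp (norm x * norm y - c * (norm x)\<^sup>2)"
      unfolding gaussian_def by (intro mult_mono) auto
    also have "\<dots> = exp (?u * norm x - c * (norm x)\<^sup>2)"
      by (simp add: exp_add[symmetric] algebra_simps)
    also have "?u * norm x - c * (norm x)\<^sup>2 \<le> ?u\<^sup>2 / (4 * c)"
    proof -
      have "0 \<le> (?u - 2 * c * norm x)\<^sup>2" by simp
      then have "4 * c * (?u * norm x - c * (norm x)\<^sup>2) \<le> ?u\<^sup>2"
        by (simp add: power2_eq_square algebra_simps)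
      then show ?thesis using c by (simp add: field_simps)
    qed
    finally show ?thesis by simp
  qed
  then show "\<exists>B. \<forall>x. (1 + norm x) ^ k * cmod (gaussian c y x) \<le> B" by blast
qed

text \<open>Polynomial multiples of one Gaussian. Differentiating the Gaussian only multiplies it by
  a polynomial, so this class is the invariant set for the coinduction.\<close>

inductive_set gauss_span :: "real \<Rightarrow> 'a::euclidean_space \<Rightarrow> ('a \<Rightarrow> complex) set" for c y where
  base: "gaussian c y \<in> gauss_span c y"
| coord: "f \<in> gauss_span c y \<Longrightarrow> (\<lambda>x. of_real (x \<bullet> b) * f x) \<in> gauss_span c y"
| scale: "f \<in> gauss_span c y \<Longrightarrow> (\<lambda>x. a * f x) \<in> gauss_span c y"
| add: "f \<in> gauss_span c y \<Longrightarrow> g \<in> gauss_span c y \<Longrightarrow> (\<lambda>x. f x + g x) \<in> gauss_span c y"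

lemma schwartz_gaussian:
  fixes y :: "'a::euclidean_space"
  assumes c: "0 < c" shows "gaussian c y \<in> schwartz"
proof -
  have 1: "(\<forall>x. f differentiable (at x)) \<and> (\<forall>b. dir_deriv b f \<in> gauss_span c y)"
    if "f \<in> gauss_span c y" for f
    using that
  proof induction
    case base
    have "dir_deriv b (gaussian c y) = (\<lambda>x. of_real (b \<bullet> y) * gaussian c y x +
        (- 2 * of_real c) * (of_real (x \<bullet> b) * gaussian c y x))" for b
      by (rule ext, subst dir_deriv_eq[OF gaussian_has_derivative]) (simp add: algebra_simps)
    moreover have "(\<lambda>x. of_real (b \<bullet> y) * gaussian c y x +
        (- 2 * of_real c) * (of_real (x \<bullet> b) * gaussian c y x)) \<in> gauss_span c y" for b
      by (intro gauss_span.intros)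
    ultimately show ?case
      using differentiableI[OF gaussian_has_derivative] by (simp only:) blast
  next
    case (coord f b)
    then have d: "f differentiable (at x)" for x by blast
    have "dir_deriv h (\<lambda>x. of_real (x \<bullet> b) * f x) = (\<lambda>x. of_real (x \<bullet> b) * dir_deriv h f x + of_real (h \<bullet> b) * f x)" for h
      by (rule ext, subst dir_deriv_mult[OF differentiableI[OF coord_has_derivative] d])
         (simp add: dir_deriv_eq[OF coord_has_derivative])
    then show ?case
      using coord differentiableI[OF coord_has_derivative]
      by (auto intro!: differentiable_mult gauss_span.add gauss_span.coord gauss_span.scale)
  next
    case (scale f a)
    then have d: "f differentiable (at x)" for x by blast
    have "dir_deriv h (\<lambda>x. a * f x) = (\<lambda>x. a * dir_deriv h f x)" for h
      by (rule ext, subst dir_deriv_mult[OF differentiable_const d]) simp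
    then show ?case using scale by (auto intro!: differentiable_mult gauss_span.scale)
  next
    case (add f g)
    then have "dir_deriv b (\<lambda>x. f x + g x) = (\<lambda>x. dir_deriv b f x + dir_deriv b g x)" for b
      by (intro ext dir_deriv_add) auto
    with add show ?case by (simp add: gauss_span.add)
  qed
  have 2: "rapid f" if "f \<in> gauss_span c y" for f
    using that
  proof induction
    case base then show ?case by (rule rapid_gaussian[OF c])
  next
    case (coord f b) then show ?case by (intro rapid_mult[OF poly_bounded_coord])
  next
    case (scale f a) then show ?case by (intro rapid_mult[OF poly_bounded_const])
  next
    case (add f g) then show ?case by (intro rapid_add)
  qed
  show ?thesis
    by (rule schwartzI_coinduct[OF gauss_span.base]) (use 1 2 in blast)+
qed

lemma cis_neg_sum: "finite I \<Longrightarrow> cis (- sum f I) = (\<Prod>i\<in>I. cis (- f i))"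
proof (induction I rule: finite_induct)
  case (insert i I)
  have "cis (- sum f (insert i I)) = cis (- f i) * cis (- sum f I)"
    using insert.hyps by (simp add: cis_mult)
  with insert show ?case by simp
qed simp

text \<open>This is the characteristic function of the standard normal distribution, read at
  \<open>- t\<close> because of the sign in \<open>fourier\<close>.\<close>

lemma integral_gaussian_real:
  "integrable lborel (\<lambda>x::real. cis (- (x * t)) * of_real (exp (- (x\<^sup>2 / 2))))"
  "(LINT x|lborel. cis (- (x * t)) * complex_of_real (exp (- (x\<^sup>2 / 2)))) = of_real (sqrt (2 * pi) * exp (- (t\<^sup>2 / 2)))"
proof -
  have e: "complex_of_real (exp (- (x\<^sup>2 / 2))) = of_real (sqrt (2 * pi)) * of_real (std_normal_density x)" for x
    unfolding std_normal_density_def of_real_mult[symmetric] by simp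
  have "integrable lborel (\<lambda>x. sqrt (2 * pi) * std_normal_density x)"
    by (intro integrable_mult_right integrable_normal_density) simp
  then have i: "integrable lborel (\<lambda>x. complex_of_real (exp (- (x\<^sup>2 / 2))))"
    unfolding e of_real_mult[symmetric] by (rule integrable_of_real)
  then show "integrable lborel (\<lambda>x::real. cis (- (x * t)) * of_real (exp (- (x\<^sup>2 / 2))))"
    by (intro integrable_cis_mult) auto
  have "complex_of_real (exp (- ((-t)\<^sup>2) / 2)) = (CLINT x|std_normal_distribution. iexp ((-t) * x))"
    unfolding char_std_normal_distribution[THEN fun_cong, symmetric] char_def ..
  also have "\<dots> = (LINT x|lborel. std_normal_density x *\<^sub>R iexp ((-t) * x))"
    by (subst integral_density) (auto simp: normal_density_nonneg)
  finally have *: "(LINT x|lborel. std_normal_density x *\<^sub>R iexp ((-t) * x)) = complex_of_real (exp (- ((-t)\<^sup>2) / 2))" ..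
  have "(LINT x|lborel. cis (- (x * t)) * complex_of_real (exp (- (x\<^sup>2 / 2))))
     = (LINT x|lborel. of_real (sqrt (2 * pi)) * (std_normal_density x *\<^sub>R iexp ((-t) * x)))"
    unfolding e by (intro Bochner_Integration.integral_cong refl) (simp add: cis_conv_exp scaleR_conv_of_real mult_ac)
  also have "\<dots> = of_real (sqrt (2 * pi) * exp (- (t\<^sup>2 / 2)))"
    by (subst integral_mult_right_zero, subst *) simp
  finally show "(LINT x|lborel. cis (- (x * t)) * complex_of_real (exp (- (x\<^sup>2 / 2)))) = of_real (sqrt (2 * pi) * exp (- (t\<^sup>2 / 2)))" .
qed

text \<open>The integral factors over the coordinates, and \<open>sqrt (2 * pi) ^ DIM('a)\<close>
  cancels the normalization. The parameter 1/2 is what makes the Gaussian a fixed point.\<close>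

lemma fourier_gaussian: "fourier (gaussian (1/2) 0) \<xi> = gaussian (1/2) 0 (\<xi> :: 'a::euclidean_space)"
proof -
  have n: "(norm z)\<^sup>2 = (\<Sum>b\<in>Basis. (z \<bullet> b)\<^sup>2)" for z :: 'a by (rule norm_power2_Basis)
  have g: "gaussian (1/2) 0 z = (\<Prod>b\<in>Basis. of_real (exp (- ((z \<bullet> b)\<^sup>2 / 2))))" for z :: 'a
    unfolding gaussian_def n by (simp add: sum_divide_distrib sum_negf[symmetric] exp_sum flip: of_real_prod)
  have "cis (- (x \<bullet> \<xi>)) * gaussian (1/2) 0 x
      = (\<Prod>b\<in>Basis. cis (- ((x \<bullet> b) * (\<xi> \<bullet> b))) * of_real (exp (- ((x \<bullet> b)\<^sup>2 / 2))))" for x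
    unfolding g by (subst euclidean_inner) (simp add: cis_neg_sum prod.distrib)
  then have "(LINT x|lborel. cis (- (x \<bullet> \<xi>)) * gaussian (1/2) 0 x)
      = (\<Prod>b::'a\<in>Basis. of_real (sqrt (2 * pi) * exp (- ((\<xi> \<bullet> b)\<^sup>2 / 2))))"
    by (simp only: lborel_integral_prod[OF integral_gaussian_real(1)] integral_gaussian_real(2))
  also have "\<dots> = of_real (sqrt (2 * pi) ^ DIM('a)) * gaussian (1/2) 0 \<xi>"
    unfolding g by (simp add: prod.distrib)
  finally have "fourier (gaussian (1/2) 0) \<xi> =
      of_real (fourier_const TYPE('a) * sqrt (2 * pi) ^ DIM('a)) * gaussian (1/2) 0 \<xi>"
    by (simp add: fourier_def)
  also have "fourier_const TYPE('a) * sqrt (2 * pi) ^ DIM('a) = 1"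
  proof -
    have "sqrt (2 * pi) ^ DIM('a) = sqrt (2 * pi) powr real DIM('a)" by (rule powr_realpow[symmetric]) simp
    also have "\<dots> = ((2 * pi) powr (1 / 2)) powr real DIM('a)" by (simp only: powr_half_sqrt pi_ge_zero mult_nonneg_nonneg zero_le_numeral)
    also have "\<dots> = (2 * pi) powr (real DIM('a) / 2)" by (simp only: powr_powr) simp
    finally show ?thesis by (simp add: powr_minus field_simps)
  qed
  finally show ?thesis by simp
qed

lemma integrable_pair_mult:
  fixes f :: "'a::euclidean_space \<Rightarrow> complex" and g :: "'b::euclidean_space \<Rightarrow> complex"
  assumes f: "integrable lborel f" and g: "integrable lborel g"
  shows "integrable (lborel \<Otimes>\<^sub>M lborel) (\<lambda>(x, y). f x * g y)"
proof -
  note [measurable] = borel_measurable_integrable[OF f] borel_measurable_integrable[OF g]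
  show ?thesis
    by (rule lborel_pair.Fubini_integrable) (auto simp: norm_mult intro!: integrable_norm f g)
qed

text \<open>Both sides are the same absolutely convergent double integral. The identity moves the
  transform onto a Gaussian in the inversion formula and also yields Parseval's identity.\<close>

lemma fourier_multiplication:
  fixes f g :: "'a::euclidean_space \<Rightarrow> complex"
  assumes f: "integrable lborel f" and g: "integrable lborel g"
  shows "(LINT \<xi>|lborel. fourier f \<xi> * g \<xi>) = (LINT x|lborel. f x * fourier g x)"
proof -
  note [measurable] = borel_measurable_integrable[OF f] borel_measurable_integrable[OF g]
  let ?h = "\<lambda>x \<xi>. cis (- (x \<bullet> \<xi>)) * (f x * g \<xi>)"
  have i: "integrable (lborel \<Otimes>\<^sub>M lborel) (\<lambda>(x, \<xi>). ?h x \<xi>)"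
    by (rule Bochner_Integration.integrable_bound[OF integrable_pair_mult[OF f g]])
       (auto simp: norm_mult)
  let ?c = "complex_of_real (fourier_const TYPE('a))"
  have "(LINT \<xi>|lborel. fourier f \<xi> * g \<xi>) = ?c * (LINT \<xi>|lborel. (LINT x|lborel. ?h x \<xi>))"
    unfolding fourier_def by (simp add: mult_ac flip: integral_mult_right_zero integral_mult_left_zero)
  also have "(LINT \<xi>|lborel. (LINT x|lborel. ?h x \<xi>)) = (LINT x|lborel. (LINT \<xi>|lborel. ?h x \<xi>))"
    by (rule lborel_pair.Fubini_integral[OF i])
  also have "?c * \<dots> = (LINT x|lborel. f x * fourier g x)"
    unfolding fourier_def by (simp add: mult_ac inner_commute flip: integral_mult_right_zero integral_mult_left_zero)
  finally show ?thesis .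
qed

lemma fourier_modulate: "fourier (\<lambda>x. cis (x \<bullet> y) * f x) \<xi> = fourier f (\<xi> - y)"
proof -
  have "cis (- (x \<bullet> \<xi>)) * cis (x \<bullet> y) = cis (- (x \<bullet> (\<xi> - y)))" for x
    by (simp add: cis_mult inner_diff_right)
  then show ?thesis unfolding fourier_def by (simp flip: mult.assoc)
qed

lemma fourier_scale:
  fixes f :: "'a::euclidean_space \<Rightarrow> complex"
  assumes [measurable]: "f \<in> borel_measurable borel" and c: "c \<noteq> 0"
  shows "fourier (\<lambda>x. f (c *\<^sub>R x)) \<xi> = (1 / \<bar>c\<bar> ^ DIM('a)) *\<^sub>R fourier f (\<xi> /\<^sub>R c)"
proof -
  let ?k = "\<lambda>x. cis (- (x \<bullet> (\<xi> /\<^sub>R c))) * f x"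
  have "(LINT x|lborel. ?k (c *\<^sub>R x)) = (1 / \<bar>c\<bar> ^ DIM('a)) *\<^sub>R integral\<^sup>L lborel ?k"
    by (rule lborel_integral_scale[OF _ c]) measurable
  moreover have "(c *\<^sub>R x) \<bullet> (\<xi> /\<^sub>R c) = x \<bullet> \<xi>" for x using c by simp
  ultimately show ?thesis unfolding fourier_def by (simp only: scaleR_conv_of_real mult.left_commute)
qed

lemma gaussian_measurable [measurable]: "gaussian c y \<in> borel_measurable borel"
  unfolding gaussian_def by measurable

lemma integral_gaussian:
  "of_real (fourier_const TYPE('a)) * (LINT x|lborel. gaussian (1/2) 0 (x :: 'a::euclidean_space)) = 1"
  using fourier_gaussian[of "0 :: 'a"] unfolding fourier_def by (simp add: gaussian_def)

lemma gaussian_bound: "cmod (gaussian c 0 x) \<le> 1" if "0 \<le> c"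
  using that by (simp add: gaussian_def)

lemma inverse_Suc_limit: "(\<lambda>n. 1 / (real n + 1)) \<longlonglongrightarrow> 0"
  using LIMSEQ_inverse_real_of_nat by (simp add: inverse_eq_divide add.commute)

text \<open>Gaussians of shrinking width form an approximate identity. The total mass stays as a
  factor since this kernel is not normalized.\<close>

lemma gaussian_averages:
  fixes \<eta> :: "'a::euclidean_space \<Rightarrow> complex"
  assumes cont: "continuous_on UNIV \<eta>" and B: "\<And>x. cmod (\<eta> x) \<le> B"
  shows "(\<lambda>n. LINT z|lborel. \<eta> (x + (1 / (real n + 1)) *\<^sub>R z) * gaussian (1/2) 0 z)
    \<longlonglongrightarrow> \<eta> x * (LINT z|lborel. gaussian (1/2) 0 (z :: 'a))"
proof -
  have [measurable]: "\<eta> \<in> borel_measurable borel"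
    using cont by (rule borel_measurable_continuous_onI)
  have gi: "integrable lborel (gaussian (1/2) (0::'a))"
    by (intro schwartz_integrable schwartz_gaussian) simp
  have "(\<lambda>n. LINT z|lborel. \<eta> (x + (1 / (real n + 1)) *\<^sub>R z) * gaussian (1/2) 0 z)
      \<longlonglongrightarrow> (LINT z|lborel. \<eta> x * gaussian (1/2) 0 (z :: 'a))"
  proof (rule integral_dominated_convergence[where w = "\<lambda>z. B * cmod (gaussian (1/2) 0 z)"])
    show "integrable lborel (\<lambda>z. B * cmod (gaussian (1/2) (0::'a) z))"
      by (intro integrable_mult_right integrable_norm gi)
    show "AE z in lborel. (\<lambda>n. \<eta> (x + (1 / (real n + 1)) *\<^sub>R z) * gaussian (1/2) 0 z) \<longlonglongrightarrow> \<eta> x * gaussian (1/2) 0 z"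
    proof (rule AE_I2)
      fix z :: 'a
      have "(\<lambda>n. x + (1 / (real n + 1)) *\<^sub>R z) \<longlonglongrightarrow> x + 0 *\<^sub>R z"
        by (rule tendsto_add[OF tendsto_const tendsto_scaleR[OF inverse_Suc_limit tendsto_const]])
      moreover have "isCont \<eta> x" using cont by (simp add: continuous_on_eq_continuous_at)
      ultimately have "(\<lambda>n. \<eta> (x + (1 / (real n + 1)) *\<^sub>R z)) \<longlonglongrightarrow> \<eta> x"
        using isCont_tendsto_compose by force
      then show "(\<lambda>n. \<eta> (x + (1 / (real n + 1)) *\<^sub>R z) * gaussian (1/2) 0 z) \<longlonglongrightarrow> \<eta> x * gaussian (1/2) 0 z"
        by (intro tendsto_intros)
    qed
    show "AE z in lborel. norm (\<eta> (x + (1 / (real n + 1)) *\<^sub>R z) * gaussian (1/2) 0 z) \<le> B * cmod (gaussian (1/2) 0 z)" for n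
      using B by (auto simp: norm_mult intro!: mult_right_mono)
  qed measurable
  then show ?thesis by simp
qed

lemma integral_gaussian_rescale:
  fixes \<eta> :: "'a::euclidean_space \<Rightarrow> complex"
  assumes [measurable]: "\<eta> \<in> borel_measurable borel" and c: "0 < c"
  shows "(LINT z|lborel. \<eta> (x + c *\<^sub>R z) * gaussian (1/2) 0 z)
    = (1 / c ^ DIM('a)) *\<^sub>R (LINT y|lborel. \<eta> y * gaussian (1/2) 0 ((y - x) /\<^sub>R c))"
proof -
  let ?K = "\<lambda>y. \<eta> y * gaussian (1/2) 0 ((y - x) /\<^sub>R c)"
  let ?L = "\<lambda>y. ?K (x + y)"
  have "(LINT z|lborel. \<eta> (x + c *\<^sub>R z) * gaussian (1/2) 0 z) = (LINT z|lborel. ?L (c *\<^sub>R z))"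
    using c by simp
  also have "\<dots> = (1 / \<bar>c\<bar> ^ DIM('a)) *\<^sub>R integral\<^sup>L lborel ?L"
    using c by (intro lborel_integral_scale) auto
  also have "integral\<^sup>L lborel ?L = integral\<^sup>L lborel ?K"
    by (rule lborel_integral_translate) measurable
  finally show ?thesis using c by simp
qed

text \<open>The Gaussian factor makes the multiplication formula applicable to the modulation
  \<open>cis (\<xi> \<bullet> x)\<close>, which itself is not integrable.\<close>

lemma fourier_inversion:
  fixes \<phi> :: "'a::euclidean_space \<Rightarrow> complex"
  assumes \<phi>: "\<phi> \<in> schwartz"
  shows "of_real (fourier_const TYPE('a)) * (LINT \<xi>|lborel. cis (\<xi> \<bullet> x) * fourier \<phi> \<xi>) = \<phi> x"
proof -
  let ?\<gamma> = "gaussian (1/2) 0 :: 'a \<Rightarrow> complex"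
  let ?\<epsilon> = "\<lambda>n. 1 / (real n + 1)"
  have e: "0 < ?\<epsilon> n" for n by simp
  \<comment> \<open>The inversion integral, damped by a Gaussian that tends to 1. The multiplication
    formula rewrites \<open>A n\<close> as a Gaussian average of \<open>\<phi>\<close> around
    \<open>x\<close>; the two resulting limits of \<open>A\<close> are compared.\<close>
  define A where "A n = (LINT \<xi>|lborel. fourier \<phi> \<xi> * (cis (\<xi> \<bullet> x) * ?\<gamma> (?\<epsilon> n *\<^sub>R \<xi>)))" for n
  note [measurable] = schwartz_measurable[OF \<phi>] schwartz_measurable[OF schwartz_fourier[OF \<phi>]]
  have gi: "integrable lborel ?\<gamma>" by (intro schwartz_integrable schwartz_gaussian) simp
  have A_eq: "A = (\<lambda>n. LINT z|lborel. \<phi> (x + ?\<epsilon> n *\<^sub>R z) * ?\<gamma> z)"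
  proof
    fix n
    have gn: "integrable lborel (\<lambda>\<xi>. ?\<gamma> (?\<epsilon> n *\<^sub>R \<xi>))"
      using e[of n] gi by (subst lborel_integrable_scale) auto
    have "A n = (LINT y|lborel. \<phi> y * fourier (\<lambda>\<xi>. cis (\<xi> \<bullet> x) * ?\<gamma> (?\<epsilon> n *\<^sub>R \<xi>)) y)"
      unfolding A_def by (rule fourier_multiplication[OF schwartz_integrable[OF \<phi>] integrable_cis_mult[OF gn]]) measurable
    also have "\<dots> = (LINT y|lborel. (1 / ?\<epsilon> n ^ DIM('a)) *\<^sub>R (\<phi> y * ?\<gamma> ((y - x) /\<^sub>R ?\<epsilon> n)))"
      using e[of n] by (simp only: fourier_modulate fourier_scale[OF gaussian_measurable less_imp_neq[OF e, symmetric]] fourier_gaussian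
          abs_of_pos mult_scaleR_right)
    also have "\<dots> = (LINT z|lborel. \<phi> (x + ?\<epsilon> n *\<^sub>R z) * ?\<gamma> z)"
      by (subst integral_gaussian_rescale[OF _ e]) (auto simp del: divide_divide_eq_right)
    finally show "A n = (LINT z|lborel. \<phi> (x + ?\<epsilon> n *\<^sub>R z) * ?\<gamma> z)" .
  qed
  have "A \<longlonglongrightarrow> \<phi> x * integral\<^sup>L lborel ?\<gamma>"
    unfolding A_eq
  proof -
    obtain B where "\<And>x. cmod (\<phi> x) \<le> B / (1 + norm x) ^ 0" using schwartz_bounded[OF \<phi>] by blast
    then show "(\<lambda>n. LINT z|lborel. \<phi> (x + ?\<epsilon> n *\<^sub>R z) * ?\<gamma> z) \<longlonglongrightarrow> \<phi> x * integral\<^sup>L lborel ?\<gamma>"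
      by (intro gaussian_averages schwartz_continuous[OF \<phi>]) simp
  qed
  moreover have "A \<longlonglongrightarrow> (LINT \<xi>|lborel. fourier \<phi> \<xi> * (cis (\<xi> \<bullet> x) * 1))"
    unfolding A_def[abs_def]
  proof (rule integral_dominated_convergence[where w = "\<lambda>\<xi>. cmod (fourier \<phi> \<xi>)"])
    show "integrable lborel (\<lambda>\<xi>. cmod (fourier \<phi> \<xi>))"
      by (intro integrable_norm schwartz_integrable schwartz_fourier \<phi>)
    show "AE \<xi> in lborel. (\<lambda>n. fourier \<phi> \<xi> * (cis (\<xi> \<bullet> x) * ?\<gamma> (?\<epsilon> n *\<^sub>R \<xi>))) \<longlonglongrightarrow> fourier \<phi> \<xi> * (cis (\<xi> \<bullet> x) * 1)"
    proof (rule AE_I2)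
      fix \<xi> :: 'a
      have "(\<lambda>n. ?\<epsilon> n *\<^sub>R \<xi>) \<longlonglongrightarrow> 0 *\<^sub>R \<xi>"
        by (rule tendsto_scaleR[OF inverse_Suc_limit tendsto_const])
      moreover have "isCont ?\<gamma> 0" by (rule has_derivative_continuous[OF gaussian_has_derivative])
      ultimately have "(\<lambda>n. ?\<gamma> (?\<epsilon> n *\<^sub>R \<xi>)) \<longlonglongrightarrow> ?\<gamma> 0"
        using isCont_tendsto_compose by force
      then show "(\<lambda>n. fourier \<phi> \<xi> * (cis (\<xi> \<bullet> x) * ?\<gamma> (?\<epsilon> n *\<^sub>R \<xi>))) \<longlonglongrightarrow> fourier \<phi> \<xi> * (cis (\<xi> \<bullet> x) * 1)"
        by (intro tendsto_intros) (simp add: gaussian_def)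
    qed
    show "AE \<xi> in lborel. norm (fourier \<phi> \<xi> * (cis (\<xi> \<bullet> x) * ?\<gamma> (?\<epsilon> n *\<^sub>R \<xi>))) \<le> cmod (fourier \<phi> \<xi>)" for n
      by (intro AE_I2) (simp add: norm_mult mult_left_le gaussian_bound)
  qed measurable
  ultimately have "(LINT \<xi>|lborel. fourier \<phi> \<xi> * (cis (\<xi> \<bullet> x) * 1)) = \<phi> x * integral\<^sup>L lborel ?\<gamma>"
    by (intro LIMSEQ_unique[where X = A])
  then have "of_real (fourier_const TYPE('a)) * (LINT \<xi>|lborel. cis (\<xi> \<bullet> x) * fourier \<phi> \<xi>)
      = \<phi> x * (of_real (fourier_const TYPE('a)) * integral\<^sup>L lborel ?\<gamma>)"
    by (simp add: mult_ac)
  then show ?thesis unfolding integral_gaussian by simp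
qed

section \<open>The inverse transform and Parseval's identity\<close>

definition fourier_inv :: "('a::euclidean_space \<Rightarrow> complex) \<Rightarrow> 'a \<Rightarrow> complex" where
  "fourier_inv \<phi> \<xi> = fourier \<phi> (- \<xi>)"

lemma fourier_inv_altdef:
  "fourier_inv \<phi> \<xi> = of_real (fourier_const TYPE('a)) * (LINT x|lborel. cis (x \<bullet> \<xi>) * \<phi> x)"
  for \<xi> :: "'a::euclidean_space"
  by (simp add: fourier_inv_def fourier_def)

lemma fourier_inv_reflect:
  fixes \<phi> :: "'a::euclidean_space \<Rightarrow> complex"
  assumes [measurable]: "\<phi> \<in> borel_measurable borel"
  shows "fourier_inv \<phi> = fourier (\<lambda>x. \<phi> (- x))"
proof
  fix \<xi>
  show "fourier_inv \<phi> \<xi> = fourier (\<lambda>x. \<phi> (- x)) \<xi>"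
    using lborel_integral_reflect[of "\<lambda>x. cis (x \<bullet> \<xi>) * \<phi> x"]
    by (simp add: fourier_inv_altdef fourier_def)
qed

lemma schwartz_fourier_inv: "\<phi> \<in> schwartz \<Longrightarrow> fourier_inv \<phi> \<in> schwartz"
  using fourier_inv_reflect[OF schwartz_measurable] schwartz_fourier[OF schwartz_reflect] by metis

lemma fourier_inv_fourier: "\<phi> \<in> schwartz \<Longrightarrow> fourier_inv (fourier \<phi>) = \<phi>"
  by (rule ext) (simp only: fourier_inv_altdef fourier_inversion)

lemma fourier_fourier_inv:
  assumes \<phi>: "\<phi> \<in> schwartz" shows "fourier (fourier_inv \<phi>) = \<phi>"
proof
  fix x
  have "fourier (fourier_inv \<phi>) x = fourier_inv (fourier (\<lambda>x. \<phi> (- x))) (- x)"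
    by (simp add: fourier_inv_reflect[OF schwartz_measurable[OF \<phi>]] fourier_inv_def[of "fourier _"])
  then show "fourier (fourier_inv \<phi>) x = \<phi> x"
    by (simp add: fourier_inv_fourier[OF schwartz_reflect[OF \<phi>]])
qed

lemma schwartz_square_integrable:
  assumes "\<phi> \<in> schwartz" shows "integrable lborel (\<lambda>x. (cmod (\<phi> x))\<^sup>2)"
proof -
  have "integrable lborel (\<lambda>x. cmod (\<phi> x * \<phi> x))"
    by (intro integrable_norm schwartz_integrable schwartz_mult assms)
  then show ?thesis by (simp add: norm_mult power2_eq_square)
qed

text \<open>The multiplication formula is used for the conjugate of \<open>\<psi>\<close> and for
  \<open>fourier_inv \<psi>\<close>: the transform of the first is the conjugate of
  \<open>fourier_inv \<psi>\<close>, that of the second is \<open>\<psi>\<close>.\<close>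

lemma parseval_fourier_inv:
  fixes \<psi> :: "'a::euclidean_space \<Rightarrow> complex"
  assumes \<psi>: "\<psi> \<in> schwartz"
  shows "(LINT \<xi>|lborel. (cmod (fourier_inv \<psi> \<xi>))\<^sup>2) = (LINT x|lborel. (cmod (\<psi> x))\<^sup>2)"
proof -
  have i: "integrable lborel (\<lambda>x. cnj (\<psi> x))" "integrable lborel (fourier_inv \<psi>)"
    by (auto intro!: schwartz_integrable schwartz_fourier_inv \<psi>)
  have c: "fourier (\<lambda>x. cnj (\<psi> x)) \<xi> = cnj (fourier_inv \<psi> \<xi>)" for \<xi>
  proof -
    have "cnj (LINT x|lborel. cis (x \<bullet> \<xi>) * \<psi> x) = (LINT x|lborel. cnj (cis (x \<bullet> \<xi>) * \<psi> x))"
      by (rule Bochner_Integration.integral_cnj[symmetric])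
    then show ?thesis by (simp add: fourier_inv_altdef fourier_def cis_cnj)
  qed
  have "complex_of_real (LINT \<xi>|lborel. (cmod (fourier_inv \<psi> \<xi>))\<^sup>2) = (LINT \<xi>|lborel. fourier (\<lambda>x. cnj (\<psi> x)) \<xi> * fourier_inv \<psi> \<xi>)"
    unfolding c by (subst integral_complex_of_real[symmetric]) (simp add: complex_norm_square mult.commute del: of_real_power)
  also have "\<dots> = (LINT x|lborel. cnj (\<psi> x) * \<psi> x)"
    using fourier_multiplication[OF i] by (simp add: fourier_fourier_inv[OF \<psi>])
  also have "\<dots> = of_real (LINT x|lborel. (cmod (\<psi> x))\<^sup>2)"
    by (subst integral_complex_of_real[symmetric]) (simp add: complex_norm_square mult.commute del: of_real_power)
  finally show ?thesis by (simp only: of_real_eq_iff)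
qed


section \<open>Functions annihilated by all Schwartz functions\<close>

lemma schwartz_gaussian_scaled:
  fixes y :: "'a::euclidean_space"
  assumes k: "0 < k"
  shows "(\<lambda>x. gaussian (1/2) 0 (k *\<^sub>R (x - y))) \<in> schwartz"
proof -
  have "(\<lambda>x. gaussian (1/2) 0 (k *\<^sub>R x + - (k *\<^sub>R y))) \<in> schwartz"
  \<comment> \<open>The constant comes from |x| <= |x - y| + |y|, where |x - y| is 1 / k times the
    norm of the substituted argument.\<close>
  proof (rule schwartz_affine[where K = "1 / k + norm y"])
    show "gaussian (1/2) (0::'a) \<in> schwartz" by (rule schwartz_gaussian) simp
    show "bounded_linear ((*\<^sub>R) k :: 'a \<Rightarrow> 'a)" by (rule bounded_linear_scaleR_right)
    show "\<exists>s. \<exists>b'\<in>Basis. k *\<^sub>R b = s *\<^sub>R b'" if "b \<in> Basis" for b :: 'a using that by blast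
    show "norm x \<le> (1 / k + norm y) * (1 + norm (k *\<^sub>R x + - (k *\<^sub>R y)))" for x
    proof -
      have e: "norm (k *\<^sub>R x + - (k *\<^sub>R y)) = k * norm (x - y)"
        using k by (simp add: scaleR_diff_right[symmetric] abs_of_pos)
      have "norm x \<le> norm (x - y) + norm y" by (metis diff_add_cancel norm_triangle_ineq)
      also have "norm (x - y) = (1 / k) * (k * norm (x - y))" using k by simp
      also have "(1 / k) * (k * norm (x - y)) + norm y \<le> (1 / k + norm y) * (1 + k * norm (x - y))"
        using k by (simp add: algebra_simps add_increasing)
      finally show ?thesis unfolding e .
    qed
  qed
  then show ?thesis by (simp add: scaleR_diff_right)
qed

text \<open>Fubini turns the integral into one over \<open>y\<close> in which \<open>f\<close> is
  tested against a Gaussian centred at \<open>y\<close>. The kernel is even, so these are the tests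
  in \<open>zero\<close>.\<close>

lemma integral_convolution_gaussian_zero:
  fixes f \<eta> :: "'a::euclidean_space \<Rightarrow> complex"
  assumes f: "integrable lborel f"
    and zero: "\<And>y. (LINT x|lborel. f x * gaussian (1/2) 0 (k *\<^sub>R (x - y))) = 0"
    and \<eta>[measurable]: "\<eta> \<in> borel_measurable borel" and B: "\<And>x. cmod (\<eta> x) \<le> B" and k: "0 < k"
  shows "(LINT x|lborel. f x * (LINT y|lborel. \<eta> y * gaussian (1/2) 0 (k *\<^sub>R (y - x)))) = 0"
proof -
  note [measurable] = borel_measurable_integrable[OF f]
  let ?\<gamma> = "\<lambda>y. gaussian (1/2) (0::'a) (k *\<^sub>R y)"
  have \<gamma>: "integrable lborel ?\<gamma>"
    using schwartz_integrable[OF schwartz_gaussian_scaled[OF k, of 0]] by simp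
  have \<gamma>x: "integrable lborel (\<lambda>y. ?\<gamma> (y - x))" "(LINT y|lborel. cmod (?\<gamma> (y - x))) = (LINT y|lborel. cmod (?\<gamma> y))" for x
    using lborel_integrable_translate[of ?\<gamma> "- x"] \<gamma> lborel_integral_translate[of "\<lambda>y. cmod (?\<gamma> y)" "- x"]
    by simp_all
  let ?h = "\<lambda>x y. f x * (\<eta> y * ?\<gamma> (y - x))"
  have int\<eta>: "integrable lborel (\<lambda>y. \<eta> y * ?\<gamma> (y - x))" for x
    by (rule Bochner_Integration.integrable_bound[OF integrable_mult_right[OF integrable_norm[OF \<gamma>x(1)], of B x]])
       (use B in \<open>auto simp: norm_mult intro!: order_trans[OF mult_right_mono[OF B]] mult_right_mono\<close>)
  have i: "integrable (lborel \<Otimes>\<^sub>M lborel) (\<lambda>(x, y). ?h x y)"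
  proof (rule lborel_pair.Fubini_integrable)
    show "integrable lborel (\<lambda>x. LINT y|lborel. norm (case (x, y) of (x, y) \<Rightarrow> ?h x y))"
    proof (rule Bochner_Integration.integrable_bound)
      show "integrable lborel (\<lambda>x. cmod (f x) * (B * (LINT y|lborel. cmod (?\<gamma> y))))"
        by (intro integrable_mult_left integrable_norm f)
      show "AE x in lborel. norm (LINT y|lborel. norm (case (x, y) of (x, y) \<Rightarrow> ?h x y))
          \<le> norm (cmod (f x) * (B * (LINT y|lborel. cmod (?\<gamma> y))))"
      proof (rule AE_I2)
        fix x
        have "(LINT y|lborel. cmod (\<eta> y * ?\<gamma> (y - x))) \<le> (LINT y|lborel. B * cmod (?\<gamma> (y - x)))"
          by (intro integral_mono integrable_norm int\<eta> integrable_mult_right \<gamma>x) (auto simp: norm_mult intro!: mult_right_mono B)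
        also have "\<dots> = B * (LINT y|lborel. cmod (?\<gamma> y))" by (simp add: \<gamma>x)
        finally have "cmod (f x) * (LINT y|lborel. cmod (\<eta> y * ?\<gamma> (y - x))) \<le> cmod (f x) * (B * (LINT y|lborel. cmod (?\<gamma> y)))"
          by (rule mult_left_mono) simp
        then show "norm (LINT y|lborel. norm (case (x, y) of (x, y) \<Rightarrow> ?h x y))
          \<le> norm (cmod (f x) * (B * (LINT y|lborel. cmod (?\<gamma> y))))"
          by (simp add: norm_mult)
      qed
    qed measurable
    show "AE x in lborel. integrable lborel (\<lambda>y. case (x, y) of (x, y) \<Rightarrow> ?h x y)"
      using int\<eta> by simp
  qed measurable
  have "(LINT x|lborel. f x * (LINT y|lborel. \<eta> y * ?\<gamma> (y - x))) = (LINT x|lborel. (LINT y|lborel. ?h x y))"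
    by simp
  also have "\<dots> = (LINT y|lborel. (LINT x|lborel. ?h x y))"
    by (rule lborel_pair.Fubini_integral[OF i, symmetric])
  also have "\<dots> = (LINT y|lborel. \<eta> y * (LINT x|lborel. f x * ?\<gamma> (x - y)))"
  proof (intro Bochner_Integration.integral_cong refl)
    fix y
    have sym: "?\<gamma> (y - x) = ?\<gamma> (x - y)" for x
      by (simp add: gaussian_def norm_minus_commute)
    show "(LINT x|lborel. ?h x y) = \<eta> y * (LINT x|lborel. f x * ?\<gamma> (x - y))"
      unfolding sym by (simp add: mult.left_commute)
  qed
  also have "\<dots> = 0" by (simp add: zero)
  finally show ?thesis .
qed

text \<open>The Gaussian averages of \<open>\<eta>\<close> have zero integral against
  \<open>f\<close> at every scale and converge boundedly to a nonzero multiple of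
  \<open>\<eta>\<close>.\<close>

lemma integral_continuous_zero:
  fixes f \<eta> :: "'a::euclidean_space \<Rightarrow> complex"
  assumes f: "integrable lborel f"
    and zero: "\<And>k y. 0 < k \<Longrightarrow> (LINT x|lborel. f x * gaussian (1/2) 0 (k *\<^sub>R (x - y))) = 0"
    and \<eta>: "continuous_on UNIV \<eta>" and B: "\<And>x. cmod (\<eta> x) \<le> B"
  shows "(LINT x|lborel. f x * \<eta> x) = 0"
proof -
  have [measurable]: "\<eta> \<in> borel_measurable borel"
    using \<eta> by (rule borel_measurable_continuous_onI)
  note [measurable] = borel_measurable_integrable[OF f]
  let ?\<gamma> = "gaussian (1/2) (0::'a)"
  have gi: "integrable lborel ?\<gamma>"
    by (intro schwartz_integrable schwartz_gaussian) simp
  let ?\<epsilon> = "\<lambda>n. 1 / (real n + 1)"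
  define T where "T n = (\<lambda>x. LINT z|lborel. \<eta> (x + ?\<epsilon> n *\<^sub>R z) * ?\<gamma> z)" for n
  have [measurable]: "T n \<in> borel_measurable borel" for n
    unfolding T_def by measurable
  have T0: "(LINT x|lborel. f x * T n x) = 0" for n
  proof -
    have k: "0 < real n + 1" by simp
    have "T n x = (1 / ?\<epsilon> n ^ DIM('a)) *\<^sub>R (LINT y|lborel. \<eta> y * ?\<gamma> ((real n + 1) *\<^sub>R (y - x)))" for x
      unfolding T_def by (subst integral_gaussian_rescale) (auto simp: inverse_eq_divide)
    then have "(LINT x|lborel. f x * T n x)
        = (1 / ?\<epsilon> n ^ DIM('a)) *\<^sub>R (LINT x|lborel. f x * (LINT y|lborel. \<eta> y * ?\<gamma> ((real n + 1) *\<^sub>R (y - x))))"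
      by (simp add: mult_scaleR_right del: integral_mult_right_zero)
    then show ?thesis
      using integral_convolution_gaussian_zero[OF f zero[OF k] _ B k] by simp
  qed
  have "(\<lambda>n. LINT x|lborel. f x * T n x) \<longlonglongrightarrow> (LINT x|lborel. f x * (\<eta> x * integral\<^sup>L lborel ?\<gamma>))"
  proof (rule integral_dominated_convergence[where w = "\<lambda>x. cmod (f x) * (B * (LINT z|lborel. cmod (?\<gamma> z)))"])
    show "integrable lborel (\<lambda>x. cmod (f x) * (B * (LINT z|lborel. cmod (?\<gamma> z))))"
      by (intro integrable_mult_left integrable_norm f)
    show "AE x in lborel. (\<lambda>n. f x * T n x) \<longlonglongrightarrow> f x * (\<eta> x * integral\<^sup>L lborel ?\<gamma>)"
      unfolding T_def by (intro AE_I2 tendsto_mult tendsto_const gaussian_averages[OF \<eta> B])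
    show "AE x in lborel. norm (f x * T n x) \<le> cmod (f x) * (B * (LINT z|lborel. cmod (?\<gamma> z)))" for n
    proof (rule AE_I2)
      fix x
      have "cmod (T n x) \<le> (LINT z|lborel. B * cmod (?\<gamma> z))"
        unfolding T_def
      proof (rule Bochner_Integration.integral_norm_bound_integral)
        show le: "norm (\<eta> (x + ?\<epsilon> n *\<^sub>R z) * ?\<gamma> z) \<le> B * cmod (?\<gamma> z)" for z
          unfolding norm_mult by (intro mult_right_mono B) simp
        show Bi: "integrable lborel (\<lambda>z. B * cmod (?\<gamma> z))"
          by (intro integrable_mult_right integrable_norm gi)
        show "integrable lborel (\<lambda>z. \<eta> (x + ?\<epsilon> n *\<^sub>R z) * ?\<gamma> z)"
          by (rule Bochner_Integration.integrable_bound[OF Bi])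
             (use le in \<open>auto intro!: AE_I2 order_trans[OF _ abs_ge_self] simp del: norm_mult\<close>)
      qed
      then show "norm (f x * T n x) \<le> cmod (f x) * (B * (LINT z|lborel. cmod (?\<gamma> z)))"
        by (simp add: norm_mult mult_left_mono)
    qed
  qed measurable
  then have "(LINT x|lborel. f x * (\<eta> x * integral\<^sup>L lborel ?\<gamma>)) = 0"
    unfolding T0 by (simp add: LIMSEQ_const_iff)
  then have "(LINT x|lborel. f x * \<eta> x) * integral\<^sup>L lborel ?\<gamma> = 0"
    by (simp flip: mult.assoc)
  moreover have "integral\<^sup>L lborel ?\<gamma> \<noteq> 0"
    using integral_gaussian[where 'a = 'a] by auto
  ultimately show ?thesis by simp
qed

text \<open>Indicators of closed sets are limits of continuous cutoffs, and closed sets form an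
  intersection-stable generator of the Borel sets; hence the integral of \<open>f\<close> over every
  Borel set vanishes.\<close>

lemma AE_zero_if_continuous_integrals_zero:
  fixes f :: "'a::euclidean_space \<Rightarrow> complex"
  assumes f: "integrable lborel f"
    and zero: "\<And>\<eta>. continuous_on UNIV \<eta> \<Longrightarrow> (\<And>x. cmod (\<eta> x) \<le> 1) \<Longrightarrow> (LINT x|lborel. f x * \<eta> x) = 0"
  shows "AE x in lborel. f x = 0"
proof (rule sigma_finite_measure.density_zero[OF sigma_finite_lborel f])
  note [measurable] = borel_measurable_integrable[OF f]
  have closed: "set_lebesgue_integral lborel C f = 0" if C: "closed C" for C
  \<comment> \<open>The distance to the empty set is 0 by convention, so for it the cutoffs below
    would tend to 1 instead of the indicator.\<close>
  proof (cases "C = {}")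
    case False
    define \<eta> where "\<eta> n x = max 0 (1 - real n * infdist x C)" for n x
    have cont: "continuous_on UNIV (\<lambda>x. complex_of_real (\<eta> n x))" for n
      unfolding \<eta>_def by (intro continuous_intros)
    have b: "cmod (complex_of_real (\<eta> n x)) \<le> 1" for n x
      by (simp add: \<eta>_def infdist_nonneg)
    have [measurable]: "(\<lambda>x. complex_of_real (\<eta> n x)) \<in> borel_measurable borel" for n
      by (rule borel_measurable_continuous_onI[OF cont])
    have [measurable]: "C \<in> sets borel" using C by (rule borel_closed)
    have "(\<lambda>n. LINT x|lborel. f x * of_real (\<eta> n x)) \<longlonglongrightarrow> (LINT x|lborel. f x * of_real (indicator C x))"
    proof (rule integral_dominated_convergence[where w = "\<lambda>x. cmod (f x)"])
      show "AE x in lborel. (\<lambda>n. f x * of_real (\<eta> n x)) \<longlonglongrightarrow> f x * of_real (indicator C x)"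
      proof (intro AE_I2 tendsto_mult tendsto_const tendsto_of_real)
        fix x
        show "(\<lambda>n. \<eta> n x) \<longlonglongrightarrow> indicator C x"
        proof (cases "x \<in> C")
          case True
          then show ?thesis by (simp add: \<eta>_def)
        next
          case x: False
          then have p: "0 < infdist x C"
            using C False by (metis in_closed_iff_infdist_zero infdist_nonneg order_le_less)
          obtain N :: nat where N: "1 / infdist x C < real N" using reals_Archimedean2 by blast
          have "\<eta> n x = 0" if "n \<ge> N" for n
          proof -
            have "1 / infdist x C \<le> real n" using N that by linarith
            then have "1 \<le> real n * infdist x C" using p by (simp add: divide_le_eq)
            then show ?thesis by (simp add: \<eta>_def)
          qed
          then show ?thesis
            using x by (intro tendsto_eventually) (auto simp: eventually_sequentially)
        qed
      qed
      show "AE x in lborel. norm (f x * of_real (\<eta> n x)) \<le> cmod (f x)" for n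
        unfolding norm_mult by (intro AE_I2 mult_left_le b) simp
    qed (use f in auto)
    then have "(LINT x|lborel. f x * of_real (indicator C x)) = 0"
      unfolding zero[OF cont b] by (simp add: LIMSEQ_const_iff)
    then show ?thesis
      unfolding set_lebesgue_integral_def by (simp add: scaleR_conv_of_real mult.commute)
  qed (simp add: set_lebesgue_integral_def)
  fix A :: "'a set" assume "A \<in> sets lborel"
  then have "A \<in> sigma_sets UNIV (Collect closed)"
    by (simp add: borel_eq_closed)
  have "Int_stable (Collect (closed :: 'a set \<Rightarrow> bool))" by (auto simp: Int_stable_def)
  moreover have "Collect closed \<subseteq> Pow (UNIV :: 'a set)" by simp
  moreover note \<open>A \<in> sigma_sets UNIV (Collect closed)\<close>
  ultimately show "set_lebesgue_integral lborel A f = 0"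
  proof (induction rule: sigma_sets_induct_disjoint)
    case (basic C)
    then show ?case by (intro closed) simp
  next
    case empty
    show ?case by (simp add: set_lebesgue_integral_def)
  next
    case (compl A)
    then have [measurable]: "A \<in> sets borel" by (simp add: borel_eq_closed)
    have "set_lebesgue_integral lborel (UNIV - A) f = set_lebesgue_integral lborel UNIV f - set_lebesgue_integral lborel A f"
      unfolding set_lebesgue_integral_def using f
      by (subst Bochner_Integration.integral_diff[symmetric])
         (auto intro!: integrable_mult_indicator[where M = lborel, simplified] Bochner_Integration.integral_cong split: split_indicator)
    then show ?case using compl closed[of UNIV] by simp
  next
    case (union A)
    then have [measurable]: "A i \<in> sets borel" for i by (auto simp: borel_eq_closed)
    have "set_lebesgue_integral lborel (\<Union>i. A i) f = suminf (\<lambda>i. set_lebesgue_integral lborel (A i) f)"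
    proof (rule lebesgue_integral_countable_add)
      show "set_integrable lborel (\<Union>i. A i) f"
        unfolding set_integrable_def using f by (intro integrable_mult_indicator) auto
    qed (use union in \<open>auto simp: disjoint_family_on_def\<close>)
    then show ?case using union by simp
  qed
qed

text \<open>\<open>g\<close> itself need not be integrable. A Gaussian factor makes it so without
  introducing zeros, and its product with another Gaussian is still an admissible test
  function.\<close>

lemma AE_zero_if_schwartz_integrals_zero:
  fixes g :: "'a::euclidean_space \<Rightarrow> complex"
  assumes int: "\<And>\<phi>. \<phi> \<in> schwartz \<Longrightarrow> integrable lborel (\<lambda>x. g x * \<phi> x)"
    and zero: "\<And>\<phi>. \<phi> \<in> schwartz \<Longrightarrow> (LINT x|lborel. g x * \<phi> x) = 0"
  shows "AE x in lborel. g x = 0"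
proof -
  let ?E = "gaussian 1 (0::'a)"
  have E: "?E \<in> schwartz" by (rule schwartz_gaussian) simp
  have "AE x in lborel. g x * ?E x = 0"
  proof (rule AE_zero_if_continuous_integrals_zero[OF int[OF E]])
    fix \<eta> :: "'a \<Rightarrow> complex"
    assume \<eta>: "continuous_on UNIV \<eta>" "\<And>x. cmod (\<eta> x) \<le> 1"
    show "(LINT x|lborel. g x * ?E x * \<eta> x) = 0"
    proof (rule integral_continuous_zero[OF int[OF E] _ \<eta>])
      show "(LINT x|lborel. g x * ?E x * gaussian (1/2) 0 (k *\<^sub>R (x - y))) = 0" if "0 < k" for k y
        using zero[OF schwartz_mult[OF E schwartz_gaussian_scaled[OF that, of y]]] by (simp add: mult.assoc)
    qed
  qed
  then show ?thesis by (simp add: gaussian_def)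
qed

text \<open>The set where \<open>g\<close> is nonzero is open and null, hence empty. Continuity
  removes the exceptional set, which permits evaluation at the single point t = 0 for
  traces.\<close>

lemma continuous_zero_if_schwartz_integrals_zero:
  fixes g :: "'a::euclidean_space \<Rightarrow> complex"
  assumes "\<And>\<phi>. \<phi> \<in> schwartz \<Longrightarrow> integrable lborel (\<lambda>x. g x * \<phi> x)"
    and "\<And>\<phi>. \<phi> \<in> schwartz \<Longrightarrow> (LINT x|lborel. g x * \<phi> x) = 0"
    and cont: "continuous_on UNIV g"
  shows "g x = 0"
proof (rule ccontr)
  assume "g x \<noteq> 0"
  have "open (g -` (- {0}))" using cont by (intro open_vimage) auto
  moreover have "{x. g x \<noteq> 0} = g -` (- {0})" by auto
  moreover have "AE x in lborel. g x = 0" by (rule AE_zero_if_schwartz_integrals_zero) fact+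
  ultimately have "{x. g x \<noteq> 0} \<in> null_sets lborel" "open {x. g x \<noteq> 0}"
    by (auto simp: AE_iff_null borel_open)
  then show False
    using open_not_negligible[of "{x. g x \<noteq> 0}"] \<open>g x \<noteq> 0\<close>
    by (auto simp: negligible_iff_null_sets null_sets_completionI)
qed

section \<open>Newton polygon weights\<close>

text \<open>The generators are kept as pairs of naturals, because the integrality of their abscissas
  is what separates them from the half-integer \<open>\<rho>\<close>.\<close>

definition newton_generators :: "('m::finite) symbol \<Rightarrow> (nat \<times> nat) set" where
  "newton_generators P = newton_points P \<union> (\<lambda>(i, k). (i, 0)) ` newton_points P
     \<union> (\<lambda>(i, k). (0, k)) ` newton_points P \<union> {(0, 0)}"

abbreviation real_point :: "nat \<times> nat \<Rightarrow> real \<times> real" where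
  "real_point v \<equiv> (real (fst v), real (snd v))"

lemma newton_polygon_eq: "newton_polygon P = convex hull (real_point ` newton_generators P)"
  unfolding newton_polygon_def newton_generators_def
  by (rule arg_cong[where f = "\<lambda>A. convex hull A"]) (auto simp: image_Un image_image split_beta)

lemma finite_newton_generators: "finite (newton_generators P)"
proof -
  have "newton_points P \<subseteq> (\<lambda>(\<alpha>, k). (mi_order \<alpha>, k)) ` Poly_Mapping.keys P"
    unfolding newton_points_def by (force simp: in_keys_iff)
  then have "finite (newton_points P)" by (rule finite_subset) simp
  then show ?thesis by (simp add: newton_generators_def)
qed

lemma newton_polygon_subset_convex:
  "convex T \<Longrightarrow> (\<And>v. v \<in> newton_generators P \<Longrightarrow> real_point v \<in> T) \<Longrightarrow> newton_polygon P \<subseteq> T"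
  unfolding newton_polygon_eq by (rule hull_minimal) auto

lemma newton_polygon_nonneg:
  assumes "v \<in> newton_polygon P" shows "0 \<le> fst v" "0 \<le> snd v"
proof -
  have "convex {v. inner (1::real, 0::real) v \<ge> 0}" "convex {v. inner (0::real, 1::real) v \<ge> 0}"
    by (rule convex_halfspace_ge)+
  then have "newton_polygon P \<subseteq> {v. inner (1::real, 0::real) v \<ge> 0} \<inter> {v. inner (0::real, 1::real) v \<ge> 0}"
    by (intro newton_polygon_subset_convex convex_Int) auto
  with assms have "v \<in> {v. inner (1::real, 0::real) v \<ge> 0} \<inter> {v. inner (0::real, 1::real) v \<ge> 0}" by blast
  then show "0 \<le> fst v" "0 \<le> snd v" by (cases v; simp)+
qed

text \<open>Were this set infinite, the sum in \<open>newton_weight\<close> would be 0 by convention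
  and would dominate no monomial.\<close>

lemma finite_newton_lattice: "finite {(i, k). (real i, real k) \<in> newton_polygon P}"
proof -
  have "bounded (newton_polygon P)"
    unfolding newton_polygon_eq
    by (intro bounded_convex_hull finite_imp_bounded finite_imageI finite_newton_generators)
  then obtain R where R: "\<And>v. v \<in> newton_polygon P \<Longrightarrow> norm v \<le> R" unfolding bounded_iff by blast
  have "{(i, k). (real i, real k) \<in> newton_polygon P} \<subseteq> {..nat \<lfloor>R\<rfloor>} \<times> {..nat \<lfloor>R\<rfloor>}"
  proof (rule subsetI, clarify)
    fix i k assume "(real i, real k) \<in> newton_polygon P"
    from R[OF this] have "real i \<le> R" "real k \<le> R"
      using norm_fst_le[of "real i" "real k"] norm_snd_le[of "real k" "real i"] by auto
    then show "i \<in> {..nat \<lfloor>R\<rfloor>} \<and> k \<in> {..nat \<lfloor>R\<rfloor>}" by (auto simp: le_nat_floor)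
  qed
  then show ?thesis by (rule finite_subset) simp
qed

lemma monomial_le_newton_weight:
  assumes "(real i, real k) \<in> newton_polygon P"
  shows "norm \<xi> ^ i * cmod lam ^ k \<le> newton_weight P \<xi> lam"
proof -
  have "(\<lambda>(i, k). norm \<xi> ^ i * cmod lam ^ k) (i, k) \<le> newton_weight P \<xi> lam"
    unfolding newton_weight_def
    by (rule member_le_sum) (use assms finite_newton_lattice in auto)
  then show ?thesis by simp
qed

lemma newton_weight_ge_1: "1 \<le> newton_weight P \<xi> lam"
proof -
  have "(real 0, real 0) \<in> newton_polygon P"
    unfolding newton_polygon_eq by (rule hull_inc) (force simp: newton_generators_def)
  from monomial_le_newton_weight[OF this] show ?thesis by simp
qed

lemma newton_weight_measurable [measurable]:
  "(\<lambda>\<xi> :: 'a::euclidean_space. newton_weight P \<xi> lam) \<in> borel_measurable borel"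
  unfolding newton_weight_def split_beta by measurable

text \<open>After taking logarithms the claim is linear in \<open>(p, q)\<close> and describes a
  half-plane. The half-plane contains the generators, whose monomials occur in the weight, and so
  contains their convex hull.\<close>

lemma powr_le_newton_weight:
  assumes "(p, q) \<in> newton_polygon P" and x: "0 < norm \<xi>" and y: "0 < cmod lam"
  shows "norm \<xi> powr p * cmod lam powr q \<le> newton_weight P \<xi> lam"
proof -
  let ?W = "newton_weight P \<xi> lam"
  have W: "0 < ?W" using newton_weight_ge_1[of P \<xi> lam] by linarith
  let ?T = "{v. inner (ln (norm \<xi>), ln (cmod lam)) v \<le> ln ?W}"
  have "newton_polygon P \<subseteq> ?T"
  proof (rule newton_polygon_subset_convex[OF convex_halfspace_le])
    fix v assume "v \<in> newton_generators P"
    then have "(real (fst v), real (snd v)) \<in> newton_polygon P"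
      unfolding newton_polygon_eq by (intro hull_inc imageI)
    from monomial_le_newton_weight[OF this]
    have "ln (norm \<xi> ^ fst v * cmod lam ^ snd v) \<le> ln ?W"
      using x y W by (subst ln_le_cancel_iff) auto
    then show "real_point v \<in> ?T"
      using x y by (simp add: ln_mult ln_realpow mult.commute)
  qed
  with assms(1) have "p * ln (norm \<xi>) + q * ln (cmod lam) \<le> ln ?W" by (auto simp: mult.commute)
  then have "exp (p * ln (norm \<xi>) + q * ln (cmod lam)) \<le> ?W"
    using W by (metis exp_le_cancel_iff exp_ln)
  then show ?thesis using x y by (simp add: powr_def exp_add)
qed

text \<open>As the generators have integer coordinates, a point with non-integer abscissa is a convex
  combination of points strictly to its left and strictly to its right.\<close>

lemma newton_polygon_split:
  assumes v: "(\<rho>, \<beta>) \<in> newton_polygon P" and nonint: "\<And>i::nat. \<rho> \<noteq> real i"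
  obtains p1 q1 p2 q2 s where "(p1, q1) \<in> newton_polygon P" "(p2, q2) \<in> newton_polygon P"
    "p1 < \<rho>" "\<rho> < p2" "\<rho> = (1 - s) * p1 + s * p2" "\<beta> = (1 - s) * q1 + s * q2"
proof -
  let ?G = "real_point ` newton_generators P"
  let ?L = "?G \<inter> {v. inner (1, 0) v < \<rho>}" and ?R = "?G \<inter> {v. inner (1, 0) v > \<rho>}"
  have G: "?G = ?L \<union> ?R" using nonint by (auto simp: not_less) (metis order_le_less)
  have L: "convex hull ?L \<subseteq> newton_polygon P \<inter> {v. inner (1, 0) v < \<rho>}"
    unfolding newton_polygon_eq
    by (intro Int_greatest hull_mono hull_minimal convex_halfspace_lt) auto
  have R: "convex hull ?R \<subseteq> newton_polygon P \<inter> {v. inner (1, 0) v > \<rho>}"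
    unfolding newton_polygon_eq
    by (intro Int_greatest hull_mono hull_minimal convex_halfspace_gt) auto
  have v': "(\<rho>, \<beta>) \<in> convex hull (?L \<union> ?R)" using v unfolding newton_polygon_eq G[symmetric] .
  \<comment> \<open>If one part were empty, the whole polygon would lie strictly on one side of the
    abscissa \<open>\<rho>\<close>.\<close>
  have "?L \<noteq> {}" "?R \<noteq> {}" using v' L R by auto
  then have "convex hull ((convex hull ?L) \<union> (convex hull ?R)) =
      {u *\<^sub>R s + v *\<^sub>R t |u v s t. 0 \<le> u \<and> 0 \<le> v \<and> u + v = 1 \<and> s \<in> convex hull ?L \<and> t \<in> convex hull ?R}"
    by (intro convex_hull_union_two convex_convex_hull) auto
  then obtain u s l r where us: "u + s = 1" and lr: "l \<in> convex hull ?L" "r \<in> convex hull ?R"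
    and "(\<rho>, \<beta>) = u *\<^sub>R l + s *\<^sub>R r"
    using subsetD[OF hull_mono[OF Un_mono[OF hull_subset hull_subset]] v'] by blast
  moreover have "u = 1 - s" using us by simp
  ultimately have e: "(\<rho>, \<beta>) = (1 - s) *\<^sub>R l + s *\<^sub>R r" by simp
  show ?thesis
  proof (rule that[of "fst l" "snd l" "fst r" "snd r" s])
    show "(fst l, snd l) \<in> newton_polygon P" "fst l < \<rho>" using subsetD[OF L lr(1)] by (auto simp: inner_prod_def)
    show "(fst r, snd r) \<in> newton_polygon P" "\<rho> < fst r" using subsetD[OF R lr(2)] by (auto simp: inner_prod_def)
    show "\<rho> = (1 - s) * fst l + s * fst r" "\<beta> = (1 - s) * snd l + s * snd r"
      using arg_cong[OF e, of fst] arg_cong[OF e, of snd] by simp_all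
  qed
qed

section \<open>Power integrals over the normal frequency and the sharp weighted bound\<close>

lemma nn_integral_powr_from_0:
  assumes "-1 < a" "0 \<le> c"
  shows "(\<integral>\<^sup>+t. ennreal (t powr a) * indicator {0..c} t \<partial>lborel) = ennreal (c powr (a + 1) / (a + 1))"
  by (rule nn_integral_has_integral_lebesgue'[OF _ has_integral_powr_from_0]) (use assms in auto)

lemma nn_integral_powr_to_inf:
  assumes "a < -1" "0 < c"
  shows "(\<integral>\<^sup>+t. ennreal (t powr a) * indicator {c..} t \<partial>lborel) = ennreal (- (c powr (a + 1)) / (a + 1))"
  by (rule nn_integral_has_integral_lebesgue'[OF _ has_integral_powr_to_inf]) (use assms in auto)

lemma nn_integral_abs_le:
  fixes h :: "real \<Rightarrow> ennreal"
  assumes [measurable]: "h \<in> borel_measurable borel"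
  shows "(\<integral>\<^sup>+t. h \<bar>t\<bar> \<partial>lborel) \<le> 2 * (\<integral>\<^sup>+t. h t * indicator {0..} t \<partial>lborel)"
proof -
  have "(\<integral>\<^sup>+t. h \<bar>t\<bar> \<partial>lborel) \<le> (\<integral>\<^sup>+t. h t * indicator {0..} t + h (- t) * indicator {0..} (- t) \<partial>lborel)"
    by (rule nn_integral_mono) (auto simp: indicator_def)
  also have "\<dots> = (\<integral>\<^sup>+t. h t * indicator {0..} t \<partial>lborel) + (\<integral>\<^sup>+t. h (- t) * indicator {0..} (- t) \<partial>lborel)"
    by (rule nn_integral_add) measurable
  also have "(\<integral>\<^sup>+t. h (- t) * indicator {0..} (- t) \<partial>lborel) = (\<integral>\<^sup>+t. h t * indicator {0..} t \<partial>lborel)"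
    using nn_integral_real_affine[of "\<lambda>t. h t * indicator {0..} t" "-1" 0] by simp
  finally show ?thesis by (simp add: mult_2)
qed

text \<open>The integral is split at the point where the two lower bounds for the weight balance.\<close>

lemma nn_integral_two_powers:
  fixes F :: "real \<Rightarrow> real"
  assumes [measurable]: "F \<in> borel_measurable borel"
    and A: "0 < A" and B: "0 < B" and p: "p1 < \<rho>" "\<rho> < p2" and \<rho>: "\<rho> = real l + 1/2"
    and s: "\<rho> = (1 - s) * p1 + s * p2"
    and F1: "\<And>t. t \<noteq> 0 \<Longrightarrow> A * \<bar>t\<bar> powr p1 \<le> F t"
    and F2: "\<And>t. t \<noteq> 0 \<Longrightarrow> B * \<bar>t\<bar> powr p2 \<le> F t"
  shows "(\<integral>\<^sup>+t. ennreal ((\<bar>t\<bar> ^ l / F t)\<^sup>2) \<partial>lborel)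
    \<le> ennreal ((1 / (\<rho> - p1) + 1 / (p2 - \<rho>)) / (A powr (1 - s) * B powr s)\<^sup>2)"
proof -
  \<comment> \<open>The point where the two lower bounds agree: A c^p1 = B c^p2.\<close>
  define c where "c = (A / B) powr (1 / (p2 - p1))"
  have c: "0 < c" using A B by (simp add: c_def)
  \<comment> \<open>Since \<open>\<rho>\<close> is l + 1/2, these are 2 l - 2 p1 and 2 l - 2 p2: the
    first is above -1, the second below.\<close>
  let ?e1 = "2 * (\<rho> - p1) - 1" and ?e2 = "2 * (\<rho> - p2) - 1"
  let ?h1 = "\<lambda>t. ennreal (t powr ?e1) * indicator {0..c} t"
  let ?h2 = "\<lambda>t. ennreal (t powr ?e2) * indicator {c..} t"
  define h where "h t = ennreal (1 / A\<^sup>2) * ?h1 t + ennreal (1 / B\<^sup>2) * ?h2 t" for t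
  have h[measurable]: "h \<in> borel_measurable borel" unfolding h_def by measurable
  have bound: "(\<bar>t\<bar> ^ l / F t)\<^sup>2 \<le> (1 / D\<^sup>2) * \<bar>t\<bar> powr (2 * (\<rho> - p) - 1)"
    if t: "t \<noteq> 0" and D: "0 < D" and F: "D * \<bar>t\<bar> powr p \<le> F t" for t D p
  proof -
    have "(\<bar>t\<bar> ^ l / F t)\<^sup>2 \<le> (\<bar>t\<bar> ^ l / (D * \<bar>t\<bar> powr p))\<^sup>2"
      using t D F by (intro power_mono divide_left_mono mult_pos_pos divide_nonneg_nonneg)
        (auto intro: less_le_trans[OF _ F] order_trans[OF _ F])
    also have "\<dots> = (1 / D\<^sup>2) * (\<bar>t\<bar> powr real l / \<bar>t\<bar> powr p)\<^sup>2"
      using t by (simp add: power_divide power_mult_distrib powr_realpow)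
    also have "(\<bar>t\<bar> powr real l / \<bar>t\<bar> powr p)\<^sup>2 = \<bar>t\<bar> powr (2 * (\<rho> - p) - 1)"
      by (simp add: \<rho> powr_diff[symmetric] power2_eq_square powr_add[symmetric])
    finally show ?thesis .
  qed
  have "(\<integral>\<^sup>+t. ennreal ((\<bar>t\<bar> ^ l / F t)\<^sup>2) \<partial>lborel) \<le> (\<integral>\<^sup>+t. h \<bar>t\<bar> \<partial>lborel)"
  proof (rule nn_integral_mono_AE)
    show "AE t in lborel. ennreal ((\<bar>t\<bar> ^ l / F t)\<^sup>2) \<le> h \<bar>t\<bar>"
      \<comment> \<open>\<open>F1\<close> and \<open>F2\<close> say nothing at t = 0, which is a
        null set.\<close>
      using AE_lborel_singleton[of "0::real"]
    proof eventually_elim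
      case (elim t)
      show ?case
      proof (cases "\<bar>t\<bar> \<le> c")
        case True
        have "ennreal ((\<bar>t\<bar> ^ l / F t)\<^sup>2) \<le> ennreal (1 / A\<^sup>2) * ?h1 \<bar>t\<bar>"
          using bound[OF elim A F1[OF elim]] True by (simp add: ennreal_mult[symmetric] ennreal_leI)
        then show ?thesis unfolding h_def by (rule add_increasing2[rotated]) simp
      next
        case False
        have "ennreal ((\<bar>t\<bar> ^ l / F t)\<^sup>2) \<le> ennreal (1 / B\<^sup>2) * ?h2 \<bar>t\<bar>"
          using bound[OF elim B F2[OF elim]] False by (simp add: ennreal_mult[symmetric] ennreal_leI)
        then show ?thesis unfolding h_def by (rule add_increasing[rotated]) simp
      qed
    qed
  qed
  \<comment> \<open>The factor 2 from passing to a half-line is compensated by the factors 1 / 2 in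
    the two antiderivatives.\<close>
  also have "\<dots> \<le> 2 * (\<integral>\<^sup>+t. h t * indicator {0..} t \<partial>lborel)" by (rule nn_integral_abs_le[OF h])
  also have "(\<integral>\<^sup>+t. h t * indicator {0..} t \<partial>lborel) \<le> (\<integral>\<^sup>+t. h t \<partial>lborel)"
    by (rule nn_integral_mono) (auto simp: indicator_def)
  also have "(\<integral>\<^sup>+t. h t \<partial>lborel) = ennreal (1 / A\<^sup>2) * ennreal (c powr (?e1 + 1) / (?e1 + 1))
      + ennreal (1 / B\<^sup>2) * ennreal (- (c powr (?e2 + 1)) / (?e2 + 1))"
    unfolding h_def
    by (subst nn_integral_add, measurable, subst (1 2) nn_integral_cmult, measurable)
       (use p c in \<open>simp add: nn_integral_powr_from_0 nn_integral_powr_to_inf\<close>)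
  also have "\<dots> = ennreal ((1 / A\<^sup>2) * (c powr (2 * (\<rho> - p1)) / (2 * (\<rho> - p1)))
      + (1 / B\<^sup>2) * (c powr (2 * (\<rho> - p2)) / (2 * (p2 - \<rho>))))"
  proof -
    have "- (c powr (?e2 + 1)) / (?e2 + 1) = c powr (2 * (\<rho> - p2)) / (2 * (p2 - \<rho>))"
      using p by (simp add: field_simps)
    then show ?thesis using p by (simp add: ennreal_mult[symmetric] ennreal_plus[symmetric] del: ennreal_plus)
  qed
  also have "(1 / A\<^sup>2) * (c powr (2 * (\<rho> - p1)) / (2 * (\<rho> - p1)))
      + (1 / B\<^sup>2) * (c powr (2 * (\<rho> - p2)) / (2 * (p2 - \<rho>)))
      = (1 / (\<rho> - p1) + 1 / (p2 - \<rho>)) / 2 / (A powr (1 - s) * B powr s)\<^sup>2"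
  proof -
    \<comment> \<open>\<open>s\<close> measures the distances of \<open>\<rho>\<close> from
      \<open>p1\<close> and \<open>p2\<close>; with them the choice of \<open>c\<close> gives both
      contributions the same powers of \<open>A\<close> and \<open>B\<close>.\<close>
    have d: "\<rho> - p1 = s * (p2 - p1)" "\<rho> - p2 = - ((1 - s) * (p2 - p1))"
      using s by (simp_all add: algebra_simps)
    have n: "p2 - p1 \<noteq> 0" using p by simp
    have "c powr (2 * (\<rho> - p1)) = (A / B) powr (2 * s)"
      using n by (simp add: c_def powr_powr d(1))
    moreover have "c powr (2 * (\<rho> - p2)) = (A / B) powr (- (2 * (1 - s)))"
      using n by (simp add: c_def powr_powr d(2))
    moreover have "(1 / A\<^sup>2) * (A / B) powr (2 * s) = 1 / (A powr (1 - s) * B powr s)\<^sup>2"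
      "(1 / B\<^sup>2) * (A / B) powr (- (2 * (1 - s))) = 1 / (A powr (1 - s) * B powr s)\<^sup>2"
    proof -
      obtain \<alpha> \<beta> where e: "A = exp \<alpha>" "B = exp \<beta>" using A B by (metis exp_ln)
      have i: "1 / (exp z)\<^sup>2 = exp (- 2 * z)" for z :: real
        by (simp add: exp_minus field_simps flip: exp_double)
      show "(1 / A\<^sup>2) * (A / B) powr (2 * s) = 1 / (A powr (1 - s) * B powr s)\<^sup>2"
        unfolding e exp_diff[symmetric] powr_def ln_exp
        by (simp add: i flip: exp_add) (simp add: algebra_simps)
      show "(1 / B\<^sup>2) * (A / B) powr (- (2 * (1 - s))) = 1 / (A powr (1 - s) * B powr s)\<^sup>2"
        unfolding e exp_diff[symmetric] powr_def ln_exp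
        by (simp add: i flip: exp_add) (simp add: algebra_simps)
    qed
    ultimately show ?thesis
      by (simp only: times_divide_eq_right) (simp add: add_divide_distrib mult_ac)
  qed
  finally have "(\<integral>\<^sup>+t. ennreal ((\<bar>t\<bar> ^ l / F t)\<^sup>2) \<partial>lborel)
      \<le> 2 * ennreal ((1 / (\<rho> - p1) + 1 / (p2 - \<rho>)) / 2 / (A powr (1 - s) * B powr s)\<^sup>2)"
    by (simp add: mult_left_mono)
  also have "\<dots> = ennreal ((1 / (\<rho> - p1) + 1 / (p2 - \<rho>)) / (A powr (1 - s) * B powr s)\<^sup>2)"
  proof -
    have "2 * (X / 2 / Y) = X / Y" for X Y :: real by simp
    then show ?thesis
      using p by (subst ennreal_numeral[symmetric], subst ennreal_mult[symmetric]) (simp_all only:, auto)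
  qed
  finally show ?thesis .
qed


lemma nn_integral_trace_monomial:
  fixes P :: "('m::finite) symbol"
  assumes v: "(a, b) \<in> shifted_polygon P (real l + 1/2)"
  obtains C where "0 < C" and "\<And>(x :: 'a::euclidean_space) lam. x \<noteq> 0 \<Longrightarrow> lam \<noteq> 0 \<Longrightarrow>
    (\<integral>\<^sup>+t. ennreal ((\<bar>t\<bar> ^ l / newton_weight P (x, t :: real) lam)\<^sup>2) \<partial>lborel)
      \<le> ennreal (C / (norm x powr a * cmod lam powr b)\<^sup>2)"
proof -
  define \<rho> where "\<rho> = real l + 1/2"
  have \<rho>: "0 < \<rho>" by (simp add: \<rho>_def)
  have ab: "0 \<le> a" "0 \<le> b" and N: "(a + \<rho>, b) \<in> newton_polygon P"
    using v by (auto simp: shifted_polygon_def \<rho>_def)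
  have nx: "norm x \<le> norm (x, t)" "\<bar>t\<bar> \<le> norm (x, t)" for x :: 'a and t :: real
    using norm_fst_le[of x t] norm_snd_le[of t x] by auto
  have meas: "(\<lambda>t::real. newton_weight P (x, t) lam) \<in> borel_measurable borel" for x :: 'a and lam
  proof (rule measurable_compose[OF _ newton_weight_measurable])
    show "(\<lambda>t::real. (x, t)) \<in> borel_measurable borel"
      by (intro borel_measurable_continuous_onI continuous_intros)
  qed
  show ?thesis
  proof (cases "a = 0")
    case True
    \<comment> \<open>For a = 0 the bound from (\<open>\<rho>\<close>, b) alone would leave 1 / |t|,
      which diverges at 0 and at infinity. Since \<open>\<rho>\<close> is a half-integer, the point
      lies between points with other abscissas, which repair one end each.\<close>
    have "\<rho> \<noteq> real i" for i
    proof
      assume "\<rho> = real i"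
      then have "real (2 * l + 1) = real (2 * i)" by (simp add: \<rho>_def)
      then have "2 * l + 1 = 2 * i" by (simp only: of_nat_eq_iff)
      then show False by presburger
    qed
    moreover have "(\<rho>, b) \<in> newton_polygon P" using N True by simp
    ultimately obtain p1 q1 p2 q2 s where pq: "(p1, q1) \<in> newton_polygon P" "(p2, q2) \<in> newton_polygon P"
      and p: "p1 < \<rho>" "\<rho> < p2" and s: "\<rho> = (1 - s) * p1 + s * p2" "b = (1 - s) * q1 + s * q2"
      using newton_polygon_split by blast
    let ?C = "1 / (\<rho> - p1) + 1 / (p2 - \<rho>)"
    show ?thesis
    proof (rule that[of ?C])
      show "0 < ?C" using p by (simp add: add_pos_pos)
      fix x :: 'a and lam :: complex
      assume x: "x \<noteq> 0" and lam: "lam \<noteq> 0"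
      \<comment> \<open>Exponents in the polygon are nonnegative, so dropping \<open>x\<close> from
        the norm lowers the monomial; \<open>x\<close> being nonzero keeps the norm of
        \<open>(x, t)\<close> positive even at t = 0.\<close>
      have *: "cmod lam powr q * \<bar>t\<bar> powr p \<le> newton_weight P (x, t) lam"
        if "(p, q) \<in> newton_polygon P" for p q t
      proof -
        have "\<bar>t\<bar> powr p \<le> norm (x, t) powr p"
          using newton_polygon_nonneg[OF that] nx by (intro powr_mono2) auto
        then have "cmod lam powr q * \<bar>t\<bar> powr p \<le> norm (x, t) powr p * cmod lam powr q"
          by (subst mult.commute) (rule mult_right_mono, auto)
        also have "\<dots> \<le> newton_weight P (x, t) lam"
          using x lam by (intro powr_le_newton_weight that) (auto simp: zero_prod_def)
        finally show ?thesis .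
      qed
      have "(\<integral>\<^sup>+t. ennreal ((\<bar>t\<bar> ^ l / newton_weight P (x, t) lam)\<^sup>2) \<partial>lborel)
          \<le> ennreal (?C / ((cmod lam powr q1) powr (1 - s) * (cmod lam powr q2) powr s)\<^sup>2)"
        by (rule nn_integral_two_powers[OF meas _ _ p \<rho>_def s(1) *[OF pq(1)] *[OF pq(2)]]) (use lam in auto)
      also have "(cmod lam powr q1) powr (1 - s) * (cmod lam powr q2) powr s = cmod lam powr b"
        by (simp add: powr_powr powr_add[symmetric] s(2) mult.commute add.commute)
      finally show "(\<integral>\<^sup>+t. ennreal ((\<bar>t\<bar> ^ l / newton_weight P (x, t) lam)\<^sup>2) \<partial>lborel)
          \<le> ennreal (?C / (norm x powr a * cmod lam powr b)\<^sup>2)"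
        using x True by simp
    qed
  next
    case False
    then have a: "0 < a" using ab by simp
    \<comment> \<open>The parameter for which \<open>\<rho>\<close> interpolates between the
      exponents 0 and \<open>a + \<rho>\<close>. Then (a + rho) (1 - s) = a, which restores the
      exponent of |x| demanded by the vertex.\<close>
    define s where "s = \<rho> / (a + \<rho>)"
    let ?C = "1 / (\<rho> - 0) + 1 / ((a + \<rho>) - \<rho>)"
    show ?thesis
    proof (rule that[of ?C])
      show "0 < ?C" using a \<rho> by (simp add: add_pos_pos)
      fix x :: 'a and lam :: complex
      assume x: "x \<noteq> 0" and lam: "lam \<noteq> 0"
      have *: "cmod lam powr b * z powr (a + \<rho>) \<le> newton_weight P (x, t) lam" if "0 \<le> z" "z \<le> norm (x, t)" for z t
      proof -
        have "z powr (a + \<rho>) \<le> norm (x, t) powr (a + \<rho>)"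
          using a \<rho> that by (intro powr_mono2) auto
        then have "cmod lam powr b * z powr (a + \<rho>) \<le> norm (x, t) powr (a + \<rho>) * cmod lam powr b"
          by (subst mult.commute) (rule mult_right_mono, auto)
        also have "\<dots> \<le> newton_weight P (x, t) lam"
          using x lam by (intro powr_le_newton_weight N) (auto simp: zero_prod_def)
        finally show ?thesis .
      qed
      let ?A = "cmod lam powr b * norm x powr (a + \<rho>)"
      have s: "\<rho> = (1 - s) * 0 + s * (a + \<rho>)" using a \<rho> by (simp add: s_def)
      have "(\<integral>\<^sup>+t. ennreal ((\<bar>t\<bar> ^ l / newton_weight P (x, t) lam)\<^sup>2) \<partial>lborel)
          \<le> ennreal (?C / (?A powr (1 - s) * (cmod lam powr b) powr s)\<^sup>2)"
      proof (rule nn_integral_two_powers[OF meas _ _ _ _ \<rho>_def s])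
        show "?A * \<bar>t\<bar> powr 0 \<le> newton_weight P (x, t) lam" if "t \<noteq> 0" for t
          using *[of "norm x" t] nx that by simp
        show "cmod lam powr b * \<bar>t\<bar> powr (a + \<rho>) \<le> newton_weight P (x, t) lam" if "t \<noteq> 0" for t
          using *[of "\<bar>t\<bar>" t] nx by simp
      qed (use x lam a \<rho> in auto)
      also have "?A powr (1 - s) * (cmod lam powr b) powr s = norm x powr a * cmod lam powr b"
      proof -
        have e: "(a + \<rho>) * (1 - s) = a" using a \<rho> by (simp add: s_def field_simps)
        have "?A powr (1 - s) = cmod lam powr (b * (1 - s)) * norm x powr a"
          by (simp only: powr_mult powr_powr e)
        moreover have "cmod lam powr (b * (1 - s)) * (cmod lam powr b) powr s = cmod lam powr b"
          unfolding powr_powr powr_add[symmetric] by (simp add: algebra_simps)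
        ultimately show ?thesis by (simp add: mult_ac)
      qed
      finally show "(\<integral>\<^sup>+t. ennreal ((\<bar>t\<bar> ^ l / newton_weight P (x, t) lam)\<^sup>2) \<partial>lborel)
          \<le> ennreal (?C / (norm x powr a * cmod lam powr b)\<^sup>2)" .
    qed
  qed
qed

text \<open>If there were infinitely many extreme points, the sum defining the shifted weight would be \<open>0\<close>.\<close>

lemma nn_integral_shifted_weight:
  fixes P :: "('m::finite) symbol"
  obtains C where "0 < C" and "\<And>(x :: 'a::euclidean_space) lam. x \<noteq> 0 \<Longrightarrow> lam \<noteq> 0 \<Longrightarrow>
    ennreal ((shifted_weight P (real l + 1/2) (x, 0 :: real) lam)\<^sup>2) *
      (\<integral>\<^sup>+t. ennreal ((\<bar>t\<bar> ^ l / newton_weight P (x, t :: real) lam)\<^sup>2) \<partial>lborel) \<le> ennreal C"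
proof -
  let ?E = "{v. v extreme_point_of shifted_polygon P (real l + 1/2)}"
  show ?thesis
  proof (cases "finite ?E")
    case False
    then show ?thesis by (intro that[of 1]) (simp_all add: shifted_weight_def)
  next
    case True
    define Q where "Q v C \<longleftrightarrow> 0 < C \<and> (\<forall>(x :: 'a) lam. x \<noteq> 0 \<longrightarrow> lam \<noteq> 0 \<longrightarrow>
      (\<integral>\<^sup>+t. ennreal ((\<bar>t\<bar> ^ l / newton_weight P (x, t :: real) lam)\<^sup>2) \<partial>lborel)
      \<le> ennreal (C / (norm x powr fst v * cmod lam powr snd v)\<^sup>2))" for v C
    have "\<exists>C. Q v C" if "v \<in> ?E" for v
    proof -
      have "(fst v, snd v) \<in> shifted_polygon P (real l + 1/2)"
        using that by (simp add: extreme_point_of_def)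
      then show ?thesis
      proof (rule nn_integral_trace_monomial[where 'a = 'a])
        fix C :: real
        assume "0 < C" and "\<And>(x :: 'a) lam. x \<noteq> 0 \<Longrightarrow> lam \<noteq> 0 \<Longrightarrow>
          (\<integral>\<^sup>+t. ennreal ((\<bar>t\<bar> ^ l / newton_weight P (x, t :: real) lam)\<^sup>2) \<partial>lborel)
          \<le> ennreal (C / (norm x powr fst v * cmod lam powr snd v)\<^sup>2)"
        then have "Q v C" unfolding Q_def by blast
        then show ?thesis ..
      qed
    qed
    then obtain C where Q: "\<And>v. v \<in> ?E \<Longrightarrow> Q v (C v)" by metis
    then have C: "\<And>v. v \<in> ?E \<Longrightarrow> 0 < C v" by (simp add: Q_def)
    have K: "(\<integral>\<^sup>+t. ennreal ((\<bar>t\<bar> ^ l / newton_weight P (x, t :: real) lam)\<^sup>2) \<partial>lborel)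
        \<le> ennreal (C v / (norm x powr fst v * cmod lam powr snd v)\<^sup>2)"
      if "v \<in> ?E" "x \<noteq> 0" "lam \<noteq> 0" for v and x :: 'a and lam
      using Q[OF that(1)] that(2,3) unfolding Q_def by blast
    let ?C = "(\<Sum>v\<in>?E. C v) * real (card ?E)"
    show ?thesis
    \<comment> \<open>The summand 1 keeps the constant positive when there are no extreme
      points.\<close>
    proof (rule that[of "?C + 1"])
      have C0: "0 \<le> (\<Sum>v\<in>?E. C v)" using C by (intro sum_nonneg) (auto intro: less_imp_le)
      then show "0 < ?C + 1" by (intro add_nonneg_pos mult_nonneg_nonneg) auto
      fix x :: 'a and lam :: complex
      assume x: "x \<noteq> 0" and lam: "lam \<noteq> 0"
      let ?K = "\<integral>\<^sup>+t. ennreal ((\<bar>t\<bar> ^ l / newton_weight P (x, t :: real) lam)\<^sup>2) \<partial>lborel"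
      let ?w = "\<lambda>v. norm x powr fst v * cmod lam powr snd v"
      \<comment> \<open>For nonzero bases the convention 0^0 = 1 in \<open>real_exp_pow\<close>
        makes no difference to \<open>powr\<close>.\<close>
      have w: "shifted_weight P (real l + 1/2) (x, 0 :: real) lam = (\<Sum>v\<in>?E. ?w v)"
        unfolding shifted_weight_def
        using x lam by (intro sum.cong) (auto simp: real_exp_pow_def)
      \<comment> \<open>Cauchy-Schwarz separates the vertices at the price of their number, so each
        monomial meets its own bound.\<close>
      have "(\<Sum>v\<in>?E. ?w v)\<^sup>2 \<le> (\<Sum>v\<in>?E. (?w v)\<^sup>2) * card ?E"
        by (rule sum_squared_le_sum_of_squares)
      then have "ennreal ((\<Sum>v\<in>?E. ?w v)\<^sup>2) * ?K \<le> ennreal ((\<Sum>v\<in>?E. (?w v)\<^sup>2) * card ?E) * ?K"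
        by (intro mult_right_mono ennreal_leI) auto
      also have "\<dots> = (\<Sum>v\<in>?E. ennreal ((?w v)\<^sup>2) * ?K) * ennreal (real (card ?E))"
      proof -
        have "ennreal ((\<Sum>v\<in>?E. (?w v)\<^sup>2) * card ?E) = (\<Sum>v\<in>?E. ennreal ((?w v)\<^sup>2)) * ennreal (real (card ?E))"
          by (subst sum_ennreal) (auto intro!: ennreal_mult sum_nonneg)
        then show ?thesis by (simp only: sum_distrib_right[symmetric] mult_ac)
      qed
      also have "\<dots> \<le> (\<Sum>v\<in>?E. ennreal (C v)) * ennreal (real (card ?E))"
      proof (intro mult_right_mono sum_mono)
        fix v assume v: "v \<in> ?E"
        have "ennreal ((?w v)\<^sup>2) * ?K \<le> ennreal ((?w v)\<^sup>2) * ennreal (C v / (?w v)\<^sup>2)"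
          by (intro mult_left_mono K v x lam) simp
        also have "\<dots> = ennreal (C v)"
          using x lam C[OF v] by (subst ennreal_mult[symmetric]) auto
        finally show "ennreal ((?w v)\<^sup>2) * ?K \<le> ennreal (C v)" .
      qed simp
      also have "\<dots> = ennreal ?C"
      proof -
        have "(\<Sum>v\<in>?E. ennreal (C v)) = ennreal (\<Sum>v\<in>?E. C v)"
          using C by (intro sum_ennreal) (auto intro: less_imp_le)
        then show ?thesis using C0 by (simp only: ennreal_mult[OF C0 of_nat_0_le_iff])
      qed
      also have "\<dots> \<le> ennreal (?C + 1)" by (rule ennreal_leI) simp
      finally show "ennreal ((shifted_weight P (real l + 1/2) (x, 0 :: real) lam)\<^sup>2) * ?K \<le> ennreal (?C + 1)"
        unfolding w .
    qed
  qed
qed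

text \<open>The weight is bounded below by 1 and, through the point \<open>(M, 0)\<close>, by |t|^M;
  l + 1 <= M leaves at most 1 / |t| for large t, which is square integrable. The bound holds for
  every \<open>x\<close> and makes the integrals that define the trace converge.\<close>

lemma nn_integral_trace_uniform:
  fixes P :: "('m::finite) symbol"
  assumes M: "(real M, 0) \<in> newton_polygon P" and l: "l < M"
  obtains K where "0 \<le> K" and "\<And>(x :: 'a::euclidean_space) lam.
    (\<integral>\<^sup>+t. ennreal ((\<bar>t\<bar> ^ l / newton_weight P (x, t :: real) lam)\<^sup>2) \<partial>lborel) \<le> ennreal K"
proof -
  have int: "integrable lborel (\<lambda>t::real. 2 * inverse (1 + t\<^sup>2))"
    using integrable_inverse_1_plus_square by (simp add: set_integrable_def)
  let ?K = "LINT t|lborel. 2 * inverse (1 + (t::real)\<^sup>2)"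
  show ?thesis
  proof (rule that[of ?K])
    show "0 \<le> ?K" by (rule integral_nonneg_AE) (auto intro!: AE_I2 simp: add_nonneg_nonneg)
    fix x :: 'a and lam :: complex
    have "(\<integral>\<^sup>+t. ennreal ((\<bar>t\<bar> ^ l / newton_weight P (x, t :: real) lam)\<^sup>2) \<partial>lborel)
        \<le> (\<integral>\<^sup>+t. ennreal (2 * inverse (1 + t\<^sup>2)) \<partial>lborel)"
    proof (rule nn_integral_mono, rule ennreal_leI)
      fix t :: real
      let ?W = "newton_weight P (x, t) lam"
      have W1: "1 \<le> ?W" by (rule newton_weight_ge_1)
      have "\<bar>t\<bar> ^ M \<le> norm (x, t) ^ M" using norm_snd_le[of t x] by (intro power_mono) auto
      also have "\<dots> \<le> ?W" using monomial_le_newton_weight[of M 0 P "(x, t)" lam] M by simp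
      finally have WM: "\<bar>t\<bar> ^ M \<le> ?W" .
      show "(\<bar>t\<bar> ^ l / ?W)\<^sup>2 \<le> 2 * inverse (1 + t\<^sup>2)"
      proof (cases "\<bar>t\<bar> \<le> 1")
        case True
        then have "\<bar>t\<bar> ^ l / ?W \<le> 1" using W1 power_le_one[of "\<bar>t\<bar>" l] by (simp add: divide_le_eq)
        then have "(\<bar>t\<bar> ^ l / ?W)\<^sup>2 \<le> 1" using W1 by (intro power_le_one) auto
        moreover have "t\<^sup>2 \<le> 1" using True by (simp add: abs_square_le_1)
        then have "1 \<le> 2 * inverse (1 + t\<^sup>2)" by (simp add: field_simps add_pos_nonneg)
        ultimately show ?thesis by linarith
      next
        case False
        then have t: "1 < \<bar>t\<bar>" by simp
        have "\<bar>t\<bar> ^ l * \<bar>t\<bar> \<le> \<bar>t\<bar> ^ M"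
          using t l power_increasing[of "Suc l" M "\<bar>t\<bar>"] by (simp add: mult.commute)
        then have "\<bar>t\<bar> ^ l * \<bar>t\<bar> \<le> ?W" using WM by linarith
        then have "\<bar>t\<bar> ^ l / ?W \<le> 1 / \<bar>t\<bar>" using W1 t by (simp add: field_simps)
        then have "(\<bar>t\<bar> ^ l / ?W)\<^sup>2 \<le> (1 / \<bar>t\<bar>)\<^sup>2" using W1 by (intro power_mono) auto
        also have "\<dots> = 1 / t\<^sup>2" by (simp add: power_divide)
        also have "\<dots> \<le> 2 * inverse (1 + t\<^sup>2)"
        proof -
          have "1 \<le> t\<^sup>2" using t by (metis abs_square_le_1 less_imp_le not_le nle_le abs_le_square_iff abs_1 power_one)
          then show ?thesis by (simp add: inverse_eq_divide divide_simps)
        qed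
        finally show ?thesis .
      qed
    qed
    also have "\<dots> = ennreal ?K"
      by (rule nn_integral_eq_integral[OF int]) (auto intro!: AE_I2 simp: add_nonneg_nonneg)
    finally show "(\<integral>\<^sup>+t. ennreal ((\<bar>t\<bar> ^ l / newton_weight P (x, t :: real) lam)\<^sup>2) \<partial>lborel) \<le> ennreal ?K" .
  qed
qed

section \<open>Traces\<close>

text \<open>The two factors i and the reflection in \<open>fourier_inv\<close> combine to the plain
  factor xi_n.\<close>

lemma fourier_inv_dir_deriv_last:
  fixes \<phi> :: "'a::euclidean_space \<times> real \<Rightarrow> complex"
  assumes \<phi>: "\<phi> \<in> schwartz"
  shows "fourier_inv (\<lambda>x. \<i> * dir_deriv (0, 1) \<phi> x) \<xi> = of_real (snd \<xi>) * fourier_inv \<phi> \<xi>"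
proof -
  have b: "(0, 1) \<in> (Basis :: ('a \<times> real) set)" by (simp add: Basis_prod_def)
  have "fourier_inv (\<lambda>x. \<i> * dir_deriv (0, 1) \<phi> x) \<xi> = \<i> * (\<i> * of_real ((- \<xi>) \<bullet> (0, 1)) * fourier \<phi> (- \<xi>))"
    unfolding fourier_inv_def by (simp only: fourier_cmult fourier_dir_deriv[OF \<phi> b])
  then show ?thesis by (simp add: fourier_inv_def inner_prod_def mult.assoc[symmetric])
qed

text \<open>\<open>u \<phi>\<close> is the pairing of the Fourier transform of \<open>u\<close> with
  \<open>fourier_inv \<phi>\<close>, and each \<open>D_last\<close> contributes a factor xi_n. The
  induction varies \<open>\<phi>\<close> because \<open>D_last\<close> acts on the test
  function.\<close>

lemma D_last_power:
  fixes u :: "('a::euclidean_space \<times> real) distr"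
  assumes u: "represents (fourier_distr u) g" and \<phi>: "\<phi> \<in> schwartz"
  shows "(D_last ^^ l) u \<phi> = (LINT \<xi>|lborel. g \<xi> * (of_real (snd \<xi>) ^ l * fourier_inv \<phi> \<xi>))"
  using \<phi>
proof (induction l arbitrary: \<phi>)
  case 0
  have "u \<phi> = fourier_distr u (fourier_inv \<phi>)"
    by (simp add: fourier_distr_def fourier_fourier_inv[OF 0])
  then show ?case using u schwartz_fourier_inv[OF 0] by (simp add: represents_def)
next
  case (Suc l)
  have b: "(0, 1) \<in> (Basis :: ('a \<times> real) set)" by (simp add: Basis_prod_def)
  have "(\<lambda>x. \<i> * dir_deriv (0, 1) \<phi> x) \<in> schwartz"
    by (intro schwartz_cmult schwartz_dir_deriv Suc.prems b)
  from Suc.IH[OF this] show ?case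
    by (simp add: D_last_def fourier_inv_dir_deriv_last[OF Suc.prems] mult_ac)
qed

text \<open>Fubini: the transform in all variables is the one-dimensional transform in
  \<open>t\<close> of the transforms of the slices. This later identifies the family of slices with
  the distribution itself.\<close>

lemma fourier_inv_slices:
  fixes \<phi> :: "'a::euclidean_space \<times> real \<Rightarrow> complex"
  assumes \<phi>: "\<phi> \<in> schwartz"
  shows "fourier_inv \<phi> (\<xi>', \<tau>) = of_real (fourier_const TYPE(real)) *
    (LINT t|lborel. cis (t * \<tau>) * fourier_inv (\<lambda>x. \<phi> (x, t)) \<xi>')"
proof -
  let ?f = "\<lambda>x t. cis (x \<bullet> \<xi>' + t * \<tau>) * \<phi> (x, t)"
  have "integrable lborel (\<lambda>x. cis (x \<bullet> (\<xi>', \<tau>)) * \<phi> x)"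
    by (rule schwartz_integrable[OF schwartz_cis[OF \<phi>]])
  then have i: "integrable (lborel \<Otimes>\<^sub>M lborel) (\<lambda>(x, t). ?f x t)"
    unfolding lborel_prod by (simp add: case_prod_beta' inner_prod_def)
  have "(LINT x|lborel. cis (x \<bullet> (\<xi>', \<tau>)) * \<phi> x) = integral\<^sup>L (lborel \<Otimes>\<^sub>M lborel) (\<lambda>(x, t). ?f x t)"
    unfolding lborel_prod by (simp add: case_prod_beta' inner_prod_def)
  also have "\<dots> = (LINT t|lborel. (LINT x|lborel. ?f x t))"
    by (rule lborel_pair.integral_snd[OF i, symmetric])
  also have "\<dots> = (LINT t|lborel. cis (t * \<tau>) * (LINT x|lborel. cis (x \<bullet> \<xi>') * \<phi> (x, t)))"
    by (intro Bochner_Integration.integral_cong refl)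
       (simp add: cis_mult[symmetric] mult.assoc mult.left_commute[of "cis (_ \<bullet> _)"])
  finally have e: "(LINT x|lborel. cis (x \<bullet> (\<xi>', \<tau>)) * \<phi> x)
      = (LINT t|lborel. cis (t * \<tau>) * (LINT x|lborel. cis (x \<bullet> \<xi>') * \<phi> (x, t)))" .
  have c: "fourier_const TYPE('a \<times> real) = fourier_const TYPE(real) * fourier_const TYPE('a)"
    by (simp add: powr_add[symmetric] diff_divide_distrib)
  have "cis (t * \<tau>) * (of_real (fourier_const TYPE('a)) * z) = of_real (fourier_const TYPE('a)) * (cis (t * \<tau>) * z)" for t z
    by (rule mult.left_commute)
  then show ?thesis
    unfolding fourier_inv_altdef e c by (simp only: integral_mult_right_zero of_real_mult mult.assoc)
qed

text \<open>The empty list of directions contributes the seminorm of order zero. Rapid decay of the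
  derivatives makes the suprema genuine, so the remaining summands are nonnegative.\<close>

lemma schwartz_norm_bound:
  fixes \<psi> :: "'a::euclidean_space \<Rightarrow> complex"
  assumes \<psi>: "\<psi> \<in> schwartz"
  shows "(1 + norm x) ^ N * cmod (\<psi> x) \<le> schwartz_norm N \<psi>"
proof -
  let ?I = "{bs :: 'a list. set bs \<subseteq> Basis \<and> length bs \<le> N}"
  let ?s = "\<lambda>bs. SUP x. (1 + norm x) ^ N * cmod (iter_deriv bs \<psi> x)"
  have bdd: "bdd_above (range (\<lambda>x. (1 + norm x) ^ N * cmod (iter_deriv bs \<psi> x)))" if "bs \<in> ?I" for bs
  proof -
    have "rapid (iter_deriv bs \<psi>)" using \<psi> that by (simp add: schwartz_iff)
    then show ?thesis unfolding rapid_def by (auto simp: bdd_above_def)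
  qed
  have le: "(1 + norm x) ^ N * cmod (iter_deriv bs \<psi> x) \<le> ?s bs" if "bs \<in> ?I" for bs x
    by (rule cSUP_upper[OF UNIV_I bdd[OF that]])
  have "?s [] \<le> schwartz_norm N \<psi>"
    unfolding schwartz_norm_def
  proof (rule member_le_sum)
    show "finite ?I" by (rule finite_lists_length_le) simp
    show "0 \<le> ?s bs" if "bs \<in> ?I - {[]}" for bs
      using le[of bs 0] that by (meson DiffD1 mult_nonneg_nonneg norm_ge_zero order_trans zero_le_power add_nonneg_nonneg zero_le_one)
  qed auto
  with le[of "[]" x] show ?thesis by simp
qed

text \<open>Testing \<open>w\<close> on products of \<open>\<psi>\<close> with functions of
  \<open>t\<close> shows that the difference of the two families at \<open>\<psi>\<close>, a
  continuous function of \<open>t\<close>, is annihilated by every Schwartz function of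
  \<open>t\<close>.\<close>

lemma has_trace_unique:
  fixes w :: "('a::euclidean_space \<times> real) distr"
  assumes "has_trace w v" "has_trace w v'" and \<psi>: "\<psi> \<in> schwartz"
  shows "v \<psi> = v' \<psi>"
proof -
  obtain W where W: "\<And>t. tempered (W t)" "\<And>\<psi>. \<psi> \<in> schwartz \<Longrightarrow> continuous_on UNIV (\<lambda>t. W t \<psi>)"
    and int: "\<And>\<phi>. \<phi> \<in> schwartz \<Longrightarrow> integrable lborel (\<lambda>t. W t (\<lambda>x'. \<phi> (x', t)))"
    "\<And>\<phi>. \<phi> \<in> schwartz \<Longrightarrow> w \<phi> = (LINT t|lborel. W t (\<lambda>x'. \<phi> (x', t)))" and v: "v = W 0"
    using assms(1) unfolding has_trace_def by blast
  obtain W' where W': "\<And>t. tempered (W' t)" "\<And>\<psi>. \<psi> \<in> schwartz \<Longrightarrow> continuous_on UNIV (\<lambda>t. W' t \<psi>)"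
    and int': "\<And>\<phi>. \<phi> \<in> schwartz \<Longrightarrow> integrable lborel (\<lambda>t. W' t (\<lambda>x'. \<phi> (x', t)))"
    "\<And>\<phi>. \<phi> \<in> schwartz \<Longrightarrow> w \<phi> = (LINT t|lborel. W' t (\<lambda>x'. \<phi> (x', t)))" and v': "v' = W' 0"
    using assms(2) unfolding has_trace_def by blast
  have scale: "W t (\<lambda>x. \<psi> x * c) = W t \<psi> * c" "W' t (\<lambda>x. \<psi> x * c) = W' t \<psi> * c" for t c
    using W(1)[of t] W'(1)[of t] \<psi> unfolding tempered_def by (auto simp: mult.commute)
  have e: "integrable lborel (\<lambda>t. W t \<psi> * h t)" "integrable lborel (\<lambda>t. W' t \<psi> * h t)"
    "(LINT t|lborel. W t \<psi> * h t) = (LINT t|lborel. W' t \<psi> * h t)" if "h \<in> schwartz" for h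
    using int[OF schwartz_tensor[OF \<psi> that]] int'[OF schwartz_tensor[OF \<psi> that]] by (simp_all add: scale)
  have "W 0 \<psi> - W' 0 \<psi> = 0"
    by (rule continuous_zero_if_schwartz_integrals_zero[where g = "\<lambda>t. W t \<psi> - W' t \<psi>"])
       (auto simp: left_diff_distrib e intro!: continuous_intros W W' \<psi>)
  then show ?thesis unfolding v v' by simp
qed

lemma represents_unique:
  fixes w :: "('a::euclidean_space) distr"
  assumes "represents w g" "represents w g'"
  shows "AE x in lborel. g x = g' x"
proof -
  have "AE x in lborel. g x - g' x = 0"
    by (rule AE_zero_if_schwartz_integrals_zero) (use assms in \<open>auto simp: represents_def left_diff_distrib\<close>)
  then show ?thesis by simp
qed

lemma L2_norm_fourier_fun:
  assumes g: "represents (fourier_distr u) g" and [measurable]: "\<sigma> \<in> borel_measurable borel"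
  shows "AE \<xi> in lborel. fourier_fun u \<xi> = g \<xi>"
    and "H_norm \<sigma> u = L2_norm (\<lambda>\<xi>. of_real (\<sigma> \<xi>) * g \<xi>)"
proof -
  have r: "represents (fourier_distr u) (fourier_fun u)"
    unfolding fourier_fun_def by (rule someI[of "represents (fourier_distr u)", OF g])
  show ae: "AE \<xi> in lborel. fourier_fun u \<xi> = g \<xi>" by (rule represents_unique[OF r g])
  have [measurable]: "fourier_fun u \<in> borel_measurable borel" "g \<in> borel_measurable borel"
    using r g by (simp_all add: represents_def)
  show "H_norm \<sigma> u = L2_norm (\<lambda>\<xi>. of_real (\<sigma> \<xi>) * g \<xi>)"
    unfolding H_norm_def L2_norm_def
    by (intro arg_cong[where f = sqrt] integral_cong_AE) (measurable, use ae in auto)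
qed

section \<open>Construction of traces for an abstract weight\<close>

lemma borel_measurable_fst: "(fst :: 'a::euclidean_space \<times> 'b::euclidean_space \<Rightarrow> 'a) \<in> borel_measurable borel"
  and borel_measurable_snd: "(snd :: 'a \<times> 'b \<Rightarrow> 'b) \<in> borel_measurable borel"
  by (intro borel_measurable_continuous_onI linear_continuous_on bounded_linear_fst bounded_linear_snd)+

text \<open>The situation at a fixed lambda: \<open>g\<close> stands for the Fourier transform of
  \<open>u\<close> and \<open>K\<close> for the crude uniform bound. The sharp bound enters only in
  \<open>weighted_trace_density\<close>.\<close>

locale trace_data =
  fixes \<Xi> :: "'a::euclidean_space \<times> real \<Rightarrow> real" and g :: "'a \<times> real \<Rightarrow> complex" and l :: nat and K :: real
  assumes \<Xi>_measurable: "\<Xi> \<in> borel_measurable borel" and \<Xi>_pos: "\<And>\<xi>. 0 < \<Xi> \<xi>"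
    and g_measurable: "g \<in> borel_measurable borel"
    and g_L2: "integrable lborel (\<lambda>\<xi>. (cmod (of_real (\<Xi> \<xi>) * g \<xi>))\<^sup>2)"
    and K_nonneg: "0 \<le> K"
    and K: "\<And>x. (\<integral>\<^sup>+t. ennreal ((\<bar>t\<bar> ^ l / \<Xi> (x, t))\<^sup>2) \<partial>lborel) \<le> ennreal K"
begin

text \<open>The square of the weighted norm of a distribution with Fourier transform
  \<open>g\<close>.\<close>

definition "N2 = (LINT \<xi>|lborel. (cmod (of_real (\<Xi> \<xi>) * g \<xi>))\<^sup>2)"

lemma N2_nonneg: "0 \<le> N2" unfolding N2_def by simp

lemma meas_pair [measurable]:
  "\<Xi> \<in> borel_measurable (borel \<Otimes>\<^sub>M borel)" "g \<in> borel_measurable (borel \<Otimes>\<^sub>M borel)"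
  "\<Xi> \<in> borel_measurable borel" "g \<in> borel_measurable borel"
  using \<Xi>_measurable g_measurable by (simp_all add: borel_prod)

lemma nn_integral_square_g: "(\<integral>\<^sup>+\<xi>. ennreal ((\<Xi> \<xi> * cmod (g \<xi>))\<^sup>2) \<partial>lborel) = ennreal N2"
proof -
  have "(cmod (of_real (\<Xi> \<xi>) * g \<xi>))\<^sup>2 = (\<Xi> \<xi> * cmod (g \<xi>))\<^sup>2" for \<xi>
    using \<Xi>_pos[of \<xi>] by (simp add: norm_mult)
  then show ?thesis
    using nn_integral_eq_integral[OF g_L2] by (simp add: N2_def)
qed

lemma nn_integral_split_pair:
  fixes f :: "'a \<times> real \<Rightarrow> ennreal"
  assumes "f \<in> borel_measurable borel"
  shows "integral\<^sup>N lborel f = (\<integral>\<^sup>+x. (\<integral>\<^sup>+t. f (x, t) \<partial>lborel) \<partial>lborel)"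
  using lborel.nn_integral_fst[of f lborel] assms by (simp add: lborel_prod)

text \<open>The integrand is split into \<open>\<Xi> \<xi> * cmod (g \<xi>)\<close> and the rest.
  The squared rest is integrated over \<open>t\<close> first, where \<open>K\<close> bounds it
  uniformly in \<open>x\<close>.\<close>

lemma trace_Cauchy_Schwarz:
  assumes [measurable]: "\<psi> \<in> borel_measurable borel"
  shows "(\<integral>\<^sup>+\<xi>. ennreal (\<bar>snd \<xi>\<bar> ^ l * cmod (g \<xi>) * cmod (\<psi> (fst \<xi>))) \<partial>lborel)\<^sup>2
    \<le> ennreal (N2 * K) * (\<integral>\<^sup>+x. ennreal ((cmod (\<psi> x))\<^sup>2) \<partial>lborel)"
proof -
  have mfst [measurable]: "(\<lambda>\<xi>::'a \<times> real. \<psi> (fst \<xi>)) \<in> borel_measurable borel"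
    by (rule measurable_compose[OF borel_measurable_fst assms])
  note [measurable] = borel_measurable_snd
  let ?A = "\<lambda>\<xi>. ennreal (\<Xi> \<xi> * cmod (g \<xi>))"
  let ?B = "\<lambda>\<xi>. ennreal (\<bar>snd \<xi>\<bar> ^ l / \<Xi> \<xi> * cmod (\<psi> (fst \<xi>)))"
  have "(\<integral>\<^sup>+\<xi>. ennreal (\<bar>snd \<xi>\<bar> ^ l * cmod (g \<xi>) * cmod (\<psi> (fst \<xi>))) \<partial>lborel) = (\<integral>\<^sup>+\<xi>. ?A \<xi> * ?B \<xi> \<partial>lborel)"
    using \<Xi>_pos by (intro nn_integral_cong) (auto simp: ennreal_mult[symmetric] less_imp_le intro!: arg_cong[where f = ennreal] simp: field_simps less_imp_neq[symmetric])
  then have "(\<integral>\<^sup>+\<xi>. ennreal (\<bar>snd \<xi>\<bar> ^ l * cmod (g \<xi>) * cmod (\<psi> (fst \<xi>))) \<partial>lborel)\<^sup>2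
      \<le> (\<integral>\<^sup>+\<xi>. (?A \<xi>)\<^sup>2 \<partial>lborel) * (\<integral>\<^sup>+\<xi>. (?B \<xi>)\<^sup>2 \<partial>lborel)"
    by (simp only:) (rule Cauchy_Schwarz_nn_integral; measurable)
  also have "(\<integral>\<^sup>+\<xi>. (?A \<xi>)\<^sup>2 \<partial>lborel) = ennreal N2"
    using \<Xi>_pos by (simp add: ennreal_power less_imp_le nn_integral_square_g)
  also have "(\<integral>\<^sup>+\<xi>. (?B \<xi>)\<^sup>2 \<partial>lborel)
      = (\<integral>\<^sup>+x. (\<integral>\<^sup>+t. ennreal ((\<bar>t\<bar> ^ l / \<Xi> (x, t))\<^sup>2) * ennreal ((cmod (\<psi> x))\<^sup>2) \<partial>lborel) \<partial>lborel)"
  proof -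
    have "(?B (x, t))\<^sup>2 = ennreal ((\<bar>t\<bar> ^ l / \<Xi> (x, t))\<^sup>2) * ennreal ((cmod (\<psi> x))\<^sup>2)" for x t
      using \<Xi>_pos[of "(x, t)"]
      by (subst ennreal_power) (simp_all add: power_divide power_mult_distrib ennreal_mult[symmetric] less_imp_le)
    moreover have "(\<integral>\<^sup>+\<xi>. (?B \<xi>)\<^sup>2 \<partial>lborel) = (\<integral>\<^sup>+x. (\<integral>\<^sup>+t. (?B (x, t))\<^sup>2 \<partial>lborel) \<partial>lborel)"
      by (rule nn_integral_split_pair) measurable
    ultimately show ?thesis by (simp only:)
  qed
  also have "\<dots> \<le> (\<integral>\<^sup>+x. ennreal K * ennreal ((cmod (\<psi> x))\<^sup>2) \<partial>lborel)"
    by (intro nn_integral_mono) (subst nn_integral_multc, measurable, intro mult_right_mono K, simp)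
  also have "\<dots> = ennreal K * (\<integral>\<^sup>+x. ennreal ((cmod (\<psi> x))\<^sup>2) \<partial>lborel)"
    by (rule nn_integral_cmult) measurable
  finally show ?thesis
    using N2_nonneg K_nonneg by (simp add: ennreal_mult mult.assoc mult_left_mono)
qed

text \<open>The frequency-side integrand when D_n^l u is restricted to a hyperplane:
  \<open>\<psi>\<close> depends on the tangential frequencies only, so all decay in xi_n must come
  from \<open>g\<close>.\<close>

definition amp :: "('a \<Rightarrow> complex) \<Rightarrow> 'a \<times> real \<Rightarrow> complex" where
  "amp \<psi> \<xi> = of_real (snd \<xi>) ^ l * g \<xi> * \<psi> (fst \<xi>)"

lemma amp_measurable [measurable]:
  assumes [measurable]: "\<psi> \<in> borel_measurable borel"
  shows "amp \<psi> \<in> borel_measurable borel"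
proof -
  have mfst [measurable]: "(\<lambda>\<xi>::'a \<times> real. \<psi> (fst \<xi>)) \<in> borel_measurable borel"
    by (rule measurable_compose[OF borel_measurable_fst assms])
  note [measurable] = borel_measurable_snd
  show ?thesis unfolding amp_def[abs_def] by measurable
qed

lemma amp_bound:
  assumes \<psi>: "\<psi> \<in> borel_measurable borel" and L2: "integrable lborel (\<lambda>x. (cmod (\<psi> x))\<^sup>2)"
  shows "integrable lborel (amp \<psi>)"
    and "(LINT \<xi>|lborel. cmod (amp \<psi> \<xi>)) \<le> sqrt (N2 * K * (LINT x|lborel. (cmod (\<psi> x))\<^sup>2))"
proof -
  let ?J = "\<integral>\<^sup>+\<xi>. ennreal (cmod (amp \<psi> \<xi>)) \<partial>lborel"
  let ?R = "N2 * K * (LINT x|lborel. (cmod (\<psi> x))\<^sup>2)"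
  have "?J = (\<integral>\<^sup>+\<xi>. ennreal (\<bar>snd \<xi>\<bar> ^ l * cmod (g \<xi>) * cmod (\<psi> (fst \<xi>))) \<partial>lborel)"
    by (simp add: amp_def norm_mult norm_power)
  also have "\<dots>\<^sup>2 \<le> ennreal (N2 * K) * (\<integral>\<^sup>+x. ennreal ((cmod (\<psi> x))\<^sup>2) \<partial>lborel)"
    by (rule trace_Cauchy_Schwarz[OF \<psi>])
  also have "\<dots> = ennreal ?R"
    using N2_nonneg K_nonneg by (subst nn_integral_eq_integral[OF L2]) (auto simp: ennreal_mult)
  finally have J2: "?J\<^sup>2 \<le> ennreal ?R" by simp
  then have "?J\<^sup>2 < \<infinity>" by (simp add: le_less_trans[OF _ ennreal_less_top])
  then have "?J < \<infinity>" by (simp add: power_less_top_ennreal)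
  then show i: "integrable lborel (amp \<psi>)"
    using amp_measurable[OF \<psi>] by (simp add: integrable_iff_bounded)
  have "?J = ennreal (LINT \<xi>|lborel. cmod (amp \<psi> \<xi>))"
    by (rule nn_integral_eq_integral) (use i in auto)
  with J2 have "ennreal ((LINT \<xi>|lborel. cmod (amp \<psi> \<xi>))\<^sup>2) \<le> ennreal ?R"
    by (simp add: ennreal_power)
  moreover have "0 \<le> ?R" using N2_nonneg K_nonneg by (intro mult_nonneg_nonneg) auto
  ultimately have "(LINT \<xi>|lborel. cmod (amp \<psi> \<xi>))\<^sup>2 \<le> ?R" by (simp add: ennreal_le_iff)
  then show "(LINT \<xi>|lborel. cmod (amp \<psi> \<xi>)) \<le> sqrt ?R" by (rule real_le_rsqrt)
qed

text \<open>\<open>amp_bound\<close> involves its argument only through the L2 norm, so Parseval's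
  identity states the bound in terms of the test function itself.\<close>

lemma amp_schwartz:
  assumes "\<psi> \<in> schwartz"
  shows "integrable lborel (amp (fourier_inv \<psi>))"
    and "(LINT \<xi>|lborel. cmod (amp (fourier_inv \<psi>) \<xi>)) \<le> sqrt (N2 * K * (LINT x|lborel. (cmod (\<psi> x))\<^sup>2))"
  using amp_bound[of "fourier_inv \<psi>"] assms
  by (simp_all add: schwartz_measurable schwartz_fourier_inv schwartz_square_integrable parseval_fourier_inv)

text \<open>The inverse Fourier transform in all variables of \<open>\<xi>\<^sub>n\<^sup>l g\<close>, restricted to \<open>x\<^sub>n = t\<close>
  and tested against \<open>\<psi>\<close>.\<close>

definition trace_family :: "real \<Rightarrow> ('a \<Rightarrow> complex) \<Rightarrow> complex" where
  "trace_family t \<psi> = of_real (fourier_const TYPE(real)) *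
     (LINT \<xi>|lborel. cis (t * snd \<xi>) * amp (fourier_inv \<psi>) \<xi>)"

lemma cis_snd_measurable [measurable]: "(\<lambda>\<xi>::'a \<times> real. cis (t * snd \<xi>)) \<in> borel_measurable borel"
  by (intro borel_measurable_continuous_onI continuous_intros continuous_on_cis)

lemma integrable_cis_amp:
  "\<psi> \<in> schwartz \<Longrightarrow> integrable lborel (\<lambda>\<xi>. cis (t * snd \<xi>) * amp (fourier_inv \<psi>) \<xi>)"
  by (intro integrable_cis_mult amp_schwartz borel_measurable_continuous_onI continuous_intros)

lemma tempered_trace_family: "tempered (trace_family t)"
  unfolding tempered_def
proof (intro conjI ballI allI)
  fix \<phi> \<psi> :: "'a \<Rightarrow> complex" assume \<phi>: "\<phi> \<in> schwartz" and \<psi>: "\<psi> \<in> schwartz"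
  have "amp (fourier_inv (\<lambda>x. \<phi> x + \<psi> x)) \<xi> = amp (fourier_inv \<phi>) \<xi> + amp (fourier_inv \<psi>) \<xi>" for \<xi>
    using \<phi> \<psi> by (simp add: amp_def fourier_inv_def fourier_add schwartz_integrable distrib_left)
  then show "trace_family t (\<lambda>x. \<phi> x + \<psi> x) = trace_family t \<phi> + trace_family t \<psi>"
    using integrable_cis_amp[OF \<phi>] integrable_cis_amp[OF \<psi>]
    by (simp add: trace_family_def distrib_left)
next
  fix \<phi> :: "'a \<Rightarrow> complex" and c
  have "amp (fourier_inv (\<lambda>x. c * \<phi> x)) \<xi> = c * amp (fourier_inv \<phi>) \<xi>" for \<xi>
    by (simp add: amp_def fourier_inv_def fourier_cmult)
  then show "trace_family t (\<lambda>x. c * \<phi> x) = c * trace_family t \<phi>"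
    by (simp add: trace_family_def mult.left_commute[of _ c])
next
  let ?d = "DIM('a)"
  let ?I = "LINT x|lborel. 1 / (1 + norm (x :: 'a)) ^ (2 * ?d)"
  let ?C = "fourier_const TYPE(real) * sqrt (N2 * K * ?I)"
  \<comment> \<open>Order \<open>?d\<close> suffices for the seminorm: it bounds
    \<open>\<psi>\<close> by a multiple of (1 + |x|)^(-d), whose square is integrable.\<close>
  have "cmod (trace_family t \<psi>) \<le> ?C * schwartz_norm ?d \<psi>" if \<psi>: "\<psi> \<in> schwartz" for \<psi>
  proof -
    let ?s = "schwartz_norm ?d \<psi>"
    have s0: "0 \<le> ?s" using schwartz_norm_bound[OF \<psi>, of 0 ?d] by (smt (verit) mult_nonneg_nonneg norm_ge_zero zero_le_power)
    have "(LINT x|lborel. (cmod (\<psi> x))\<^sup>2) \<le> (LINT x|lborel. ?s\<^sup>2 * (1 / (1 + norm (x :: 'a)) ^ (2 * ?d)))"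
    proof (intro integral_mono schwartz_square_integrable \<psi> integrable_mult_right integrable_inverse_one_plus_norm)
      fix x :: 'a
      have p: "0 < (1 + norm x) ^ ?d" by (smt (verit) norm_ge_zero zero_less_power)
      have "cmod (\<psi> x) \<le> ?s / (1 + norm x) ^ ?d"
        using schwartz_norm_bound[OF \<psi>, of x ?d] p by (simp add: pos_le_divide_eq mult.commute)
      then have "(cmod (\<psi> x))\<^sup>2 \<le> (?s / (1 + norm x) ^ ?d)\<^sup>2" by (intro power_mono) auto
      then show "(cmod (\<psi> x))\<^sup>2 \<le> ?s\<^sup>2 * (1 / (1 + norm x) ^ (2 * ?d))"
        by (simp add: power_divide power_mult[symmetric] mult.commute)
    qed
    then have "(LINT x|lborel. (cmod (\<psi> x))\<^sup>2) \<le> ?s\<^sup>2 * ?I" by (simp only: integral_mult_right_zero)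
    then have "sqrt (N2 * K * (LINT x|lborel. (cmod (\<psi> x))\<^sup>2)) \<le> sqrt (N2 * K * (?s\<^sup>2 * ?I))"
      using N2_nonneg K_nonneg by (intro real_sqrt_le_mono mult_left_mono) auto
    also have "\<dots> = sqrt (N2 * K * ?I) * ?s"
      using s0 by (simp add: real_sqrt_mult)
    finally have J: "(LINT \<xi>|lborel. cmod (amp (fourier_inv \<psi>) \<xi>)) \<le> sqrt (N2 * K * ?I) * ?s"
      using amp_schwartz(2)[OF \<psi>] by linarith
    have "cmod (LINT \<xi>|lborel. cis (t * snd \<xi>) * amp (fourier_inv \<psi>) \<xi>) \<le> (LINT \<xi>|lborel. cmod (amp (fourier_inv \<psi>) \<xi>))"
      using integral_norm_bound[of lborel "\<lambda>\<xi>. cis (t * snd \<xi>) * amp (fourier_inv \<psi>) \<xi>"] by (simp add: norm_mult)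
    with J have "cmod (LINT \<xi>|lborel. cis (t * snd \<xi>) * amp (fourier_inv \<psi>) \<xi>) \<le> sqrt (N2 * K * ?I) * ?s" by linarith
    then show ?thesis
      unfolding trace_family_def norm_mult by (simp add: mult.assoc mult_left_mono)
  qed
  then show "\<exists>C N. \<forall>\<phi>\<in>schwartz. cmod (trace_family t \<phi>) \<le> C * schwartz_norm N \<phi>" by blast
qed

lemma continuous_trace_family:
  assumes \<psi>: "\<psi> \<in> schwartz"
  shows "continuous_on UNIV (\<lambda>t. trace_family t \<psi>)"
proof (rule continuous_on_sequentiallyI)
  fix s :: "nat \<Rightarrow> real" and t
  assume s: "s \<longlonglongrightarrow> t"
  have [measurable]: "amp (fourier_inv \<psi>) \<in> borel_measurable borel"
    by (intro amp_measurable schwartz_measurable schwartz_fourier_inv \<psi>)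
  have "(\<lambda>n. LINT \<xi>|lborel. cis (s n * snd \<xi>) * amp (fourier_inv \<psi>) \<xi>)
      \<longlonglongrightarrow> (LINT \<xi>|lborel. cis (t * snd \<xi>) * amp (fourier_inv \<psi>) \<xi>)"
  proof (rule integral_dominated_convergence[where w = "\<lambda>\<xi>. cmod (amp (fourier_inv \<psi>) \<xi>)"])
    show "AE \<xi> in lborel. (\<lambda>n. cis (s n * snd \<xi>) * amp (fourier_inv \<psi>) \<xi>) \<longlonglongrightarrow> cis (t * snd \<xi>) * amp (fourier_inv \<psi>) \<xi>"
      unfolding cis_conv_exp by (intro AE_I2 tendsto_intros s)
  qed (auto simp: norm_mult intro!: amp_schwartz \<psi>)
  then show "(\<lambda>n. trace_family (s n) \<psi>) \<longlonglongrightarrow> trace_family t \<psi>"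
    unfolding trace_family_def by (intro tendsto_intros)
qed


text \<open>The fourth power is chosen because the bound for the trace family takes a square root,
  and (1 + |t|)^(-2) is still integrable.\<close>

lemma slice_square_integral:
  fixes \<phi> :: "'a \<times> real \<Rightarrow> complex"
  assumes \<phi>: "\<phi> \<in> schwartz"
  obtains B where "0 \<le> B" "\<And>t. (LINT x|lborel. (cmod (\<phi> (x, t)))\<^sup>2) \<le> B / (1 + \<bar>t\<bar>) ^ 4"
proof -
  let ?d = "DIM('a)"
  let ?I = "LINT x|lborel. 1 / (1 + norm (x :: 'a)) ^ (2 * ?d)"
  \<comment> \<open>Of this decay, \<open>?d\<close> powers are spent on square integrability in
    \<open>x\<close>; the other two become the fourth power of 1 + |t| after squaring.\<close>
  obtain B where B: "0 < B" "\<And>x. cmod (\<phi> x) \<le> B / (1 + norm x) ^ (?d + 2)"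
    using schwartz_bounded[OF \<phi>] by blast
  show ?thesis
  proof (rule that[of "B\<^sup>2 * ?I"])
    have "0 \<le> ?I" by (rule integral_nonneg_AE) auto
    then show "0 \<le> B\<^sup>2 * ?I" by simp
    fix t :: real
    have "(LINT x|lborel. (cmod (\<phi> (x, t)))\<^sup>2) \<le> (LINT x|lborel. (B\<^sup>2 / (1 + \<bar>t\<bar>) ^ 4) * (1 / (1 + norm (x :: 'a)) ^ (2 * ?d)))"
    proof (intro integral_mono schwartz_square_integrable schwartz_slice \<phi> integrable_mult_right integrable_inverse_one_plus_norm)
      fix x :: 'a
      have p: "0 < (1 + norm x) ^ ?d * (1 + \<bar>t\<bar>)\<^sup>2"
        by (intro mult_pos_pos zero_less_power) (smt (verit) norm_ge_zero)+
      have "(1 + norm x) ^ ?d * (1 + \<bar>t\<bar>)\<^sup>2 \<le> (1 + norm (x, t)) ^ ?d * (1 + norm (x, t))\<^sup>2"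
        using norm_fst_le[of x t] norm_snd_le[of t x] by (intro mult_mono power_mono) auto
      then have "B / (1 + norm (x, t)) ^ (?d + 2) \<le> B / ((1 + norm x) ^ ?d * (1 + \<bar>t\<bar>)\<^sup>2)"
        unfolding power_add using B(1) p by (intro divide_left_mono mult_pos_pos[OF _ p]) (auto intro: less_le_trans[OF p])
      then have "cmod (\<phi> (x, t)) \<le> B / ((1 + norm x) ^ ?d * (1 + \<bar>t\<bar>)\<^sup>2)"
        using B(2)[of "(x, t)"] by linarith
      then have "(cmod (\<phi> (x, t)))\<^sup>2 \<le> (B / ((1 + norm x) ^ ?d * (1 + \<bar>t\<bar>)\<^sup>2))\<^sup>2"
        by (intro power_mono) auto
      also have "\<dots> = (B\<^sup>2 / (1 + \<bar>t\<bar>) ^ 4) * (1 / (1 + norm x) ^ (2 * ?d))"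
        by (simp add: power_divide power_mult_distrib power_mult[symmetric] mult.commute)
      finally show "(cmod (\<phi> (x, t)))\<^sup>2 \<le> (B\<^sup>2 / (1 + \<bar>t\<bar>) ^ 4) * (1 / (1 + norm x) ^ (2 * ?d))" .
    qed
    also have "\<dots> = B\<^sup>2 * ?I / (1 + \<bar>t\<bar>) ^ 4" by (subst integral_mult_right_zero) simp
    finally show "(LINT x|lborel. (cmod (\<phi> (x, t)))\<^sup>2) \<le> B\<^sup>2 * ?I / (1 + \<bar>t\<bar>) ^ 4" .
  qed
qed

text \<open>Absolute convergence for exchanging the integrals in \<open>has_trace_family\<close>: at
  fixed \<open>t\<close> the integral over frequencies is bounded by the L2 norm of the slice, which
  decays in \<open>t\<close>.\<close>

lemma integrable_trace_family:
  fixes \<phi> :: "'a \<times> real \<Rightarrow> complex"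
  assumes \<phi>: "\<phi> \<in> schwartz"
  shows "integrable (lborel \<Otimes>\<^sub>M lborel) (\<lambda>(t, \<xi>). cis (t * snd \<xi>) * amp (fourier_inv (\<lambda>x. \<phi> (x, t))) \<xi>)"
proof (rule lborel_pair.Fubini_integrable)
  have sl: "(\<lambda>x. \<phi> (x, t)) \<in> schwartz" for t by (rule schwartz_slice[OF \<phi>])
  have [measurable]: "\<phi> \<in> borel_measurable (borel \<Otimes>\<^sub>M borel)"
    using schwartz_measurable[OF \<phi>] by (simp add: borel_prod)
  have F [measurable]: "(\<lambda>p. fourier_inv (\<lambda>x. \<phi> (x, fst p)) (snd p)) \<in> borel_measurable (borel \<Otimes>\<^sub>M borel)"
    unfolding fourier_inv_altdef by measurable
  note [measurable] = borel_measurable_fst borel_measurable_snd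
  have "(\<lambda>p. fourier_inv (\<lambda>x. \<phi> (x, fst p)) (fst (snd p))) \<in> borel_measurable (lborel \<Otimes>\<^sub>M lborel)"
    using measurable_compose[OF _ F, of "\<lambda>p. (fst p, fst (snd p))" "lborel \<Otimes>\<^sub>M lborel"] by simp
  note [measurable] = this
  show H: "(\<lambda>(t, \<xi>). cis (t * snd \<xi>) * amp (fourier_inv (\<lambda>x. \<phi> (x, t))) \<xi>) \<in> borel_measurable (lborel \<Otimes>\<^sub>M lborel)"
    unfolding amp_def case_prod_beta' by measurable
  show "AE t in lborel. integrable lborel (\<lambda>\<xi>. case (t, \<xi>) of (t, \<xi>) \<Rightarrow> cis (t * snd \<xi>) * amp (fourier_inv (\<lambda>x. \<phi> (x, t))) \<xi>)"
    using integrable_cis_amp[OF sl] by simp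
  obtain B where B: "0 \<le> B" "\<And>t. (LINT x|lborel. (cmod (\<phi> (x, t)))\<^sup>2) \<le> B / (1 + \<bar>t\<bar>) ^ 4"
    using slice_square_integral[OF \<phi>] by blast
  show "integrable lborel (\<lambda>t. LINT \<xi>|lborel. norm (case (t, \<xi>) of (t, \<xi>) \<Rightarrow> cis (t * snd \<xi>) * amp (fourier_inv (\<lambda>x. \<phi> (x, t))) \<xi>))"
  proof (rule Bochner_Integration.integrable_bound)
    show "integrable lborel (\<lambda>t. sqrt (N2 * K * B) * (1 / (1 + norm (t::real)) ^ (2 * DIM(real))))"
      by (intro integrable_mult_right integrable_inverse_one_plus_norm)
    show "(\<lambda>t. LINT \<xi>|lborel. norm (case (t, \<xi>) of (t, \<xi>) \<Rightarrow> cis (t * snd \<xi>) * amp (fourier_inv (\<lambda>x. \<phi> (x, t))) \<xi>)) \<in> borel_measurable lborel"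
      by (intro lborel.borel_measurable_lebesgue_integral) (use H in \<open>simp add: case_prod_beta'\<close>)
    show "AE t in lborel. norm (LINT \<xi>|lborel. norm (case (t, \<xi>) of (t, \<xi>) \<Rightarrow> cis (t * snd \<xi>) * amp (fourier_inv (\<lambda>x. \<phi> (x, t))) \<xi>))
        \<le> norm (sqrt (N2 * K * B) * (1 / (1 + norm (t::real)) ^ (2 * DIM(real))))"
    proof (rule AE_I2)
      fix t :: real
      have "(LINT \<xi>|lborel. cmod (amp (fourier_inv (\<lambda>x. \<phi> (x, t))) \<xi>)) \<le> sqrt (N2 * K * (LINT x|lborel. (cmod (\<phi> (x, t)))\<^sup>2))"
        by (rule amp_schwartz(2)[OF sl])
      also have "\<dots> \<le> sqrt (N2 * K * (B / (1 + \<bar>t\<bar>) ^ 4))"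
        using N2_nonneg K_nonneg by (intro real_sqrt_le_mono mult_left_mono B) auto
      also have "\<dots> = sqrt (N2 * K * B) * (1 / (1 + \<bar>t\<bar>) ^ 2)"
      proof -
        have "(1 + \<bar>t\<bar>) ^ 4 = ((1 + \<bar>t\<bar>)\<^sup>2)\<^sup>2" by (simp flip: power_mult)
        then have "sqrt ((1 + \<bar>t\<bar>) ^ 4) = (1 + \<bar>t\<bar>)\<^sup>2" by (simp only: real_sqrt_abs abs_power2)
        then show ?thesis by (simp add: real_sqrt_divide)
      qed
      finally have J: "(LINT \<xi>|lborel. cmod (amp (fourier_inv (\<lambda>x. \<phi> (x, t))) \<xi>)) \<le> sqrt (N2 * K * B) * (1 / (1 + \<bar>t\<bar>) ^ 2)" .
      have "norm (LINT \<xi>|lborel. norm (case (t, \<xi>) of (t, \<xi>) \<Rightarrow> cis (t * snd \<xi>) * amp (fourier_inv (\<lambda>x. \<phi> (x, t))) \<xi>))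
          = (LINT \<xi>|lborel. cmod (amp (fourier_inv (\<lambda>x. \<phi> (x, t))) \<xi>))"
        by (simp add: norm_mult)
      also have "\<dots> \<le> \<bar>sqrt (N2 * K * B) * (1 / (1 + \<bar>t\<bar>) ^ 2)\<bar>"
        using J abs_ge_self by (rule order_trans)
      finally show "norm (LINT \<xi>|lborel. norm (case (t, \<xi>) of (t, \<xi>) \<Rightarrow> cis (t * snd \<xi>) * amp (fourier_inv (\<lambda>x. \<phi> (x, t))) \<xi>))
        \<le> norm (sqrt (N2 * K * B) * (1 / (1 + norm t) ^ (2 * DIM(real))))" by simp
    qed
  qed
qed

text \<open>After exchanging the integrals, the one over \<open>t\<close> assembles the slice
  transforms into \<open>fourier_inv \<phi>\<close>, and the formula of \<open>D_last_power\<close>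
  remains.\<close>

lemma has_trace_family:
  assumes u: "represents (fourier_distr u) g"
  shows "has_trace ((D_last ^^ l) u) (trace_family 0)"
  unfolding has_trace_def
proof (intro exI[of _ trace_family] conjI allI ballI refl tempered_trace_family continuous_trace_family)
  fix \<phi> :: "'a \<times> real \<Rightarrow> complex" assume \<phi>: "\<phi> \<in> schwartz"
  let ?H = "\<lambda>t \<xi>. cis (t * snd \<xi>) * amp (fourier_inv (\<lambda>x. \<phi> (x, t))) \<xi>"
  let ?c = "complex_of_real (fourier_const TYPE(real))"
  note i = integrable_trace_family[OF \<phi>]
  show "integrable lborel (\<lambda>t. trace_family t (\<lambda>x'. \<phi> (x', t)))"
    unfolding trace_family_def by (intro integrable_mult_right lborel_pair.integrable_fst i)
  have "(LINT t|lborel. trace_family t (\<lambda>x'. \<phi> (x', t))) = ?c * (LINT t|lborel. (LINT \<xi>|lborel. ?H t \<xi>))"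
    unfolding trace_family_def by simp
  also have "\<dots> = ?c * (LINT \<xi>|lborel. (LINT t|lborel. ?H t \<xi>))"
    by (simp only: lborel_pair.Fubini_integral[OF i])
  also have "\<dots> = (LINT \<xi>|lborel. g \<xi> * (of_real (snd \<xi>) ^ l * fourier_inv \<phi> \<xi>))"
  proof -
    have "?c * (LINT t|lborel. ?H t \<xi>) = g \<xi> * (of_real (snd \<xi>) ^ l * fourier_inv \<phi> \<xi>)" for \<xi>
    proof -
      have "?H t \<xi> = (of_real (snd \<xi>) ^ l * g \<xi>) * (cis (t * snd \<xi>) * fourier_inv (\<lambda>x. \<phi> (x, t)) (fst \<xi>))" for t
        by (simp add: amp_def mult_ac)
      then have "(LINT t|lborel. ?H t \<xi>)
          = (of_real (snd \<xi>) ^ l * g \<xi>) * (LINT t|lborel. cis (t * snd \<xi>) * fourier_inv (\<lambda>x. \<phi> (x, t)) (fst \<xi>))"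
        by (simp only: integral_mult_right_zero)
      moreover have "fourier_inv \<phi> \<xi> = ?c * (LINT t|lborel. cis (t * snd \<xi>) * fourier_inv (\<lambda>x. \<phi> (x, t)) (fst \<xi>))"
        using fourier_inv_slices[OF \<phi>, of "fst \<xi>" "snd \<xi>"] by simp
      ultimately show ?thesis by (simp add: mult_ac)
    qed
    then show ?thesis by (simp flip: integral_mult_right_zero)
  qed
  also have "\<dots> = (D_last ^^ l) u \<phi>" by (rule D_last_power[OF u \<phi>, symmetric])
  finally show "(D_last ^^ l) u \<phi> = (LINT t|lborel. trace_family t (\<lambda>x'. \<phi> (x', t)))" ..
qed

definition trace_density :: "'a \<Rightarrow> complex" where
  "trace_density x = of_real (fourier_const TYPE(real)) * (LINT t|lborel. of_real t ^ l * g (x, t))"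

lemma trace_density_measurable [measurable]: "trace_density \<in> borel_measurable borel"
  unfolding trace_density_def[abs_def] by measurable

text \<open>The transform of \<open>v\<close> is tested through \<open>fourier \<phi>\<close>. At t
  = 0 the factor \<open>cis\<close> is 1 and \<open>fourier_inv\<close> undoes
  \<open>fourier\<close>, so Fubini leaves the integral of \<open>g\<close> over the normal
  frequency.\<close>

lemma represents_trace_density:
  assumes v: "\<And>\<psi>. \<psi> \<in> schwartz \<Longrightarrow> v \<psi> = trace_family 0 \<psi>"
  shows "represents (fourier_distr v) trace_density"
  unfolding represents_def
proof (intro conjI ballI)
  show "trace_density \<in> borel_measurable lborel" by simp
  fix \<phi> :: "'a \<Rightarrow> complex" assume \<phi>: "\<phi> \<in> schwartz"
  have "integrable lborel (amp \<phi>)"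
    by (rule amp_bound[OF schwartz_measurable[OF \<phi>] schwartz_square_integrable[OF \<phi>]])
  then have i: "integrable (lborel \<Otimes>\<^sub>M lborel) (\<lambda>(x, t). of_real t ^ l * g (x, t) * \<phi> x)"
    by (simp add: amp_def[abs_def] lborel_prod case_prod_beta')
  have e: "trace_density x * \<phi> x = of_real (fourier_const TYPE(real)) * (LINT t|lborel. of_real t ^ l * g (x, t) * \<phi> x)" for x
    by (simp add: trace_density_def)
  show "integrable lborel (\<lambda>x. trace_density x * \<phi> x)"
    unfolding e by (intro integrable_mult_right lborel_pair.integrable_fst i)
  have "fourier_distr v \<phi> = trace_family 0 (fourier \<phi>)"
    unfolding fourier_distr_def by (rule v[OF schwartz_fourier[OF \<phi>]])
  also have "\<dots> = of_real (fourier_const TYPE(real)) * integral\<^sup>L lborel (amp \<phi>)"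
    by (simp add: trace_family_def fourier_inv_fourier[OF \<phi>])
  also have "integral\<^sup>L lborel (amp \<phi>) = integral\<^sup>L (lborel \<Otimes>\<^sub>M lborel) (\<lambda>(x, t). of_real t ^ l * g (x, t) * \<phi> x)"
    by (simp add: amp_def[abs_def] lborel_prod case_prod_beta')
  also have "\<dots> = (LINT x|lborel. (LINT t|lborel. of_real t ^ l * g (x, t) * \<phi> x))"
    by (rule lborel_pair.integral_fst[OF i, symmetric])
  finally show "fourier_distr v \<phi> = (LINT x|lborel. trace_density x * \<phi> x)"
    unfolding e by simp
qed

text \<open>Cauchy-Schwarz in \<open>t\<close> alone. Unlike \<open>trace_Cauchy_Schwarz\<close> it
  keeps the integral of t^(2l) / Xi^2 as a function of \<open>x\<close>, so that the trace weight
  can be set against it.\<close>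

lemma trace_density_bound:
  "ennreal ((cmod (trace_density x))\<^sup>2) \<le> (\<integral>\<^sup>+t. ennreal ((\<bar>t\<bar> ^ l / \<Xi> (x, t))\<^sup>2) \<partial>lborel) *
    (\<integral>\<^sup>+t. ennreal ((\<Xi> (x, t) * cmod (g (x, t)))\<^sup>2) \<partial>lborel)"
proof -
  let ?f = "\<lambda>t. complex_of_real t ^ l * g (x, t)"
  let ?A = "\<lambda>t. ennreal (\<bar>t\<bar> ^ l / \<Xi> (x, t))" and ?B = "\<lambda>t. ennreal (\<Xi> (x, t) * cmod (g (x, t)))"
  have "fourier_const TYPE(real) \<le> (2 * pi) powr 0"
    using pi_ge_two by (intro powr_mono) auto
  then have c: "fourier_const TYPE(real) \<le> 1" by simp
  have "ennreal (cmod (trace_density x)) \<le> ennreal (cmod (integral\<^sup>L lborel ?f))"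
    unfolding trace_density_def norm_mult using c by (intro ennreal_leI mult_left_le_one_le) auto
  also have "\<dots> \<le> (\<integral>\<^sup>+t. ennreal (cmod (?f t)) \<partial>lborel)"
  \<comment> \<open>Where the integrand is not integrable, the integral is 0 by convention and the
    bound is trivial.\<close>
  proof (cases "integrable lborel ?f")
    case True then show ?thesis by (rule integral_norm_bound_ennreal)
  qed (simp add: not_integrable_integral_eq)
  also have "\<dots> = (\<integral>\<^sup>+t. ?A t * ?B t \<partial>lborel)"
  proof (rule nn_integral_cong)
    fix t
    show "ennreal (cmod (?f t)) = ?A t * ?B t"
      using \<Xi>_pos[of "(x, t)"] by (simp add: ennreal_mult[symmetric] less_imp_le norm_mult norm_power)
  qed
  finally have "(ennreal (cmod (trace_density x)))\<^sup>2 \<le> (\<integral>\<^sup>+t. ?A t * ?B t \<partial>lborel)\<^sup>2"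
    by (rule power_mono) simp
  also have "\<dots> \<le> (\<integral>\<^sup>+t. (?A t)\<^sup>2 \<partial>lborel) * (\<integral>\<^sup>+t. (?B t)\<^sup>2 \<partial>lborel)"
    by (rule Cauchy_Schwarz_nn_integral; measurable)
  finally show ?thesis
    using \<Xi>_pos by (simp add: ennreal_power less_imp_le)
qed

text \<open>Multiplied by the squared weight, the first factor of the pointwise bound is at most
  \<open>C\<close>; integrating the second over \<open>x\<close> gives the squared norm of
  \<open>g\<close>.\<close>

lemma weighted_trace_density:
  assumes [measurable]: "w \<in> borel_measurable borel" and C: "0 \<le> C"
    and w: "AE x in lborel. ennreal ((w x)\<^sup>2) * (\<integral>\<^sup>+t. ennreal ((\<bar>t\<bar> ^ l / \<Xi> (x, t))\<^sup>2) \<partial>lborel) \<le> ennreal C"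
  shows "in_L2 (\<lambda>x. of_real (w x) * trace_density x)"
    and "L2_norm (\<lambda>x. of_real (w x) * trace_density x) \<le> sqrt C * L2_norm (\<lambda>\<xi>. of_real (\<Xi> \<xi>) * g \<xi>)"
proof -
  let ?h = "\<lambda>x. (cmod (of_real (w x) * trace_density x))\<^sup>2"
  have "(\<integral>\<^sup>+x. ennreal (?h x) \<partial>lborel) \<le>
      (\<integral>\<^sup>+x. ennreal C * (\<integral>\<^sup>+t. ennreal ((\<Xi> (x, t) * cmod (g (x, t)))\<^sup>2) \<partial>lborel) \<partial>lborel)"
  proof (rule nn_integral_mono_AE)
    show "AE x in lborel. ennreal (?h x) \<le> ennreal C * (\<integral>\<^sup>+t. ennreal ((\<Xi> (x, t) * cmod (g (x, t)))\<^sup>2) \<partial>lborel)"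
      using w
    proof eventually_elim
      case (elim x)
      have "ennreal (?h x) = ennreal ((w x)\<^sup>2) * ennreal ((cmod (trace_density x))\<^sup>2)"
        by (simp add: norm_mult power_mult_distrib ennreal_mult)
      also have "\<dots> \<le> ennreal ((w x)\<^sup>2) * ((\<integral>\<^sup>+t. ennreal ((\<bar>t\<bar> ^ l / \<Xi> (x, t))\<^sup>2) \<partial>lborel) *
          (\<integral>\<^sup>+t. ennreal ((\<Xi> (x, t) * cmod (g (x, t)))\<^sup>2) \<partial>lborel))"
        by (intro mult_left_mono trace_density_bound) simp
      also have "\<dots> \<le> ennreal C * (\<integral>\<^sup>+t. ennreal ((\<Xi> (x, t) * cmod (g (x, t)))\<^sup>2) \<partial>lborel)"
        unfolding mult.assoc[symmetric] by (intro mult_right_mono elim) simp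
      finally show ?case .
    qed
  qed
  also have "\<dots> = ennreal C * ennreal N2"
    by (subst nn_integral_cmult, measurable, subst nn_integral_split_pair[symmetric], measurable)
       (simp add: nn_integral_square_g)
  finally have le: "(\<integral>\<^sup>+x. ennreal (?h x) \<partial>lborel) \<le> ennreal (C * N2)"
    using C N2_nonneg by (simp add: ennreal_mult)
  have i: "integrable lborel ?h"
    unfolding integrable_iff_bounded
    using le_less_trans[OF le ennreal_less_top] by simp
  then show "in_L2 (\<lambda>x. of_real (w x) * trace_density x)" by (simp add: in_L2_def)
  have "ennreal (integral\<^sup>L lborel ?h) \<le> ennreal (C * N2)"
    using le nn_integral_eq_integral[OF i] by simp
  then have "integral\<^sup>L lborel ?h \<le> C * N2"
    using C N2_nonneg by (simp add: ennreal_le_iff)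
  then have "sqrt (integral\<^sup>L lborel ?h) \<le> sqrt (C * N2)" by (rule real_sqrt_le_mono)
  then show "L2_norm (\<lambda>x. of_real (w x) * trace_density x) \<le> sqrt C * L2_norm (\<lambda>\<xi>. of_real (\<Xi> \<xi>) * g \<xi>)"
    by (simp add: L2_norm_def N2_def real_sqrt_mult)
qed

end

section \<open>The trace estimate for Newton polygon weights\<close>

lemma shifted_weight_measurable [measurable]:
  "(\<lambda>x :: 'a::euclidean_space. shifted_weight P \<rho> (x, 0 :: real) lam) \<in> borel_measurable borel"
proof -
  have "norm (x, 0 :: real) = norm x" for x :: 'a by simp
  then show ?thesis unfolding shifted_weight_def real_exp_pow_def split_beta by simp
qed

text \<open>\<open>M\<close> and \<open>l\<close> supply the crude bound behind the existence of the
  trace, \<open>C\<close> the sharp one behind its norm; the omitted point \<open>x = 0\<close> is a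
  null set. Any trace \<open>v\<close> agrees with the constructed one on test functions, so its
  transform is \<open>trace_density\<close>.\<close>

lemma trace_estimate:
  fixes u :: "('a::euclidean_space \<times> real) distr" and P :: "('m::finite) symbol"
  assumes M: "(real M, 0) \<in> newton_polygon P" and l: "l < M"
    and u: "u \<in> H_space (\<lambda>\<xi>. newton_weight P \<xi> lam)" and lam: "lam \<noteq> 0"
    and C: "0 < C" "\<And>(x :: 'a). x \<noteq> 0 \<Longrightarrow>
      ennreal ((shifted_weight P (real l + 1/2) (x, 0 :: real) lam)\<^sup>2) *
      (\<integral>\<^sup>+t. ennreal ((\<bar>t\<bar> ^ l / newton_weight P (x, t :: real) lam)\<^sup>2) \<partial>lborel) \<le> ennreal C"
  shows "\<exists>v. has_trace ((D_last ^^ l) u) v"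
    and "has_trace ((D_last ^^ l) u) v \<Longrightarrow>
      v \<in> H_space (\<lambda>x. shifted_weight P (real l + 1/2) (x, 0 :: real) lam) \<and>
      H_norm (\<lambda>x. shifted_weight P (real l + 1/2) (x, 0 :: real) lam) v
        \<le> sqrt C * H_norm (\<lambda>\<xi>. newton_weight P \<xi> lam) u"
proof -
  let ?\<Xi> = "\<lambda>\<xi> :: 'a \<times> real. newton_weight P \<xi> lam"
  let ?w = "\<lambda>x :: 'a. shifted_weight P (real l + 1/2) (x, 0 :: real) lam"
  obtain g where g: "represents (fourier_distr u) g" "in_L2 (\<lambda>\<xi>. of_real (?\<Xi> \<xi>) * g \<xi>)"
    using u by (auto simp: H_space_def)
  obtain K where K: "0 \<le> K" "\<And>(x :: 'a) lam.
      (\<integral>\<^sup>+t. ennreal ((\<bar>t\<bar> ^ l / newton_weight P (x, t :: real) lam)\<^sup>2) \<partial>lborel) \<le> ennreal K"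
    using nn_integral_trace_uniform[OF M l, where 'a = 'a] by blast
  interpret trace_data ?\<Xi> g l K
  proof
    show "0 < newton_weight P \<xi> lam" for \<xi> :: "'a \<times> real"
      using newton_weight_ge_1[of P \<xi> lam] by linarith
  qed (use g K newton_weight_measurable in \<open>auto simp: represents_def in_L2_def\<close>)
  note tr = has_trace_family[OF g(1)]
  then show "\<exists>v. has_trace ((D_last ^^ l) u) v" by blast
  assume v: "has_trace ((D_last ^^ l) u) v"
  then have "tempered v" by (auto simp: has_trace_def)
  have d: "represents (fourier_distr v) trace_density"
    by (rule represents_trace_density) (rule has_trace_unique[OF v tr])
  have "AE x in lborel. ennreal ((?w x)\<^sup>2) * (\<integral>\<^sup>+t. ennreal ((\<bar>t\<bar> ^ l / ?\<Xi> (x, t))\<^sup>2) \<partial>lborel) \<le> ennreal C"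
    using AE_lborel_singleton[of "0 :: 'a"] by eventually_elim (rule C(2))
  note b = weighted_trace_density[OF shifted_weight_measurable less_imp_le[OF C(1)] this]
  show "v \<in> H_space ?w \<and> H_norm ?w v \<le> sqrt C * H_norm ?\<Xi> u"
    unfolding L2_norm_fourier_fun(2)[OF d shifted_weight_measurable]
      L2_norm_fourier_fun(2)[OF g(1) newton_weight_measurable]
    using \<open>tempered v\<close> d b by (auto simp: H_space_def)
qed

theorem theorem2p9:
  fixes P :: "('m::finite) symbol"
    and S :: nat and a b :: "nat \<Rightarrow> nat" and m :: "nat \<Rightarrow> int" and lam0 :: real
  assumes vertices: "clockwise_vertices
      ((0, 0) # map (\<lambda>s. (real (a s), real (b s))) [1..<S + 2]) (newton_polygon P)"
    and "1 \<le> S" and "a 1 = 0" and "b (S + 1) = 0"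
    and last_side_not_vertical: "a S \<noteq> a (S + 1)"
    and m_def: "\<And>s. s \<in> {1..S} \<Longrightarrow> 2 * m s = int (a (s + 1)) - int (a s)"
    and "0 < lam0"
  shows "\<exists>C>0. \<forall>l::nat. int l \<le> (\<Sum>s=1..S. 2 * m s) - 1 \<longrightarrow>
    (\<forall>lam::complex. lam0 \<le> cmod lam \<longrightarrow>
      (\<forall>u :: ((real ^ 'm) \<times> real) distr. u \<in> H_space (\<lambda>\<xi>. newton_weight P \<xi> lam) \<longrightarrow>
        (\<exists>v. has_trace ((D_last ^^ l) u) v) \<and>
        (\<forall>v. has_trace ((D_last ^^ l) u) v \<longrightarrow>
          v \<in> H_space (\<lambda>\<xi>'. shifted_weight P (real l + 1 / 2) (\<xi>', 0::real) lam) \<and>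
          H_norm (\<lambda>\<xi>'. shifted_weight P (real l + 1 / 2) (\<xi>', 0::real) lam) v
            \<le> C * H_norm (\<lambda>\<xi>. newton_weight P \<xi> lam) u)))"
proof -
  define M where "M = a (S + 1)"
  \<comment> \<open>The numbers \<open>2 * m s\<close> are the horizontal widths of the sides, so
    their sum telescopes to the abscissa of the last vertex and the condition on l becomes l <
    M.\<close>
  have "(\<Sum>s=1..S. 2 * m s) = (\<Sum>s=1..S. int (a (Suc s)) - int (a s))"
    by (intro sum.cong) (auto simp: m_def)
  also have "\<dots> = int M"
    using \<open>a 1 = 0\<close> by (subst sum_Suc_diff) (simp_all add: M_def)
  finally have sum_m: "(\<Sum>s=1..S. 2 * m s) = int M" .
  have "(real M, 0) \<in> set ((0, 0) # map (\<lambda>s. (real (a s), real (b s))) [1..<S + 2])"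
    using \<open>b (S + 1) = 0\<close> by (auto simp: M_def image_iff intro!: bexI[of _ "S + 1"])
  then have "(real M, 0) extreme_point_of newton_polygon P"
    using vertices by (auto simp: clockwise_vertices_def)
  then have M: "(real M, 0) \<in> newton_polygon P" by (simp add: extreme_point_of_def)
  define Q where "Q l C \<longleftrightarrow> 0 < C \<and> (\<forall>(x :: real ^ 'm) lam. x \<noteq> 0 \<longrightarrow> lam \<noteq> 0 \<longrightarrow>
    ennreal ((shifted_weight P (real l + 1/2) (x, 0 :: real) lam)\<^sup>2) *
      (\<integral>\<^sup>+t. ennreal ((\<bar>t\<bar> ^ l / newton_weight P (x, t :: real) lam)\<^sup>2) \<partial>lborel) \<le> ennreal C)" for l C
  have "\<exists>C. Q l C" for l
  proof (rule nn_integral_shifted_weight[where 'a = "real ^ 'm"])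
    fix C :: real
    assume "0 < C" and "\<And>(x :: real ^ 'm) lam. x \<noteq> 0 \<Longrightarrow> lam \<noteq> 0 \<Longrightarrow>
      ennreal ((shifted_weight P (real l + 1/2) (x, 0 :: real) lam)\<^sup>2) *
      (\<integral>\<^sup>+t. ennreal ((\<bar>t\<bar> ^ l / newton_weight P (x, t :: real) lam)\<^sup>2) \<partial>lborel) \<le> ennreal C"
    then have "Q l C" unfolding Q_def by blast
    then show ?thesis ..
  qed
  then obtain C where Q: "\<And>l. Q l (C l)" by metis
  then have C0: "0 < C l" for l by (simp add: Q_def)
  \<comment> \<open>Only finitely many l are admissible, so a sum dominates all their constants; the
    1 covers M = 0.\<close>
  let ?C = "(\<Sum>l<M. sqrt (C l)) + 1"
  show ?thesis
  proof (intro exI[of _ ?C] conjI allI impI)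
    show "0 < ?C" using C0 by (intro add_nonneg_pos sum_nonneg) (auto intro: less_imp_le)
    fix l :: nat and lam :: complex and u :: "((real ^ 'm) \<times> real) distr"
    assume "int l \<le> (\<Sum>s=1..S. 2 * m s) - 1" and lam: "lam0 \<le> cmod lam"
      and u: "u \<in> H_space (\<lambda>\<xi>. newton_weight P \<xi> lam)"
    then have "int l \<le> int M - 1" by (simp only: sum_m)
    then have l: "l < M" by linarith
    have "lam \<noteq> 0" using lam \<open>0 < lam0\<close> by auto
    then have K: "\<And>(x :: real ^ 'm). x \<noteq> 0 \<Longrightarrow>
      ennreal ((shifted_weight P (real l + 1/2) (x, 0 :: real) lam)\<^sup>2) *
      (\<integral>\<^sup>+t. ennreal ((\<bar>t\<bar> ^ l / newton_weight P (x, t :: real) lam)\<^sup>2) \<partial>lborel) \<le> ennreal (C l)"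
      using Q[of l] unfolding Q_def by blast
    note est = trace_estimate[OF M l u \<open>lam \<noteq> 0\<close> C0 K]
    show "\<exists>v. has_trace ((D_last ^^ l) u) v" by (rule est(1))
    fix v assume v: "has_trace ((D_last ^^ l) u) v"
    show "v \<in> H_space (\<lambda>\<xi>'. shifted_weight P (real l + 1 / 2) (\<xi>', 0::real) lam)"
      using est(2)[OF _ v] by blast
    have "sqrt (C l) \<le> (\<Sum>l<M. sqrt (C l))"
      using l C0 by (intro member_le_sum) (auto intro: less_imp_le)
    then have "sqrt (C l) \<le> ?C" by linarith
    moreover have "0 \<le> H_norm (\<lambda>\<xi>. newton_weight P \<xi> lam) u" by (simp add: H_norm_def L2_norm_def)
    ultimately have "sqrt (C l) * H_norm (\<lambda>\<xi>. newton_weight P \<xi> lam) u \<le> ?C * H_norm (\<lambda>\<xi>. newton_weight P \<xi> lam) u"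
      by (rule mult_right_mono)
    with est(2)[OF _ v] show "H_norm (\<lambda>\<xi>'. shifted_weight P (real l + 1 / 2) (\<xi>', 0::real) lam) v
        \<le> ?C * H_norm (\<lambda>\<xi>. newton_weight P \<xi> lam) u"
      by linarith
  qed
qed

end
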